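(* Let $A$ be a scaled approximately unital Banach algebra, let $p$ be a central open projection in $A^{**}$, and let $J=pA^{**}\cap A$ be the corresponding ideal. Then $F_p=Q(A)\cap J^\perp$, and this is a weak* closed face of $Q(A)$. Moreover, the assignment $p\mapsto F_p$ from the set of central open projections (equivalently $J\mapsto F_{s_J}$ from the set of $M$-ideal ideals of $A$) into the set of weak* closed faces of $Q(A)$ is one-to-one and is an order-reversing order embedding: $p_1\le p_2$ iff $F_{p_2}\subseteq F_{p_1}$. Furthermore, if $\{J_i:i\in I\}$ is any family of $M$-ideal ideals of $A$ and $J$ is the closure of their span, then $F_{s_J}=\bigcap_i F_{s_{J_i}}$.
   Context: Banach algebras are complex with submultiplicative norm; "unital" means identity of norm 1; approximately unital means having a contractive approximate identity. Multiplier unitization $A^1$: $A$ if unital, otherwise $A+\mathbb{C}1$ with $\|a+\lambda1\|=\sup\{\|ac+\lambda c\|:c\in A,\|c\|\le1\}$. States of a unital Banach algebra: $\|\varphi\|=\varphi(1)=1$. $S(A)$: norm-one functionals on $A$ extending to states of $A^1$; $Q(A)=\{t\varphi:t\in[0,1],\varphi\in S(A)\}$. ${\mathfrak r}_A=\{a:\mathrm{Re}\,\varphi(a)\ge0$ for all states $\varphi$ of $A^1\}$; ${\mathfrak c}_{A^*}=\{\varphi\in A^*:\mathrm{Re}\,\varphi\ge0$ on ${\mathfrak r}_A\}$; $A$ is scaled if ${\mathfrak c}_{A^*}=\{t\varphi:t\ge0,\varphi\in S(A)\}$. Biduals use the second Arens product, $A^{**}\cong A^{\perp\perp}\subset(A^1)^{**}$.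 A subspace $J$ of a Banach space $X$ is an $M$-ideal if $J^{\perp\perp}$ is the range of a projection $P$ on $X^{**}$ with $\|\eta\|=\max\{\|P\eta\|,\|\eta-P\eta\|\}$. An $M$-ideal ideal of $A$ is a subspace $J$ which is an $M$-ideal in $A^1$ such that $z=P(1)$ (with $P$ the corresponding projection on $(A^1)^{**}$) commutes with all of $A^{**}$; then $z\in A^{**}$ is an idempotent, the support projection $s_J$, with $J=s_JA^{**}\cap A$. A central open projection is an element of the form $s_J$ for an $M$-ideal ideal $J$. For projections, $p\le q$ means $pq=qp=p$. For a central open projection $p$, $F_p=\{\varphi\in Q(A):\langle p,\varphi\rangle=0\}$, using the canonical pairing of $A^{**}$ with $A^*$. $J^\perp$ is the annihilator of $J$ in $A^*$. *)

theory Defs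
  imports "HOL-Analysis.Analysis"
begin

text \<open>A complex Banach algebra is modelled as a type 'a of class real_normed_algebra and banach
  (submultiplicative norm, complete, associative, possibly noncommutative and nonunital),
  together with a complex scalar multiplication cs extending the real one.\<close>

definition cbanach_alg :: "(complex \<Rightarrow> 'a::{real_normed_algebra,banach} \<Rightarrow> 'a) \<Rightarrow> bool" where
  "cbanach_alg cs \<longleftrightarrow>
     (\<forall>r x. cs (complex_of_real r) x = r *\<^sub>R x) \<and>
     (\<forall>a b x. cs a (cs b x) = cs (a * b) x) \<and>
     (\<forall>x. cs 1 x = x) \<and>
     (\<forall>a x y. cs a (x + y) = cs a x + cs a y) \<and>
     (\<forall>a b x. cs (a + b) x = cs a x + cs b x) \<and>
     (\<forall>a x. norm (cs a x) = cmod a * norm x) \<and>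
     (\<forall>a x y. cs a (x * y) = cs a x * y) \<and>
     (\<forall>a x y. cs a (x * y) = x * cs a y)"

text \<open>Approximately unital: existence of a contractive approximate identity. A net is
  represented by its image filter on 'a (a proper filter), which is equivalent.\<close>

definition approx_unital :: "'a::real_normed_algebra itself \<Rightarrow> bool" where
  "approx_unital _ \<longleftrightarrow> (\<exists>F::'a filter. F \<noteq> bot \<and> eventually (\<lambda>e. norm e \<le> 1) F \<and>
      (\<forall>a. ((\<lambda>e. e * a) \<longlongrightarrow> a) F \<and> ((\<lambda>e. a * e) \<longlongrightarrow> a) F))"

definition bdd_clf :: "'v set \<Rightarrow> ('v \<Rightarrow> 'v \<Rightarrow> 'v) \<Rightarrow> (complex \<Rightarrow> 'v \<Rightarrow> 'v) \<Rightarrow> ('v \<Rightarrow> real)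
                        \<Rightarrow> ('v \<Rightarrow> complex) \<Rightarrow> bool" where
  "bdd_clf D ad sm nm f \<longleftrightarrow>
     (\<forall>x\<in>D. \<forall>y\<in>D. f (ad x y) = f x + f y) \<and>
     (\<forall>c. \<forall>x\<in>D. f (sm c x) = c * f x) \<and>
     (\<exists>K. \<forall>x\<in>D. cmod (f x) \<le> K * nm x) \<and>
     (\<forall>x. x \<notin> D \<longrightarrow> f x = 0)"

definition gdual :: "'v set \<Rightarrow> ('v \<Rightarrow> 'v \<Rightarrow> 'v) \<Rightarrow> (complex \<Rightarrow> 'v \<Rightarrow> 'v) \<Rightarrow> ('v \<Rightarrow> real)
                        \<Rightarrow> ('v \<Rightarrow> complex) set" where
  "gdual D ad sm nm = {f. bdd_clf D ad sm nm f}"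

definition gdnorm :: "'v set \<Rightarrow> ('v \<Rightarrow> real) \<Rightarrow> ('v \<Rightarrow> complex) \<Rightarrow> real" where
  "gdnorm D nm f = Sup {cmod (f x) | x. x \<in> D \<and> nm x \<le> 1}"

definition fadd :: "('v \<Rightarrow> complex) \<Rightarrow> ('v \<Rightarrow> complex) \<Rightarrow> 'v \<Rightarrow> complex" where
  "fadd f g = (\<lambda>x. f x + g x)"

definition fsm :: "complex \<Rightarrow> ('v \<Rightarrow> complex) \<Rightarrow> 'v \<Rightarrow> complex" where
  "fsm c f = (\<lambda>x. c * f x)"

text \<open>Canonical embedding into the bidual and the second Arens product on the bidual
  of an algebra with multiplication m (D1 = the dual space):
  (a.f)(b) = f(b a),  (f.eta)(a) = eta(a.f),  (eta <> xi)(f) = xi(f.eta).\<close>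

definition cemb :: "('v \<Rightarrow> complex) set \<Rightarrow> 'v \<Rightarrow> ('v \<Rightarrow> complex) \<Rightarrow> complex" where
  "cemb D1 x = (\<lambda>f. if f \<in> D1 then f x else 0)"

definition arens2 :: "('v \<Rightarrow> complex) set \<Rightarrow> ('v \<Rightarrow> 'v \<Rightarrow> 'v)
     \<Rightarrow> (('v \<Rightarrow> complex) \<Rightarrow> complex) \<Rightarrow> (('v \<Rightarrow> complex) \<Rightarrow> complex) \<Rightarrow> ('v \<Rightarrow> complex) \<Rightarrow> complex" where
  "arens2 D1 m \<eta> \<xi> = (\<lambda>f. if f \<in> D1 then \<xi> (\<lambda>a. \<eta> (\<lambda>b. f (m b a))) else 0)"

definition dualA :: "(complex \<Rightarrow> 'a::{real_normed_algebra,banach} \<Rightarrow> 'a) \<Rightarrow> ('a \<Rightarrow> complex) set" where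
  "dualA cs = gdual UNIV (+) cs norm"

definition dnormA :: "('a::{real_normed_algebra,banach} \<Rightarrow> complex) \<Rightarrow> real" where
  "dnormA f = gdnorm UNIV norm f"

definition bidualA :: "(complex \<Rightarrow> 'a::{real_normed_algebra,banach} \<Rightarrow> 'a)
                        \<Rightarrow> (('a \<Rightarrow> complex) \<Rightarrow> complex) set" where
  "bidualA cs = gdual (dualA cs) fadd fsm dnormA"

definition prodA :: "(complex \<Rightarrow> 'a::{real_normed_algebra,banach} \<Rightarrow> 'a)
     \<Rightarrow> (('a \<Rightarrow> complex) \<Rightarrow> complex) \<Rightarrow> (('a \<Rightarrow> complex) \<Rightarrow> complex) \<Rightarrow> ('a \<Rightarrow> complex) \<Rightarrow> complex" where
  "prodA cs = arens2 (dualA cs) (*)"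

definition embA :: "(complex \<Rightarrow> 'a::{real_normed_algebra,banach} \<Rightarrow> 'a) \<Rightarrow> 'a \<Rightarrow> ('a \<Rightarrow> complex) \<Rightarrow> complex" where
  "embA cs = cemb (dualA cs)"

text \<open>A^1 is represented by pairs (a, lambda) standing for a + lambda 1, with the
  seminorm sup{norm (a c + lambda c) : norm c \<le> 1}. If A is non-unital this is the norm of
  A^1 from the paper; if A has an identity e of norm 1 it is the seminorm
  norm (a + lambda e), whose quotient is A = A^1. Duals and biduals of a seminormed space
  coincide with those of its normed quotient, so this represents (A^1)* and (A^1)** in
  both cases.\<close>

definition add1 :: "'a::{real_normed_algebra,banach} \<times> complex \<Rightarrow> 'a \<times> complex \<Rightarrow> 'a \<times> complex" where
  "add1 x y = (fst x + fst y, snd x + snd y)"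

definition sm1 :: "(complex \<Rightarrow> 'a::{real_normed_algebra,banach} \<Rightarrow> 'a) \<Rightarrow> complex \<Rightarrow> 'a \<times> complex \<Rightarrow> 'a \<times> complex" where
  "sm1 cs c x = (cs c (fst x), c * snd x)"

definition norm1 :: "(complex \<Rightarrow> 'a::{real_normed_algebra,banach} \<Rightarrow> 'a) \<Rightarrow> 'a \<times> complex \<Rightarrow> real" where
  "norm1 cs x = Sup {norm (fst x * c + cs (snd x) c) | c. norm c \<le> 1}"

definition mult1 :: "(complex \<Rightarrow> 'a::{real_normed_algebra,banach} \<Rightarrow> 'a) \<Rightarrow> 'a \<times> complex \<Rightarrow> 'a \<times> complex \<Rightarrow> 'a \<times> complex" where
  "mult1 cs x y = (fst x * fst y + cs (snd y) (fst x) + cs (snd x) (fst y), snd x * snd y)"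

definition dual1 :: "(complex \<Rightarrow> 'a::{real_normed_algebra,banach} \<Rightarrow> 'a) \<Rightarrow> ('a \<times> complex \<Rightarrow> complex) set" where
  "dual1 cs = gdual UNIV add1 (sm1 cs) (norm1 cs)"

definition dnorm1 :: "(complex \<Rightarrow> 'a::{real_normed_algebra,banach} \<Rightarrow> 'a) \<Rightarrow> ('a \<times> complex \<Rightarrow> complex) \<Rightarrow> real" where
  "dnorm1 cs f = gdnorm UNIV (norm1 cs) f"

definition bidual1 :: "(complex \<Rightarrow> 'a::{real_normed_algebra,banach} \<Rightarrow> 'a)
                        \<Rightarrow> (('a \<times> complex \<Rightarrow> complex) \<Rightarrow> complex) set" where
  "bidual1 cs = gdual (dual1 cs) fadd fsm (dnorm1 cs)"

definition bnorm1 :: "(complex \<Rightarrow> 'a::{real_normed_algebra,banach} \<Rightarrow> 'a)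
                        \<Rightarrow> (('a \<times> complex \<Rightarrow> complex) \<Rightarrow> complex) \<Rightarrow> real" where
  "bnorm1 cs \<eta> = gdnorm (dual1 cs) (dnorm1 cs) \<eta>"

definition prod1 :: "(complex \<Rightarrow> 'a::{real_normed_algebra,banach} \<Rightarrow> 'a)
     \<Rightarrow> (('a \<times> complex \<Rightarrow> complex) \<Rightarrow> complex) \<Rightarrow> (('a \<times> complex \<Rightarrow> complex) \<Rightarrow> complex)
     \<Rightarrow> ('a \<times> complex \<Rightarrow> complex) \<Rightarrow> complex" where
  "prod1 cs = arens2 (dual1 cs) (mult1 cs)"

definition one1 :: "(complex \<Rightarrow> 'a::{real_normed_algebra,banach} \<Rightarrow> 'a) \<Rightarrow> ('a \<times> complex \<Rightarrow> complex) \<Rightarrow> complex" where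
  "one1 cs = cemb (dual1 cs) (0, 1)"

text \<open>The canonical identification of A** with A^perp-perp inside (A^1)**.\<close>
definition iota1 :: "(complex \<Rightarrow> 'a::{real_normed_algebra,banach} \<Rightarrow> 'a)
     \<Rightarrow> (('a \<Rightarrow> complex) \<Rightarrow> complex) \<Rightarrow> ('a \<times> complex \<Rightarrow> complex) \<Rightarrow> complex" where
  "iota1 cs \<eta> = (\<lambda>\<psi>. if \<psi> \<in> dual1 cs then \<eta> (\<lambda>a. \<psi> (a, 0)) else 0)"

definition states1 :: "(complex \<Rightarrow> 'a::{real_normed_algebra,banach} \<Rightarrow> 'a) \<Rightarrow> ('a \<times> complex \<Rightarrow> complex) set" where
  "states1 cs = {\<psi> \<in> dual1 cs. dnorm1 cs \<psi> = 1 \<and> \<psi> (0, 1) = 1}"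

definition SA :: "(complex \<Rightarrow> 'a::{real_normed_algebra,banach} \<Rightarrow> 'a) \<Rightarrow> ('a \<Rightarrow> complex) set" where
  "SA cs = {\<phi> \<in> dualA cs. dnormA \<phi> = 1 \<and> (\<exists>\<psi>\<in>states1 cs. \<forall>a. \<psi> (a, 0) = \<phi> a)}"

definition QA :: "(complex \<Rightarrow> 'a::{real_normed_algebra,banach} \<Rightarrow> 'a) \<Rightarrow> ('a \<Rightarrow> complex) set" where
  "QA cs = {(\<lambda>a. complex_of_real t * \<phi> a) | t \<phi>. 0 \<le> t \<and> t \<le> 1 \<and> \<phi> \<in> SA cs}"

definition rA :: "(complex \<Rightarrow> 'a::{real_normed_algebra,banach} \<Rightarrow> 'a) \<Rightarrow> 'a set" where
  "rA cs = {a. \<forall>\<psi>\<in>states1 cs. Re (\<psi> (a, 0)) \<ge> 0}"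

definition cA :: "(complex \<Rightarrow> 'a::{real_normed_algebra,banach} \<Rightarrow> 'a) \<Rightarrow> ('a \<Rightarrow> complex) set" where
  "cA cs = {\<phi> \<in> dualA cs. \<forall>a\<in>rA cs. Re (\<phi> a) \<ge> 0}"

definition scaled :: "(complex \<Rightarrow> 'a::{real_normed_algebra,banach} \<Rightarrow> 'a) \<Rightarrow> bool" where
  "scaled cs \<longleftrightarrow> cA cs = {(\<lambda>a. complex_of_real t * \<phi> a) | t \<phi>. 0 \<le> t \<and> \<phi> \<in> SA cs}"

definition csubspace :: "(complex \<Rightarrow> 'a::{real_normed_algebra,banach} \<Rightarrow> 'a) \<Rightarrow> 'a set \<Rightarrow> bool" where
  "csubspace cs J \<longleftrightarrow> 0 \<in> J \<and> (\<forall>x\<in>J. \<forall>y\<in>J. x + y \<in> J) \<and> (\<forall>c. \<forall>x\<in>J. cs c x \<in> J)"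

definition cspan :: "(complex \<Rightarrow> 'a::{real_normed_algebra,banach} \<Rightarrow> 'a) \<Rightarrow> 'a set \<Rightarrow> 'a set" where
  "cspan cs S = \<Inter>{V. csubspace cs V \<and> S \<subseteq> V}"

definition perp1 :: "(complex \<Rightarrow> 'a::{real_normed_algebra,banach} \<Rightarrow> 'a) \<Rightarrow> 'a set \<Rightarrow> ('a \<times> complex \<Rightarrow> complex) set" where
  "perp1 cs J = {\<psi> \<in> dual1 cs. \<forall>a\<in>J. \<psi> (a, 0) = 0}"

definition perpperp1 :: "(complex \<Rightarrow> 'a::{real_normed_algebra,banach} \<Rightarrow> 'a) \<Rightarrow> 'a set
                           \<Rightarrow> (('a \<times> complex \<Rightarrow> complex) \<Rightarrow> complex) set" where
  "perpperp1 cs J = {\<eta> \<in> bidual1 cs. \<forall>\<psi>\<in>perp1 cs J. \<eta> \<psi> = 0}"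

definition Mproj :: "(complex \<Rightarrow> 'a::{real_normed_algebra,banach} \<Rightarrow> 'a) \<Rightarrow> 'a set
     \<Rightarrow> ((('a \<times> complex \<Rightarrow> complex) \<Rightarrow> complex) \<Rightarrow> (('a \<times> complex \<Rightarrow> complex) \<Rightarrow> complex)) \<Rightarrow> bool" where
  "Mproj cs J P \<longleftrightarrow>
     (\<forall>\<eta>\<in>bidual1 cs. P \<eta> \<in> bidual1 cs) \<and>
     (\<forall>\<eta>\<in>bidual1 cs. \<forall>\<xi>\<in>bidual1 cs. P (fadd \<eta> \<xi>) = fadd (P \<eta>) (P \<xi>)) \<and>
     (\<forall>c. \<forall>\<eta>\<in>bidual1 cs. P (fsm c \<eta>) = fsm c (P \<eta>)) \<and>
     (\<forall>\<eta>\<in>bidual1 cs. P (P \<eta>) = P \<eta>) \<and>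
     P ` bidual1 cs = perpperp1 cs J \<and>
     (\<forall>\<eta>\<in>bidual1 cs. bnorm1 cs \<eta> = max (bnorm1 cs (P \<eta>)) (bnorm1 cs (fadd \<eta> (fsm (-1) (P \<eta>)))))"

definition Mideal_ideal :: "(complex \<Rightarrow> 'a::{real_normed_algebra,banach} \<Rightarrow> 'a) \<Rightarrow> 'a set \<Rightarrow> bool" where
  "Mideal_ideal cs J \<longleftrightarrow> csubspace cs J \<and> closed J \<and>
     (\<exists>P. Mproj cs J P \<and>
        (\<forall>\<eta>\<in>bidualA cs. prod1 cs (P (one1 cs)) (iota1 cs \<eta>) = prod1 cs (iota1 cs \<eta>) (P (one1 cs))))"

definition supp_proj :: "(complex \<Rightarrow> 'a::{real_normed_algebra,banach} \<Rightarrow> 'a) \<Rightarrow> 'a set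
                           \<Rightarrow> ('a \<Rightarrow> complex) \<Rightarrow> complex" where
  "supp_proj cs J = (SOME p. p \<in> bidualA cs \<and> (\<exists>P. Mproj cs J P \<and> iota1 cs p = P (one1 cs)))"

definition central_open_proj :: "(complex \<Rightarrow> 'a::{real_normed_algebra,banach} \<Rightarrow> 'a)
                                  \<Rightarrow> (('a \<Rightarrow> complex) \<Rightarrow> complex) \<Rightarrow> bool" where
  "central_open_proj cs p \<longleftrightarrow> (\<exists>J. Mideal_ideal cs J \<and> p = supp_proj cs J)"

definition proj_le :: "(complex \<Rightarrow> 'a::{real_normed_algebra,banach} \<Rightarrow> 'a)
                        \<Rightarrow> (('a \<Rightarrow> complex) \<Rightarrow> complex) \<Rightarrow> (('a \<Rightarrow> complex) \<Rightarrow> complex) \<Rightarrow> bool" where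
  "proj_le cs p q \<longleftrightarrow> prodA cs p q = p \<and> prodA cs q p = p"

definition ideal_of :: "(complex \<Rightarrow> 'a::{real_normed_algebra,banach} \<Rightarrow> 'a)
                        \<Rightarrow> (('a \<Rightarrow> complex) \<Rightarrow> complex) \<Rightarrow> 'a set" where
  "ideal_of cs p = {a. \<exists>\<eta>\<in>bidualA cs. embA cs a = prodA cs p \<eta>}"

definition perpA :: "(complex \<Rightarrow> 'a::{real_normed_algebra,banach} \<Rightarrow> 'a) \<Rightarrow> 'a set \<Rightarrow> ('a \<Rightarrow> complex) set" where
  "perpA cs J = {\<phi> \<in> dualA cs. \<forall>a\<in>J. \<phi> a = 0}"

definition Fp :: "(complex \<Rightarrow> 'a::{real_normed_algebra,banach} \<Rightarrow> 'a)
                   \<Rightarrow> (('a \<Rightarrow> complex) \<Rightarrow> complex) \<Rightarrow> ('a \<Rightarrow> complex) set" where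
  "Fp cs p = {\<phi> \<in> QA cs. p \<phi> = 0}"

text \<open>Face of a set of functionals (same as face_of, for the pointwise linear structure).\<close>
definition fface :: "('a \<Rightarrow> complex) set \<Rightarrow> ('a \<Rightarrow> complex) set \<Rightarrow> bool" where
  "fface F Q \<longleftrightarrow> F \<subseteq> Q \<and>
     (\<forall>x\<in>F. \<forall>y\<in>F. \<forall>t::real. 0 \<le> t \<and> t \<le> 1 \<longrightarrow> (\<lambda>a. t * x a + (1 - t) * y a) \<in> F) \<and>
     (\<forall>x\<in>Q. \<forall>y\<in>Q. \<forall>t::real. 0 < t \<and> t < 1 \<and> (\<lambda>a. t * x a + (1 - t) * y a) \<in> F
          \<longrightarrow> x \<in> F \<and> y \<in> F)"

text \<open>Weak* topology on A* = topology of pointwise convergence (product topology on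
  'a \<Rightarrow> complex) restricted to A*.\<close>
definition wstar_closed :: "(complex \<Rightarrow> 'a::{real_normed_algebra,banach} \<Rightarrow> 'a) \<Rightarrow> ('a \<Rightarrow> complex) set \<Rightarrow> bool" where
  "wstar_closed cs S \<longleftrightarrow> closedin (top_of_set (dualA cs)) S"

end

theory Submission
  imports Defs "HOL-Library.Function_Algebras"
begin

text \<open>
  Write \<open>B\<close> for the bidual of \<open>A\<^sup>1\<close> and \<open>z = P(1)\<close> for the support of an M-ideal ideal \<open>J\<close>.
  The element \<open>z\<close> is Hermitian and M-projections commute with Hermitian operators, which gives
  \<open>z\<^sup>2 = z\<close>; if \<open>P c = 0\<close> then \<open>\<parallel>z + \<zeta> c\<parallel> \<le> 1\<close> for all small \<open>\<zeta>\<close>, so \<open>z c\<close> has numerical radius 0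
  in \<open>z B\<close> and vanishes. Hence \<open>P\<close> is multiplication by the central idempotent \<open>z\<close>, and \<open>J\<close> is a
  two-sided ideal.

  For a state \<open>\<psi>\<close> the bound \<open>\<parallel>\<zeta> P \<eta> + (1 - z)\<parallel> \<le> 1\<close> gives \<open>\<bar>\<psi>(P \<eta>)\<bar> \<le> Re \<psi>(z)\<close> on the unit ball.
  So \<open>\<psi>(z) \<ge> 0\<close>, with equality iff \<open>\<psi>\<close> annihilates \<open>J\<close>, which identifies \<open>F\<^sub>p\<close> and shows that it is
  a face. Since \<open>A\<close> is scaled, \<open>Q(A)\<close> is the unit ball of the cone dual to the accretive elements,
  hence convex and weak* closed. The faces determine the ideals because states separate the points of
  the unital algebra \<open>A\<^sup>1/J\<close>.

  Because \<open>z\<close> is central and the second Arens product is \<open>(\<eta> \<xi>)(f) = \<xi>(f \<cdot> \<eta>)\<close>, multiplication by \<open>z\<close> is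
  the adjoint of the map \<open>f \<mapsto> f \<cdot> z\<close> on the dual, which is an L-projection. An increasing net of
  L-projections converges strongly, so suprema of arbitrary families of supports exist; this
  produces the M-projection for the closed span.
\<close>

section \<open>Hahn-Banach\<close>

text \<open>One analytic fact serves twice: in a complex unital algebra, an element on which all
  states vanish is 0. In the corner \<open>z B\<close> it turns P into a multiplication, and in
  A^1/J it makes states separate points. The quotient is only a seminormed algebra, so the
  exponential series of the usual proof is replaced by finite powers (1 + y/n)^n, which need no
  completeness. The obstacle for suprema is centrality. A weak* limit of supports is easy to get,
  but \<xi>(f \<cdot> \<eta>) is weak* continuous in \<xi> alone, so commutation does not pass to
  such a limit in the other factor. Additivity of the norm under L-projections makes the net f
  \<cdot> z converge in norm, and then every element of the bidual can be applied to the limit.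
  Scaledness also repairs a defect of restriction: a state of A^1 may restrict to a functional of
  norm below 1 on A, and scaledness still makes it a multiple of a state of A.\<close>

definition sublinear :: "('v::real_vector \<Rightarrow> real) \<Rightarrow> bool" where
  "sublinear p \<longleftrightarrow> (\<forall>x y. p (x + y) \<le> p x + p y) \<and> (\<forall>r x. 0 \<le> r \<longrightarrow> p (r *\<^sub>R x) = r * p x)"

text \<open>For sublinear p, a linear functional below \<open>shrink p y\<close> must take the value
  \<open>p y\<close> at \<open>y\<close>, because the term t = 1 gives
  \<open>shrink p y (- y)\<close> at most \<open>- p y\<close>. With t = 1/s the terms are the
  difference quotients (p(y + s x) - p(y))/s, so this is the one-sided derivative of
  \<open>p\<close> at \<open>y\<close>. At the unit of a normed algebra it is the largest real part
  that states take at x.\<close>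

definition shrink :: "('v::real_vector \<Rightarrow> real) \<Rightarrow> 'v \<Rightarrow> 'v \<Rightarrow> real" where
  "shrink p y x = (INF t\<in>{0..}. p (x + t *\<^sub>R y) - t * p y)"

lemma sublinearI:
  assumes "\<And>x y. p (x + y) \<le> p x + p y" "\<And>r x. 0 < r \<Longrightarrow> p (r *\<^sub>R x) \<le> r * p x" "p 0 = 0"
  shows "sublinear p"
  unfolding sublinear_def
proof (intro conjI allI impI)
  fix r :: real and x :: 'a
  assume r: "0 \<le> r"
  show "p (r *\<^sub>R x) = r * p x"
  proof (cases "r = 0")
    case False
    with r have r: "0 < r" by simp
    have "p x = p (inverse r *\<^sub>R (r *\<^sub>R x))" using r by simp
    also have "\<dots> \<le> inverse r * p (r *\<^sub>R x)" using r by (intro assms(2)) simp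
    finally have "r * p x \<le> p (r *\<^sub>R x)" using r by (simp add: field_simps)
    with assms(2)[OF r, of x] show ?thesis by simp
  qed (simp add: assms)
qed (use assms in auto)

lemma sublinear_add: "sublinear p \<Longrightarrow> p (x + y) \<le> p x + p y"
  and sublinear_scale: "sublinear p \<Longrightarrow> 0 \<le> r \<Longrightarrow> p (r *\<^sub>R x) = r * p x"
  by (auto simp: sublinear_def)

lemma sublinear_zero: "sublinear p \<Longrightarrow> p 0 = 0"
  using sublinear_scale[of p 0 0] by simp

lemma sublinear_minus: "sublinear p \<Longrightarrow> - p (- x) \<le> p x"
  using sublinear_add[of p x "- x"] sublinear_zero[of p] by simp

lemma shrink_bdd_below:
  assumes "sublinear p"
  shows "bdd_below ((\<lambda>t. p (x + t *\<^sub>R y) - t * p y) ` {0..})"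
proof (rule bdd_belowI2)
  fix t :: real assume "t \<in> {0..}"
  then have "t * p y = p ((x + t *\<^sub>R y) + - x)" using assms by (simp add: sublinear_scale)
  also have "\<dots> \<le> p (x + t *\<^sub>R y) + p (- x)" by (rule sublinear_add[OF assms])
  finally show "- p (- x) \<le> p (x + t *\<^sub>R y) - t * p y" by simp
qed

lemma shrink_le:
  assumes "sublinear p" "0 \<le> t"
  shows "shrink p y x \<le> p (x + t *\<^sub>R y) - t * p y"
  unfolding shrink_def by (rule cINF_lower[OF shrink_bdd_below]) (use assms in auto)

lemma shrink_approx:
  assumes "sublinear p" "shrink p y x < c"
  obtains t where "0 \<le> t" "p (x + t *\<^sub>R y) - t * p y < c"
  using assms(2) unfolding shrink_def
  by (subst (asm) cINF_less_iff[OF _ shrink_bdd_below[OF assms(1)]]) auto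

lemma shrink_le_self: "sublinear p \<Longrightarrow> shrink p y x \<le> p x"
  using shrink_le[of p 0 y x] by simp

lemma sublinear_shrink:
  assumes p: "sublinear p"
  shows "sublinear (shrink p y)"
proof (rule sublinearI)
  fix x x' :: 'a
  show "shrink p y (x + x') \<le> shrink p y x + shrink p y x'"
  proof (rule field_le_epsilon)
    fix e :: real assume e: "0 < e"
    obtain t where t: "0 \<le> t" "p (x + t *\<^sub>R y) - t * p y < shrink p y x + e/2"
      using shrink_approx[OF p, of y x "shrink p y x + e/2"] e by auto
    obtain s where s: "0 \<le> s" "p (x' + s *\<^sub>R y) - s * p y < shrink p y x' + e/2"
      using shrink_approx[OF p, of y x' "shrink p y x' + e/2"] e by auto
    have "shrink p y (x + x') \<le> p ((x + x') + (t + s) *\<^sub>R y) - (t + s) * p y"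
      using t s by (intro shrink_le p) auto
    also have "(x + x') + (t + s) *\<^sub>R y = (x + t *\<^sub>R y) + (x' + s *\<^sub>R y)"
      by (simp add: algebra_simps)
    finally show "shrink p y (x + x') \<le> shrink p y x + shrink p y x' + e"
      using sublinear_add[OF p, of "x + t *\<^sub>R y" "x' + s *\<^sub>R y"] t s by (simp add: algebra_simps)
  qed
next
  fix r :: real and x :: 'a assume r: "0 < r"
  show "shrink p y (r *\<^sub>R x) \<le> r * shrink p y x"
  proof (rule field_le_epsilon)
    fix e :: real assume e: "0 < e"
    obtain t where t: "0 \<le> t" "p (x + t *\<^sub>R y) - t * p y < shrink p y x + e/r"
      using shrink_approx[OF p, of y x "shrink p y x + e/r"] e r by auto
    have "shrink p y (r *\<^sub>R x) \<le> p (r *\<^sub>R x + (r * t) *\<^sub>R y) - (r * t) * p y"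
      using t r by (intro shrink_le p) auto
    also have "r *\<^sub>R x + (r * t) *\<^sub>R y = r *\<^sub>R (x + t *\<^sub>R y)" by (simp add: algebra_simps)
    also have "p \<dots> = r * p (x + t *\<^sub>R y)" using r p by (simp add: sublinear_scale)
    also have "\<dots> - r * t * p y = r * (p (x + t *\<^sub>R y) - t * p y)" by (simp add: algebra_simps)
    also have "\<dots> \<le> r * (shrink p y x + e/r)" using t r by (intro mult_left_mono) auto
    finally show "shrink p y (r *\<^sub>R x) \<le> r * shrink p y x + e" using r by (simp add: algebra_simps)
  qed
next
  have "shrink p y 0 = (INF t\<in>{0::real..}. (0::real))"
    unfolding shrink_def using p by (intro arg_cong[where f=Inf] image_cong refl) (simp add: sublinear_scale)
  then show "shrink p y 0 = 0" by simp
qed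

text \<open>Zorn's lemma with the order turned downwards. The infimum of a chain is finite because
  every member satisfies q x \<ge> - p(- x), and subadditive because the smaller of two comparable
  members is nearly optimal at both points.\<close>

lemma sublinear_minimal:
  assumes p: "sublinear p"
  obtains q where "sublinear q" "\<And>x. q x \<le> p x"
    "\<And>r. sublinear r \<Longrightarrow> (\<And>x. r x \<le> q x) \<Longrightarrow> r = q"
proof -
  define S where "S = {q. sublinear q \<and> (\<forall>x. q x \<le> p x)}"
  let ?P = "\<lambda>q r. \<forall>x. r x \<le> (q x :: real)"
  have "\<exists>m\<in>S. \<forall>a\<in>S. ?P m a \<longrightarrow> a = m"
  proof (rule predicate_Zorn)
    show "partial_order_on S (relation_of ?P S)"
    proof (rule partial_order_on_relation_ofI)
      fix a b c :: "'a \<Rightarrow> real"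
      assume "?P a b" "?P b c"
      then show "?P a c" by (meson order_trans)
    next
      fix a b :: "'a \<Rightarrow> real"
      assume "?P a b" "?P b a"
      then show "a = b" by (auto intro: order_antisym)
    qed auto
  next
    fix C assume "C \<in> Chains (relation_of ?P S)"
    then have CS: "C \<subseteq> S" and tot: "\<And>q r. q \<in> C \<Longrightarrow> r \<in> C \<Longrightarrow> ?P q r \<or> ?P r q"
      unfolding Chains_def relation_of_def by auto
    show "\<exists>u\<in>S. \<forall>a\<in>C. ?P a u"
    proof (cases "C = {}")
      case True
      then show ?thesis using p by (auto simp: S_def)
    next
      case ne: False
      define u where "u x = (INF q\<in>C. q x)" for x
      have bdd: "bdd_below ((\<lambda>q. q x) ` C)" for x
      proof (rule bdd_belowI2)
        fix q assume "q \<in> C"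
        then have "sublinear q" "q (- x) \<le> p (- x)" using CS by (auto simp: S_def)
        then show "- p (- x) \<le> q x" using sublinear_minus[of q x] by linarith
      qed
      have le: "u x \<le> q x" if "q \<in> C" for q x
        unfolding u_def by (rule cINF_lower[OF bdd that])
      have ap: "\<exists>q\<in>C. q x < c" if "u x < c" for x c
        using that unfolding u_def by (subst (asm) cINF_less_iff[OF ne bdd]) auto
      have sub: "sublinear q" if "q \<in> C" for q using that CS by (auto simp: S_def)
      have "sublinear u"
      proof (rule sublinearI)
        fix x y
        show "u (x + y) \<le> u x + u y"
        proof (rule field_le_epsilon)
          fix e :: real assume e: "0 < e"
          obtain q where q: "q \<in> C" "q x < u x + e/2" using ap[of x "u x + e/2"] e by auto
          obtain r where r: "r \<in> C" "r y < u y + e/2" using ap[of y "u y + e/2"] e by auto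
          obtain s where s: "s \<in> C" "s x \<le> q x" "s y \<le> r y"
            using tot[OF q(1) r(1)] q(1) r(1) by auto
          have "u (x + y) \<le> s (x + y)" by (rule le[OF s(1)])
          also have "\<dots> \<le> s x + s y" by (rule sublinear_add[OF sub[OF s(1)]])
          finally show "u (x + y) \<le> u x + u y + e" using s q r by simp
        qed
      next
        fix r :: real and x assume r: "0 < r"
        show "u (r *\<^sub>R x) \<le> r * u x"
        proof (rule field_le_epsilon)
          fix e :: real assume e: "0 < e"
          obtain q where q: "q \<in> C" "q x < u x + e/r" using ap[of x "u x + e/r"] e r by auto
          have "u (r *\<^sub>R x) \<le> q (r *\<^sub>R x)" by (rule le[OF q(1)])
          also have "\<dots> = r * q x" using sub[OF q(1)] r by (simp add: sublinear_scale)
          also have "\<dots> \<le> r * (u x + e/r)" using q r by (intro mult_left_mono) auto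
          finally show "u (r *\<^sub>R x) \<le> r * u x + e" using r by (simp add: algebra_simps)
        qed
      next
        have "u 0 = (INF q\<in>C. 0)" unfolding u_def using sub by (intro arg_cong[where f=Inf] image_cong refl) (auto simp: sublinear_zero)
        then show "u 0 = 0" using ne by simp
      qed
      moreover obtain q where "q \<in> C" using ne by auto
      moreover have "u x \<le> p x" for x
        using le[OF \<open>q \<in> C\<close>, of x] \<open>q \<in> C\<close> CS unfolding S_def
        by (metis (mono_tags, lifting) mem_Collect_eq order_trans subsetD)
      ultimately have "u \<in> S" by (simp add: S_def)
      then show ?thesis using le by blast
    qed
  qed
  then obtain m where m: "m \<in> S" "\<And>a. a \<in> S \<Longrightarrow> ?P m a \<Longrightarrow> a = m" by blast
  show thesis
  proof (rule that[of m])
    fix r :: "'a \<Rightarrow> real"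
    assume r: "sublinear r" "\<And>x. r x \<le> m x"
    have "r x \<le> p x" for x using r(2)[of x] m(1) by (auto simp: S_def intro: order_trans)
    then show "r = m" using r by (intro m(2)) (auto simp: S_def)
  qed (use m in \<open>auto simp: S_def\<close>)
qed

text \<open>A minimal sublinear functional equals all its shrinkings, hence is additive.\<close>

theorem Hahn_Banach_sublinear:
  assumes p: "sublinear p"
  obtains f where "linear f" "\<And>x. f x \<le> p x" "f x0 = p x0"
proof -
  \<comment> \<open>Minimizing below \<open>shrink p x0\<close> instead of \<open>p\<close> builds
    the value at \<open>x0\<close> into the functional.\<close>
  obtain q where q: "sublinear q" "\<And>x. q x \<le> shrink p x0 x"
    and min: "\<And>r. sublinear r \<Longrightarrow> (\<And>x. r x \<le> q x) \<Longrightarrow> r = q"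
    using sublinear_minimal[OF sublinear_shrink[OF p]] by blast
  have "shrink q y = q" for y
    by (rule min) (use q in \<open>auto intro: sublinear_shrink shrink_le_self\<close>)
  then have "q x \<le> q (x + y) - q y" for x y
    using shrink_le[OF q(1), of 1 y x] by simp
  then have add: "q (x + y) = q x + q y" for x y
    using sublinear_add[OF q(1), of x y] by (smt (verit))
  have minus: "q (- x) = - q x" for x
    using add[of x "- x"] sublinear_zero[OF q(1)] by simp
  have "linear q"
  proof (rule linearI)
    fix r x
    show "q (r *\<^sub>R x) = r *\<^sub>R q x"
    proof (cases "0 \<le> r")
      case False
      then have "q ((- r) *\<^sub>R x) = (- r) * q x" using sublinear_scale[OF q(1), of "- r" x] by simp
      then show ?thesis using minus[of "r *\<^sub>R x"] by simp
    qed (simp add: sublinear_scale[OF q(1)])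
  qed (rule add)
  moreover have "q x \<le> p x" for x using q(2)[of x] shrink_le_self[OF p, of x0 x] by simp
  moreover have "q (- x0) \<le> - p x0"
    using q(2)[of "- x0"] shrink_le[OF p, of 1 x0 "- x0"] sublinear_zero[OF p] by simp
  ultimately show thesis using minus[of x0] by (intro that[of q]) (auto intro: order_antisym)
qed

lemma complexify_functional:
  fixes sc :: "complex \<Rightarrow> 'v::real_vector \<Rightarrow> 'v"
  assumes vs: "vector_space sc" and real: "\<And>r x. sc (complex_of_real r) x = r *\<^sub>R x"
    and f: "linear f" "\<And>x. f x \<le> p x" and p: "\<And>c x. p (sc c x) = cmod c * p x"
  obtains F where "\<And>x y. F (x + y) = F x + F y" "\<And>c x. F (sc c x) = c * F x"
    "\<And>x. Re (F x) = f x" "\<And>x. cmod (F x) \<le> p x"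
proof -
  interpret vector_space sc by (rule vs)
  define F where "F x = Complex (f x) (- f (sc \<i> x))" for x
  have add: "F (x + y) = F x + F y" for x y
    by (simp add: F_def complex_eq_iff scale_right_distrib linear_add[OF f(1)])
  have fr: "f (sc (complex_of_real r) x) = r * f x" for r x
    by (simp add: real linear_scale[OF f(1)])
  have sc: "F (sc c x) = c * F x" for c x
  proof -
    have fc: "f (sc d x) = Re d * f x + Im d * f (sc \<i> x)" for d
    proof -
      have "sc d x = sc (complex_of_real (Re d)) x + sc (complex_of_real (Im d)) (sc \<i> x)"
        by (simp flip: scale_left_distrib add: complex_eq_iff)
      then show ?thesis by (simp add: linear_add[OF f(1)] fr del: scale_scale)
    qed
    show ?thesis using fc[of c] fc[of "\<i> * c"] by (simp add: F_def complex_eq_iff)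
  qed
  have "cmod (F x) \<le> p x" for x
  \<comment> \<open>The rotation needs a nonzero value, since \<open>sgn 0 = 0\<close> is not
    unimodular.\<close>
  proof (cases "F x = 0")
    case True
    have "f x \<le> p x" "f (- x) \<le> p (- x)" using f(2) by auto
    moreover have "p (- x) = p x" using p[of "-1" x] by simp
    ultimately show ?thesis using True linear_neg[OF f(1), of x] by simp
  next
    case False
    let ?c = "cnj (sgn (F x))"
    have c: "cmod ?c = 1" using False by (simp add: norm_sgn)
    have "?c * F x = complex_of_real (cmod (F x))"
      using complex_norm_square[of "F x"] False
      by (simp add: sgn_eq field_simps power2_eq_square)
    then have "cmod (F x) = Re (F (sc ?c x))" by (simp add: sc)
    also have "\<dots> = f (sc ?c x)" by (simp add: F_def)
    also have "\<dots> \<le> p (sc ?c x)" by (rule f(2))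
    also have "\<dots> = p x" using c by (simp add: p)
    finally show ?thesis .
  qed
  then show thesis by (intro that[of F] add sc) (auto simp: F_def)
qed

section \<open>Seminormed spaces, duals and the numerical radius\<close>

lemma fadd_eq_plus: "fadd = (+)"
  by (simp add: fadd_def fun_eq_iff)

lemma vector_space_fsm: "vector_space (fsm :: complex \<Rightarrow> ('v \<Rightarrow> complex) \<Rightarrow> 'v \<Rightarrow> complex)"
  by unfold_locales (auto simp: fsm_def fun_eq_iff algebra_simps)

text \<open>One locale covers A, A^1, their duals and biduals, corners and quotients. The carrier is
  a set because a dual is a set of functions, and N is a seminorm because A^1 and quotients are
  modelled without passing to classes.\<close>

locale cseminormed = vector_space sc
  for sc :: "complex \<Rightarrow> 'v::ab_group_add \<Rightarrow> 'v" +
  fixes V :: "'v set" and N :: "'v \<Rightarrow> real"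
  assumes zero_mem: "0 \<in> V"
    and add_mem: "x \<in> V \<Longrightarrow> y \<in> V \<Longrightarrow> x + y \<in> V"
    and sc_mem: "x \<in> V \<Longrightarrow> sc c x \<in> V"
    and N_add: "x \<in> V \<Longrightarrow> y \<in> V \<Longrightarrow> N (x + y) \<le> N x + N y"
    and N_sc: "x \<in> V \<Longrightarrow> N (sc c x) = cmod c * N x"
begin

lemma N_zero: "N 0 = 0"
  using N_sc[OF zero_mem, of 0] by simp

lemma minus_mem: "x \<in> V \<Longrightarrow> - x \<in> V"
  using sc_mem[of x "-1"] by simp

lemma diff_mem: "x \<in> V \<Longrightarrow> y \<in> V \<Longrightarrow> x - y \<in> V"
  using add_mem[of x "- y"] minus_mem[of y] by simp

lemma N_minus: "x \<in> V \<Longrightarrow> N (- x) = N x"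
  using N_sc[of x "-1"] by simp

lemma N_nonneg: "x \<in> V \<Longrightarrow> 0 \<le> N x"
  using N_add[of x "- x"] by (simp add: minus_mem N_minus N_zero)

lemma N_diff: "x \<in> V \<Longrightarrow> y \<in> V \<Longrightarrow> N (x - y) \<le> N x + N y"
  using N_add[of x "- y"] by (simp add: minus_mem N_minus)

lemma sum_mem: "(\<And>i. i \<in> I \<Longrightarrow> g i \<in> V) \<Longrightarrow> sum g I \<in> V"
  by (induction I rule: infinite_finite_induct) (auto simp: zero_mem add_mem)

lemma N_sum: "(\<And>i. i \<in> I \<Longrightarrow> g i \<in> V) \<Longrightarrow> N (sum g I) \<le> (\<Sum>i\<in>I. N (g i))"
proof (induction I rule: infinite_finite_induct)
  case (insert i I)
  then have "N (g i + sum g I) \<le> N (g i) + N (sum g I)" by (intro N_add sum_mem) auto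
  moreover have "N (sum g I) \<le> (\<Sum>i\<in>I. N (g i))" using insert by blast
  ultimately show ?case using insert by simp
qed (auto simp: N_zero)

abbreviation dual where "dual \<equiv> gdual V (+) sc N"
abbreviation dnorm where "dnorm \<equiv> gdnorm V N"

lemma dualI:
  assumes "\<And>x y. x \<in> V \<Longrightarrow> y \<in> V \<Longrightarrow> f (x + y) = f x + f y"
    and "\<And>c x. x \<in> V \<Longrightarrow> f (sc c x) = c * f x"
    and "\<And>x. x \<in> V \<Longrightarrow> cmod (f x) \<le> K * N x"
    and "\<And>x. x \<notin> V \<Longrightarrow> f x = 0"
  shows "f \<in> dual"
  using assms unfolding gdual_def bdd_clf_def by blast

lemma
  assumes "f \<in> dual"
  shows dual_add: "x \<in> V \<Longrightarrow> y \<in> V \<Longrightarrow> f (x + y) = f x + f y"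
    and dual_sc: "x \<in> V \<Longrightarrow> f (sc c x) = c * f x"
    and dual_outside: "x \<notin> V \<Longrightarrow> f x = 0"
  using assms unfolding gdual_def bdd_clf_def by auto

lemma dual_zero: "f \<in> dual \<Longrightarrow> f 0 = 0"
  using dual_sc[OF _ zero_mem, of f 0] by simp

lemma dual_minus: "f \<in> dual \<Longrightarrow> x \<in> V \<Longrightarrow> f (- x) = - f x"
  using dual_sc[of f x "-1"] by simp

lemma dual_diff: "f \<in> dual \<Longrightarrow> x \<in> V \<Longrightarrow> y \<in> V \<Longrightarrow> f (x - y) = f x - f y"
  using dual_add[of f x "- y"] by (simp add: minus_mem dual_minus)

lemma dual_bdd_above: 
  assumes "f \<in> dual"
  shows "bdd_above {cmod (f x) | x. x \<in> V \<and> N x \<le> 1}"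
proof -
  obtain K where K: "\<And>x. x \<in> V \<Longrightarrow> cmod (f x) \<le> K * N x"
    using assms unfolding gdual_def bdd_clf_def by blast
  have "cmod (f x) \<le> \<bar>K\<bar>" if "x \<in> V" "N x \<le> 1" for x
  proof -
    have "K * N x \<le> \<bar>K\<bar> * 1" using that N_nonneg[of x] by (intro mult_mono) auto
    with K[OF that(1)] show ?thesis by simp
  qed
  then show ?thesis by (auto intro!: bdd_aboveI[of _ "\<bar>K\<bar>"])
qed

lemma dnorm_upper: "f \<in> dual \<Longrightarrow> x \<in> V \<Longrightarrow> N x \<le> 1 \<Longrightarrow> cmod (f x) \<le> dnorm f"
  unfolding gdnorm_def by (rule cSup_upper[OF _ dual_bdd_above]) auto

lemma dnorm_least_ball:
  assumes "\<And>x. x \<in> V \<Longrightarrow> N x \<le> 1 \<Longrightarrow> cmod (f x) \<le> K"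
  shows "dnorm f \<le> K"
  unfolding gdnorm_def using assms zero_mem N_zero by (intro cSup_least) fastforce+

lemma dnorm_nonneg: "f \<in> dual \<Longrightarrow> 0 \<le> dnorm f"
  using dnorm_upper[of f 0] zero_mem N_zero by simp (metis norm_ge_zero order_trans)

lemma dnorm_least:
  assumes "\<And>x. x \<in> V \<Longrightarrow> cmod (f x) \<le> K * N x" "0 \<le> K"
  shows "dnorm f \<le> K"
proof (rule dnorm_least_ball)
  fix x assume "x \<in> V" "N x \<le> 1"
  then show "cmod (f x) \<le> K" using assms(1)[of x] mult_left_mono[of "N x" 1 K] assms(2) by simp
qed

lemma dual_bound:
  assumes f: "f \<in> dual" and x: "x \<in> V"
  shows "cmod (f x) \<le> dnorm f * N x"
proof (rule field_le_epsilon)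
  fix d :: real assume d: "0 < d"
  \<comment> \<open>N x may be 0, so x is divided by a slightly larger number; the excess costs at
    most dnorm f * d / (dnorm f + 1) \<le> d.\<close>
  define r where "r = N x + d / (dnorm f + 1)"
  have dn: "0 \<le> dnorm f" by (rule dnorm_nonneg[OF f])
  have r: "r > 0" "N x \<le> r" using d dn N_nonneg[OF x] by (auto simp: r_def intro: add_nonneg_pos)
  have "N (sc (inverse (complex_of_real r)) x) \<le> 1"
    using r x by (simp add: N_sc norm_inverse norm_divide field_simps)
  then have "cmod (f (sc (inverse (complex_of_real r)) x)) \<le> dnorm f"
    by (intro dnorm_upper f sc_mem x)
  then have "cmod (f x) \<le> dnorm f * r"
    using r f x by (simp add: dual_sc norm_mult norm_inverse norm_divide field_simps)
  also have "\<dots> \<le> dnorm f * N x + d"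
    using d dn by (simp add: r_def field_simps)
  finally show "cmod (f x) \<le> dnorm f * N x + d" .
qed

text \<open>The dual norm is definite although N is not: the value 0 off the carrier makes
  functionals that agree on V equal as functions.\<close>

lemma dnorm_eq_zero: "f \<in> dual \<Longrightarrow> dnorm f = 0 \<Longrightarrow> f = 0"
  using dual_bound[of f] dual_outside[of f] by (fastforce simp: fun_eq_iff)

lemma cseminormed_dual: "cseminormed fsm dual dnorm"
proof -
  have add: "f + g \<in> dual" "dnorm (f + g) \<le> dnorm f + dnorm g" if "f \<in> dual" "g \<in> dual" for f g
  proof -
    have *: "cmod (f x + g x) \<le> (dnorm f + dnorm g) * N x" if "x \<in> V" for x
      using norm_triangle_ineq[of "f x" "g x"] dual_bound[OF \<open>f \<in> dual\<close> that]
        dual_bound[OF \<open>g \<in> dual\<close> that] by (simp add: algebra_simps)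
    show "f + g \<in> dual"
      by (rule dualI[where K="dnorm f + dnorm g"])
        (use that * in \<open>auto simp: dual_add dual_sc dual_outside algebra_simps\<close>)
    show "dnorm (f + g) \<le> dnorm f + dnorm g"
      by (rule dnorm_least) (use * that in \<open>auto simp: dnorm_nonneg\<close>)
  qed
  have sc: "fsm c f \<in> dual" "dnorm (fsm c f) \<le> cmod c * dnorm f" if f: "f \<in> dual" for c f
  proof -
    have *: "cmod (c * f x) \<le> (cmod c * dnorm f) * N x" if "x \<in> V" for x
      using dual_bound[OF f that] by (simp add: norm_mult mult_left_mono mult.assoc)
    show "fsm c f \<in> dual"
      by (rule dualI[where K="cmod c * dnorm f"])
        (use f * in \<open>auto simp: fsm_def dual_add dual_sc dual_outside algebra_simps\<close>)
    show "dnorm (fsm c f) \<le> cmod c * dnorm f"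
      by (rule dnorm_least) (use * f in \<open>auto simp: fsm_def dnorm_nonneg\<close>)
  qed
  have zero: "0 \<in> dual" by (rule dualI[where K=0]) auto
  have sc_eq: "dnorm (fsm c f) = cmod c * dnorm f" if f: "f \<in> dual" for c f
  proof (cases "c = 0")
    case True
    then show ?thesis using sc[OF f, of 0] dnorm_nonneg[of "fsm c f"] by simp
  next
    case False
    have "dnorm f = dnorm (fsm (inverse c) (fsm c f))"
      using False by (simp add: fsm_def mult.assoc[symmetric])
    also have "\<dots> \<le> cmod (inverse c) * dnorm (fsm c f)" by (rule sc(2)[OF sc(1)[OF f]])
    finally have "cmod c * dnorm f \<le> dnorm (fsm c f)"
      using False by (simp add: norm_inverse norm_divide field_simps)
    then show ?thesis using sc(2)[OF f, of c] by simp
  qed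
  show ?thesis
    unfolding cseminormed_def cseminormed_axioms_def
    using vector_space_fsm add sc(1) sc_eq zero by blast
qed

end

text \<open>Only N e \<le> 1 is required, because a corner or a quotient may be zero, and then N e =
  0.\<close>

locale cseminormed_algebra = cseminormed sc V N
  for sc :: "complex \<Rightarrow> 'v::ab_group_add \<Rightarrow> 'v" and V N +
  fixes mul :: "'v \<Rightarrow> 'v \<Rightarrow> 'v" and e :: 'v
  assumes mul_mem: "x \<in> V \<Longrightarrow> y \<in> V \<Longrightarrow> mul x y \<in> V"
    and mul_add_left: "x \<in> V \<Longrightarrow> y \<in> V \<Longrightarrow> w \<in> V \<Longrightarrow> mul (x + y) w = mul x w + mul y w"
    and mul_add_right: "x \<in> V \<Longrightarrow> y \<in> V \<Longrightarrow> w \<in> V \<Longrightarrow> mul w (x + y) = mul w x + mul w y"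
    and mul_sc_left: "x \<in> V \<Longrightarrow> y \<in> V \<Longrightarrow> mul (sc c x) y = sc c (mul x y)"
    and mul_sc_right: "x \<in> V \<Longrightarrow> y \<in> V \<Longrightarrow> mul x (sc c y) = sc c (mul x y)"
    and mul_assoc: "x \<in> V \<Longrightarrow> y \<in> V \<Longrightarrow> w \<in> V \<Longrightarrow> mul (mul x y) w = mul x (mul y w)"
    and N_mul: "x \<in> V \<Longrightarrow> y \<in> V \<Longrightarrow> N (mul x y) \<le> N x * N y"
    and e_mem: "e \<in> V" and N_e: "N e \<le> 1"
    and mul_e_left: "x \<in> V \<Longrightarrow> mul e x = x" and mul_e_right: "x \<in> V \<Longrightarrow> mul x e = x"
begin

lemma mul_minus_right: "x \<in> V \<Longrightarrow> y \<in> V \<Longrightarrow> mul x (- y) = - mul x y"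
  using mul_sc_right[of x y "-1"] by simp

lemma mul_minus_left: "x \<in> V \<Longrightarrow> y \<in> V \<Longrightarrow> mul (- x) y = - mul x y"
  using mul_sc_left[of x y "-1"] by simp

lemma mul_diff_right: "x \<in> V \<Longrightarrow> y \<in> V \<Longrightarrow> w \<in> V \<Longrightarrow> mul w (x - y) = mul w x - mul w y"
  using mul_add_right[of x "- y" w] by (simp add: minus_mem mul_minus_right)

lemma mul_diff_left: "x \<in> V \<Longrightarrow> y \<in> V \<Longrightarrow> w \<in> V \<Longrightarrow> mul (x - y) w = mul x w - mul y w"
  using mul_add_left[of x "- y" w] by (simp add: minus_mem mul_minus_left)

lemma mul_sum_right:
  "(\<And>i. i \<in> I \<Longrightarrow> g i \<in> V) \<Longrightarrow> w \<in> V \<Longrightarrow> mul w (sum g I) = (\<Sum>i\<in>I. mul w (g i))"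
proof (induction I rule: infinite_finite_induct)
  case (insert i I)
  then show ?case by (simp add: mul_add_right sum_mem)
qed (use mul_sc_right[of w 0 0] zero_mem in auto)

section \<open>Vanishing of elements of zero numerical radius\<close>

primrec pw :: "'v \<Rightarrow> nat \<Rightarrow> 'v" where
  "pw b 0 = e" | "pw b (Suc k) = mul b (pw b k)"

lemma pw_mem: "b \<in> V \<Longrightarrow> pw b k \<in> V"
  by (induction k) (auto simp: e_mem mul_mem)

lemma N_pw: "b \<in> V \<Longrightarrow> N (pw b k) \<le> N b ^ k"
proof (induction k)
  case (Suc k)
  have "N (mul b (pw b k)) \<le> N b * N (pw b k)" using Suc by (intro N_mul pw_mem)
  also have "\<dots> \<le> N b * N b ^ k" using Suc by (intro mult_left_mono N_nonneg) auto
  finally show ?case by simp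
qed (simp add: N_e)

text \<open>The sum is (e + z b)^n expanded; \<open>T_Suc\<close> is Pascal's rule, and
  submultiplicativity does the rest.\<close>

lemma binomial_bound:
  assumes b: "b \<in> V"
  shows "N (\<Sum>k\<le>n. sc (of_nat (n choose k) * z ^ k) (pw b k)) \<le> N (e + sc z b) ^ n"
proof -
  define T where "T n = (\<Sum>k\<le>n. sc (of_nat (n choose k) * z ^ k) (pw b k))" for n
  have T_mem: "T n \<in> V" for n unfolding T_def by (intro sum_mem sc_mem pw_mem b)
  have T_Suc: "T (Suc n) = mul (e + sc z b) (T n)" for n
  proof -
    have 1: "mul b (T n) = (\<Sum>k\<le>n. sc (of_nat (n choose k) * z ^ k) (pw b (Suc k)))"
      unfolding T_def using b by (simp add: mul_sum_right sc_mem pw_mem mul_sc_right)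
    have 2: "mul (e + sc z b) (T n) = T n + sc z (mul b (T n))"
      using b by (simp add: mul_add_left e_mem sc_mem T_mem mul_e_left mul_sc_left)
    have 3: "sc z (mul b (T n)) = (\<Sum>k\<le>n. sc (of_nat (n choose k) * z ^ Suc k) (pw b (Suc k)))"
      unfolding 1 scale_sum_right by (rule sum.cong) (auto simp: mult_ac)
    have "T n = (\<Sum>k\<le>Suc n. sc (of_nat (n choose k) * z ^ k) (pw b k))"
      unfolding T_def by simp
    also have "\<dots> = sc 1 e + (\<Sum>k\<le>n. sc (of_nat (n choose Suc k) * z ^ Suc k) (pw b (Suc k)))"
      by (subst sum.atMost_Suc_shift) simp
    finally have 4: "T n = \<dots>" .
    have "T n + sc z (mul b (T n))
        = sc 1 e + (\<Sum>k\<le>n. sc (of_nat (n choose Suc k) * z ^ Suc k) (pw b (Suc k))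
            + sc (of_nat (n choose k) * z ^ Suc k) (pw b (Suc k)))"
      unfolding 3 by (subst 4) (simp only: add.assoc sum.distrib)
    also have "\<dots> = sc 1 e + (\<Sum>k\<le>n. sc (of_nat (Suc n choose Suc k) * z ^ Suc k) (pw b (Suc k)))"
      by (simp only: scale_left_distrib[symmetric]) (simp add: algebra_simps)
    also have "\<dots> = T (Suc n)"
      unfolding T_def by (subst sum.atMost_Suc_shift) simp
    finally show ?thesis using 2 by simp
  qed
  have "N (T n) \<le> N (e + sc z b) ^ n"
  proof (induction n)
    case 0
    then show ?case by (simp add: T_def N_e)
  next
    case (Suc n)
    have m: "e + sc z b \<in> V" by (intro add_mem e_mem sc_mem b)
    have "N (T (Suc n)) \<le> N (e + sc z b) * N (T n)"
      unfolding T_Suc by (intro N_mul T_mem m)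
    also have "\<dots> \<le> N (e + sc z b) * N (e + sc z b) ^ n"
      using Suc by (intro mult_left_mono N_nonneg m)
    finally show ?case by simp
  qed
  then show ?thesis by (simp add: T_def)
qed

end

text \<open>The 7 is 1 + 2 + 2 + 4/3 + 2/3, the terms k = 0, ..., 4 of the series of exp 2.\<close>

lemma exp_tail_bound: "(\<Sum>k\<in>{5..n}. 2 ^ k / fact k) \<le> exp 2 - (7::real)"
proof -
  have "(\<Sum>k\<in>{..<5} \<union> {5..n}. 2 ^ k / fact k) \<le> (\<Sum>k. 2 ^ k / fact k :: real)"
    using summable_exp[of "2::real"] by (intro sum_le_suminf) (auto simp: divide_inverse mult.commute)
  also have "(\<Sum>k. 2 ^ k / fact k :: real) = exp 2"
    by (simp add: exp_def divide_inverse mult.commute)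
  also have "(\<Sum>k\<in>{..<5} \<union> {5..n}. 2 ^ k / fact k :: real) = (\<Sum>k<5. 2 ^ k / fact k) + (\<Sum>k\<in>{5..n}. 2 ^ k / fact k)"
    by (rule sum.union_disjoint) auto
  also have "(\<Sum>k<5. 2 ^ k / fact k :: real) = 7"
    by (simp add: eval_nat_numeral fact_numeral)
  finally show ?thesis by simp
qed

lemma exp_2_less: "exp 2 < (7.4::real)"
proof -
  have "exp (2::real) = exp 1 * exp 1" by (simp flip: exp_add)
  also have "\<dots> < (272/100) * (272/100)" using e_less_272 by (intro mult_strict_mono) auto
  finally show ?thesis by simp
qed

text \<open>The summands are w^(-1) w^k for the fourth roots of unity w. The sum cancels unless k
  mod 4 = 1; from k = 5 on the crude bound 4 is enough, because these indices go into the
  tail.\<close>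

lemma fourth_roots_character_sum:
  "k \<in> {0,2,3,4} \<Longrightarrow> 1 * 1 ^ k + (-1) * (-1) ^ k + (-\<i>) * \<i> ^ k + \<i> * (-\<i>) ^ k = (0::complex)"
  "cmod (1 * 1 ^ k + (-1) * (-1) ^ k + (-\<i>) * \<i> ^ k + \<i> * (-\<i>) ^ k) \<le> 4"
proof -
  show "cmod (1 * 1 ^ k + (-1) * (-1) ^ k + (-\<i>) * \<i> ^ k + \<i> * (-\<i>) ^ k) \<le> 4" for k
    using norm_triangle_ineq[of "1 * 1 ^ k + (-1) * (-1) ^ k + (-\<i>) * \<i> ^ k" "\<i> * (-\<i>) ^ k"]
      norm_triangle_ineq[of "1 * 1 ^ k + (-1) * (-1) ^ k" "(-\<i>) * \<i> ^ k"]
      norm_triangle_ineq[of "1 * 1 ^ k" "(-1) * (-1) ^ k :: complex"]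
    by (simp add: norm_mult norm_power)
qed (auto simp: power2_eq_square power3_eq_cube power4_eq_xxxx)


text \<open>Averaging \<open>\<zeta>\<^sup>-\<^sup>1 (1 + \<zeta> y)\<^sup>n\<close> over the fourth roots of unity, with \<open>y = 2 b / (n \<parallel>b\<parallel>)\<close>, isolates the
  linear term up to the terms of order at least 5, whose norms sum to at most \<open>exp 2 - 7\<close>.\<close>

lemma (in cseminormed_algebra) numerical_radius_zero:
  assumes b: "b \<in> V"
    and h: "\<And>z d. z \<in> {1, -1, \<i>, -\<i>} \<Longrightarrow> 0 < d \<Longrightarrow>
      \<exists>s0>0. \<forall>s. 0 < s \<and> s < s0 \<longrightarrow> N (e + sc (complex_of_real s * z) b) \<le> 1 + d * s"
  shows "N b = 0"
proof (rule ccontr)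
  define M where "M = N b"
  assume "N b \<noteq> 0"
  then have M: "0 < M" using N_nonneg[OF b] by (simp add: M_def)
  let ?R = "{1, -1, \<i>, -\<i>}"
  \<comment> \<open>The hypothesis says that the derivative of the norm at \<open>e\<close> is at
    most 0 in the directions b, -b, ib, -ib. The slope M/10 is chosen so that, with M s = 2/n below,
    the n-th powers are at most (1 + 1/(5n))^n \<le> exp(1/5).\<close>
  have "\<forall>z\<in>?R. \<exists>s0>0. \<forall>s. 0 < s \<and> s < s0 \<longrightarrow> N (e + sc (complex_of_real s * z) b) \<le> 1 + M/10 * s"
    by (intro ballI h) (use M in auto)
  then obtain \<sigma> where \<sigma>: "\<And>z. z \<in> ?R \<Longrightarrow> 0 < \<sigma> z"
      "\<And>z s. z \<in> ?R \<Longrightarrow> 0 < s \<Longrightarrow> s < \<sigma> z \<Longrightarrow> N (e + sc (complex_of_real s * z) b) \<le> 1 + M/10 * s"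
    by (metis (no_types, lifting))
  define s0 where "s0 = Min (\<sigma> ` ?R)"
  have s0: "0 < s0" "\<And>z. z \<in> ?R \<Longrightarrow> s0 \<le> \<sigma> z"
    using \<sigma>(1) by (auto simp: s0_def)
  obtain n0 :: nat where n0: "2 / (M * s0) < n0" using reals_Archimedean2 by blast
  define n where "n = max n0 5"
  have n: "5 \<le> n" "2 / (M * s0) < n" using n0 by (auto simp: n_def)
  define s where "s = 2 / (M * n)"
  have s: "0 < s" "s < s0" using n M s0 by (auto simp: s_def field_simps)
  have Ms: "M * s = 2 / n" using M by (simp add: s_def)
  define T where "T z = (\<Sum>k\<le>n. sc (of_nat (n choose k) * (complex_of_real s * z) ^ k) (pw b k))" for z
  have T_mem: "T z \<in> V" for z unfolding T_def by (intro sum_mem sc_mem pw_mem b)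
  have T_bound: "N (T z) \<le> exp (1/5)" if z: "z \<in> ?R" for z
  proof -
    have "N (T z) \<le> N (e + sc (complex_of_real s * z) b) ^ n"
      unfolding T_def by (rule binomial_bound[OF b])
    also have "\<dots> \<le> (1 + M/10 * s) ^ n"
      using \<sigma>(2)[OF z s(1)] s(2) s0(2)[OF z] b by (intro power_mono N_nonneg add_mem e_mem sc_mem) auto
    also have "1 + M/10 * s = 1 + (1/5) / n" using Ms by simp
    also have "\<dots> ^ n \<le> exp (1/5)" using n by (intro exp_ge_one_plus_x_over_n_power_n) auto
    finally show ?thesis .
  qed
  define ch :: "nat \<Rightarrow> complex" where
    "ch k = 1 * 1 ^ k + (-1) * (-1) ^ k + (-\<i>) * \<i> ^ k + \<i> * (-\<i>) ^ k" for k
  have ch0: "ch k = 0" if "k \<in> {0,2,3,4}" for k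
    unfolding ch_def by (rule fourth_roots_character_sum(1)[OF that])
  define c where "c k = of_nat (n choose k) * complex_of_real s ^ k * ch k" for k
  define U where "U = sc 1 (T 1) + sc (-1) (T (-1)) + sc (-\<i>) (T \<i>) + sc \<i> (T (-\<i>))"
  have "N U \<le> N (sc 1 (T 1) + sc (-1) (T (-1)) + sc (-\<i>) (T \<i>)) + N (sc \<i> (T (-\<i>)))"
    unfolding U_def by (intro N_add add_mem sc_mem T_mem)
  also have "\<dots> \<le> N (sc 1 (T 1) + sc (-1) (T (-1))) + N (sc (-\<i>) (T \<i>)) + N (sc \<i> (T (-\<i>)))"
    by (intro add_right_mono N_add add_mem sc_mem T_mem)
  also have "\<dots> \<le> N (sc 1 (T 1)) + N (sc (-1) (T (-1))) + N (sc (-\<i>) (T \<i>)) + N (sc \<i> (T (-\<i>)))"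
    by (intro add_right_mono N_add add_mem sc_mem T_mem)
  also have "\<dots> \<le> exp (1/5) + exp (1/5) + exp (1/5) + exp (1/5)"
    unfolding N_sc[OF T_mem] by (intro add_mono) (use T_bound in auto)
  also have "\<dots> \<le> 4 * (1 + 1/5 + (1/5)\<^sup>2)" using exp_bound[of "1/5::real"] by simp
  finally have NU: "N U \<le> 4 * (1 + 1/5 + (1/5)\<^sup>2)" .
  have factor: "1 * (C * (S * w)) + (-1) * (C * (S * x)) + (-\<i>) * (C * (S * y)) + \<i> * (C * (S * z))
      = C * S * (1 * w + (-1) * x + (-\<i>) * y + \<i> * z)" for C S w x y z :: complex
    by (simp add: algebra_simps)
  have "U = (\<Sum>k\<le>n. sc (c k) (pw b k))"
    unfolding U_def T_def scale_sum_right sum.distrib[symmetric] scale_scale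
      scale_left_distrib[symmetric]
    by (rule sum.cong[OF refl]) (simp only: c_def ch_def power_mult_distrib factor)
  also have "{..n} = insert 1 ({5..n} \<union> {0,2,3,4})" using n by auto
  also have "(\<Sum>k\<in>\<dots>. sc (c k) (pw b k)) = sc (c 1) (pw b 1) + (\<Sum>k\<in>{5..n} \<union> {0,2,3,4}. sc (c k) (pw b k))"
    by (rule sum.insert) auto
  also have "(\<Sum>k\<in>{5..n} \<union> {0,2,3,4}. sc (c k) (pw b k)) = (\<Sum>k\<in>{5..n}. sc (c k) (pw b k))"
    by (rule sum.mono_neutral_right) (auto simp: c_def ch0)
  also have "pw b 1 = b" using b by (simp add: mul_e_right)
  finally have U: "sc (c 1) b = U - (\<Sum>k\<in>{5..n}. sc (c k) (pw b k))" by simp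
  have "N (\<Sum>k\<in>{5..n}. sc (c k) (pw b k)) \<le> (\<Sum>k\<in>{5..n}. N (sc (c k) (pw b k)))"
    by (intro N_sum sc_mem pw_mem b)
  also have "\<dots> \<le> (\<Sum>k\<in>{5..n}. 4 * (2 ^ k / fact k))"
  proof (rule sum_mono)
    fix k assume k: "k \<in> {5..n}"
    have "real (n choose k) * fact k \<le> real n ^ k"
      using binomial_fact_pow[of n k] by (metis of_nat_fact of_nat_le_iff of_nat_mult of_nat_power)
    then have bk: "real (n choose k) / real n ^ k \<le> 1 / fact k"
      using n by (simp add: field_simps)
    have "N (sc (c k) (pw b k)) \<le> cmod (c k) * M ^ k"
      unfolding N_sc[OF pw_mem[OF b]] M_def by (intro mult_left_mono N_pw b) auto
    also have "cmod (c k) = real (n choose k) * s ^ k * cmod (ch k)"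
      using s by (simp add: c_def norm_mult norm_power)
    also have "\<dots> * M ^ k \<le> real (n choose k) * s ^ k * 4 * M ^ k"
      using s M fourth_roots_character_sum(2)[of k] by (intro mult_right_mono mult_left_mono) (auto simp: ch_def)
    also have "\<dots> = 4 * (real (n choose k) * (M * s) ^ k)" by (simp add: power_mult_distrib)
    also have "\<dots> = 4 * (2 ^ k * (real (n choose k) / real n ^ k))" by (simp add: Ms power_divide)
    also have "\<dots> \<le> 4 * (2 ^ k * (1 / fact k))" by (intro mult_left_mono bk) auto
    finally show "N (sc (c k) (pw b k)) \<le> 4 * (2 ^ k / fact k)" by simp
  qed
  also have "\<dots> = 4 * (\<Sum>k\<in>{5..n}. 2 ^ k / fact k)" by (simp add: sum_distrib_left)
  also have "\<dots> \<le> 4 * (exp 2 - 7)" by (intro mult_left_mono exp_tail_bound) auto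
  also have "\<dots> \<le> 4 * (2/5)" using exp_2_less by simp
  finally have tail: "N (\<Sum>k\<in>{5..n}. sc (c k) (pw b k)) \<le> 4 * (2/5)" .
  \<comment> \<open>The averaged powers contribute at most 4 * 1.24 = 4.96 and the tail at most 4 *
    0.4 = 1.6, whereas the linear term has norm 4 n s M = 8.\<close>
  have "N (sc (c 1) b) \<le> N U + N (\<Sum>k\<in>{5..n}. sc (c k) (pw b k))"
    unfolding U by (intro N_diff sum_mem sc_mem pw_mem b) (simp add: U_def add_mem diff_mem sc_mem T_mem)
  also have "\<dots> < 8" using NU tail by (simp add: power2_eq_square)
  finally have "N (sc (c 1) b) < 8" .
  moreover have "c 1 = of_nat n * complex_of_real s * 4"
    by (simp add: c_def ch_def)
  then have "N (sc (c 1) b) = real n * s * 4 * M"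
    using s by (simp add: N_sc[OF b] M_def norm_mult)
  then have "N (sc (c 1) b) = 8" using n M by (simp add: s_def)
  ultimately show False by simp
qed

section \<open>M-projections on normed algebras\<close>

definition (in cseminormed) M_projection :: "('v \<Rightarrow> 'v) \<Rightarrow> bool" where
  "M_projection P \<longleftrightarrow>
     (\<forall>x\<in>V. P x \<in> V) \<and> (\<forall>x\<in>V. \<forall>y\<in>V. P (x + y) = P x + P y) \<and>
     (\<forall>c. \<forall>x\<in>V. P (sc c x) = sc c (P x)) \<and> (\<forall>x\<in>V. P (P x) = P x) \<and>
     (\<forall>x\<in>V. N x = max (N (P x)) (N (x - P x)))"

context cseminormed begin

lemma
  assumes "M_projection P"
  shows MP_mem: "x \<in> V \<Longrightarrow> P x \<in> V"
    and MP_add: "x \<in> V \<Longrightarrow> y \<in> V \<Longrightarrow> P (x + y) = P x + P y"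
    and MP_sc: "x \<in> V \<Longrightarrow> P (sc c x) = sc c (P x)"
    and MP_idem: "x \<in> V \<Longrightarrow> P (P x) = P x"
    and MP_norm: "x \<in> V \<Longrightarrow> N x = max (N (P x)) (N (x - P x))"
  using assms unfolding M_projection_def by blast+

lemma MP_minus: "M_projection P \<Longrightarrow> x \<in> V \<Longrightarrow> P (- x) = - P x"
  using MP_sc[of P x "-1"] by simp

lemma MP_diff: "M_projection P \<Longrightarrow> x \<in> V \<Longrightarrow> y \<in> V \<Longrightarrow> P (x - y) = P x - P y"
  using MP_add[of P x "- y"] by (simp add: minus_mem MP_minus)

lemma MP_contractive: "M_projection P \<Longrightarrow> x \<in> V \<Longrightarrow> N (P x) \<le> N x"
  using MP_norm[of P x] by simp

lemma MP_complement: "M_projection P \<Longrightarrow> M_projection (\<lambda>x. x - P x)"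
  unfolding M_projection_def[of "\<lambda>x. x - P x"]
  by (auto simp: MP_mem diff_mem MP_add MP_sc MP_diff MP_idem scale_right_diff_distrib)
    (metis MP_norm max.commute)

lemma MP_norm_add:
  assumes P: "M_projection P" and "x \<in> V" "y \<in> V" "P x = x" "P y = 0"
  shows "N (x + y) = max (N x) (N y)"
  using MP_norm[OF P, of "x + y"] assms by (simp add: add_mem MP_add)

end

locale cnormed = cseminormed sc V N for sc :: "complex \<Rightarrow> 'v::ab_group_add \<Rightarrow> 'v" and V N +
  assumes N_eq_zero: "x \<in> V \<Longrightarrow> N x = 0 \<Longrightarrow> x = 0"
begin

text \<open>Suppose P w = 0 but y = Q w is nonzero. Then y lies in the common range, so |t y + w| =
  max(t|y|, |w|), which is t|y| for t = |w|/|y|. But Q sends t y + w to (t + 1) y, against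
  contractivity. Hence Q vanishes on the kernel of P.\<close>

lemma M_projection_unique:
  assumes P: "M_projection P" and Q: "M_projection Q" and PQ: "P ` V = Q ` V" and x: "x \<in> V"
  shows "P x = Q x"
proof -
  have fixQ: "P (Q y) = Q y" if "y \<in> V" for y
  proof -
    have "Q y \<in> P ` V" using that PQ by auto
    then show ?thesis using MP_idem[OF P] by auto
  qed
  have fixP: "Q (P y) = P y" if "y \<in> V" for y
  proof -
    have "P y \<in> Q ` V" using that PQ by auto
    then show ?thesis using MP_idem[OF Q] by auto
  qed
  define w where "w = x - P x"
  define y where "y = Q w"
  have w: "w \<in> V" "P w = 0" using x P by (auto simp: w_def diff_mem MP_mem MP_diff MP_idem)
  have y: "y \<in> V" "P y = y" "Q y = y" using w Q by (auto simp: y_def MP_mem fixQ MP_idem)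
  have "N y = 0"
  proof (rule ccontr)
    assume "N y \<noteq> 0"
    then have Ny: "0 < N y" using N_nonneg[OF y(1)] by simp
    define t where "t = N w / N y"
    have t: "0 \<le> t" "t * N y = N w" using Ny N_nonneg[OF w(1)] by (auto simp: t_def)
    have mem: "sc (complex_of_real t) y \<in> V" by (rule sc_mem[OF y(1)])
    have "N (sc (complex_of_real t) y + w) = max (N (sc (complex_of_real t) y)) (N w)"
      by (rule MP_norm_add[OF P]) (use mem y w P in \<open>auto simp: MP_sc\<close>)
    also have "\<dots> = t * N y" using t y by (simp add: N_sc)
    finally have 1: "N (sc (complex_of_real t) y + w) = t * N y" .
    have "Q (sc (complex_of_real t) y + w) = sc (complex_of_real (t + 1)) y"
      using Q mem y w by (simp add: MP_add MP_sc y_def scale_left_distrib)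
    then have "N (sc (complex_of_real (t + 1)) y) \<le> t * N y"
      using MP_contractive[OF Q, of "sc (complex_of_real t) y + w"] 1 mem w add_mem by simp
    then have "(t + 1) * N y \<le> t * N y" using N_sc[OF y(1), of "complex_of_real (t + 1)"] t(1) by simp
    then show False using Ny by simp
  qed
  then have "Q w = 0" using N_eq_zero y by (simp add: y_def)
  then have "Q x = Q (P x)" using x P Q by (simp add: w_def MP_diff MP_mem)
  then show ?thesis using fixP[OF x] by simp
qed

text \<open>M-projections commute with Hermitian operators; here Hermitian is expressed by
  \<open>\<parallel>1 + \<i> s T\<parallel> = 1 + O(s\<^sup>2)\<close>.\<close>

lemma M_projection_Hermitian:
  assumes P: "M_projection P"
    and T_mem: "\<And>x. x \<in> V \<Longrightarrow> T x \<in> V"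
    and T_add: "\<And>x y. x \<in> V \<Longrightarrow> y \<in> V \<Longrightarrow> T (x + y) = T x + T y"
    and T_sc: "\<And>c x. x \<in> V \<Longrightarrow> T (sc c x) = sc c (T x)"
    and T_bound: "\<And>x. x \<in> V \<Longrightarrow> N (T x) \<le> K * N x" and K: "0 \<le> K"
    and herm: "\<And>s x. x \<in> V \<Longrightarrow> N (x + sc (\<i> * complex_of_real s) (T x)) \<le> (1 + s\<^sup>2) * N x"
    and y: "y \<in> V" "P y = 0"
  shows "P (T y) = 0"
proof -
  have unit: "P (T y) = 0" if y: "y \<in> V" "P y = 0" "N y \<le> 1" for y
  proof (rule ccontr)
    define e where "e = P (T y)"
    define m where "m = N e"
    assume "P (T y) \<noteq> 0"
    then have m: "0 < m" using N_eq_zero[of e] N_nonneg[of e] MP_mem[OF P T_mem[OF y(1)]]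
      by (auto simp: e_def m_def less_le)
    have e: "e \<in> V" using y by (auto simp: e_def intro: MP_mem[OF P] T_mem)
    define x where "x = sc (inverse (complex_of_real m)) e"
    have x: "x \<in> V" "N x = 1" "P x = x" "e = sc (complex_of_real m) x"
      using e m P y by (auto simp: x_def sc_mem N_sc norm_inverse MP_sc e_def MP_idem T_mem)
        (simp add: m_def e_def)
    define PT where "PT = (\<lambda>x. P (T x))"
    have PT_mem: "PT v \<in> V" if "v \<in> V" for v using that by (simp add: PT_def MP_mem[OF P] T_mem)
    have PT_add: "PT (v + w) = PT v + PT w" if "v \<in> V" "w \<in> V" for v w
      using that P by (simp add: PT_def T_add T_mem MP_add)
    have PT_sc: "PT (sc c v) = sc c (PT v)" if "v \<in> V" for c v
      using that P by (simp add: PT_def T_sc T_mem MP_sc)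
    have PT_bound: "N (PT v) \<le> K * N v" if "v \<in> V" for v
      using MP_contractive[OF P T_mem[OF that]] T_bound[OF that] by (simp add: PT_def)
    have PPT: "P (PT v) = PT v" if "v \<in> V" for v using that P by (simp add: PT_def MP_idem T_mem)
    have est: "m \<le> s * (m * K + K\<^sup>2 + 3)" if s: "0 < s" "s \<le> 1" for s
    proof -
      let ?s = "complex_of_real s"
      \<comment> \<open>The M-norm gives |v| \<le> 1 since P x = x and P y = 0. The factor -i turns
        the perturbation i s T of y into a real gain: P(v + i s T v) = (1 + s m) x + i s P T
        x.\<close>
      define v where "v = x + sc (-\<i>) y"
      have v: "v \<in> V" using x y by (simp add: v_def add_mem diff_mem sc_mem)
      have Nv: "N v \<le> 1"
        unfolding v_def
        by (subst MP_norm_add[OF P]) (use x y P in \<open>auto simp: sc_mem minus_mem MP_sc MP_minus N_sc N_minus\<close>)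
      define u where "u = sc (1 + ?s * complex_of_real m) x + sc (\<i> * ?s) (PT x)"
      have u: "u \<in> V" using x by (simp add: u_def add_mem sc_mem PT_mem)
      have Pu: "P u = u" using x P by (simp add: u_def MP_add MP_sc sc_mem PT_mem PPT)
      have "P (v + sc (\<i> * ?s) (T v)) = P v + sc (\<i> * ?s) (PT v)"
        using v P by (simp add: MP_add MP_diff MP_sc sc_mem T_mem PT_def)
      also have "P v = x" using x y P by (simp add: v_def MP_add MP_diff MP_sc sc_mem)
      also have "PT v = PT x + sc (-\<i>) e"
        using x y by (simp only: v_def PT_add PT_sc sc_mem) (simp add: PT_def e_def)
      also have "x + sc (\<i> * ?s) (PT x + sc (-\<i>) e) = u"
        unfolding u_def x(4) by (simp add: scale_right_distrib scale_left_distrib algebra_simps)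
      finally have Pv: "P (v + sc (\<i> * ?s) (T v)) = u" .
      have "N u \<le> N (v + sc (\<i> * ?s) (T v))"
        using MP_contractive[OF P, of "v + sc (\<i> * ?s) (T v)"] Pv v by (simp add: add_mem diff_mem sc_mem T_mem)
      also have "\<dots> \<le> (1 + s\<^sup>2) * N v" by (rule herm[OF v])
      also have "\<dots> \<le> (1 + s\<^sup>2) * 1" using Nv by (intro mult_left_mono) auto
      finally have Nu: "N u \<le> 1 + s\<^sup>2" by simp
      \<comment> \<open>A second step, with -s, cancels i s P T x to first order and keeps the gain
        1 + s m; the remainder \<open>w\<close> below is of order s^2.\<close>
      have "P (u + sc (\<i> * complex_of_real (- s)) (T u)) = u + sc (\<i> * complex_of_real (- s)) (PT u)"
        using u P Pu by (simp add: MP_add MP_diff MP_sc sc_mem T_mem PT_def)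
      then have "N (u + sc (\<i> * complex_of_real (- s)) (PT u)) \<le> N (u + sc (\<i> * complex_of_real (- s)) (T u))"
        using MP_contractive[OF P, of "u + sc (\<i> * complex_of_real (- s)) (T u)"] u
        by (simp add: add_mem diff_mem sc_mem T_mem)
      also have "\<dots> \<le> (1 + (- s)\<^sup>2) * N u" by (rule herm[OF u])
      also have "\<dots> \<le> (1 + s\<^sup>2) * (1 + s\<^sup>2)" using Nu by (simp add: mult_left_mono)
      also have "\<dots> \<le> 1 + 3 * s\<^sup>2"
      proof -
        have "s\<^sup>2 \<le> 1" using s by (simp add: power_le_one)
        then have "s\<^sup>2 * s\<^sup>2 \<le> s\<^sup>2 * 1" by (intro mult_left_mono) auto
        then show ?thesis by (simp add: algebra_simps)
      qed
      finally have up: "N (u + sc (\<i> * complex_of_real (- s)) (PT u)) \<le> 1 + 3 * s\<^sup>2" .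
      define w where "w = sc (- \<i> * ?s * ?s * complex_of_real m) (PT x) + sc (?s * ?s) (PT (PT x))"
      have w: "w \<in> V" using x by (simp add: w_def add_mem diff_mem minus_mem sc_mem PT_mem)
      have "PT u = sc (1 + ?s * complex_of_real m) (PT x) + sc (\<i> * ?s) (PT (PT x))"
        using x by (simp add: u_def PT_add PT_sc sc_mem PT_mem)
      then have "u + sc (\<i> * complex_of_real (- s)) (PT u) = sc (1 + ?s * complex_of_real m) x + w"
        unfolding u_def w_def
        by (simp add: scale_right_distrib scale_left_distrib algebra_simps)
      then have split: "sc (1 + ?s * complex_of_real m) x
          = (u + sc (\<i> * complex_of_real (- s)) (PT u)) - w" by simp
      have "1 + s * m = cmod (complex_of_real (1 + s * m))" using s m by (subst norm_of_real) auto
      also have "\<dots> = N (sc (1 + ?s * complex_of_real m) x)" using x by (simp add: N_sc)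
      also have "\<dots> \<le> N (u + sc (\<i> * complex_of_real (- s)) (PT u)) + N w"
        unfolding split by (intro N_diff add_mem sc_mem PT_mem u w)
      also have "N w \<le> N (sc (- \<i> * ?s * ?s * complex_of_real m) (PT x)) + N (sc (?s * ?s) (PT (PT x)))"
        unfolding w_def using x by (intro N_add sc_mem PT_mem)
      also have "\<dots> = s\<^sup>2 * m * N (PT x) + s\<^sup>2 * N (PT (PT x))"
        using x s m by (simp add: N_sc N_minus sc_mem PT_mem norm_mult power2_eq_square)
      also have "\<dots> \<le> s\<^sup>2 * m * K + s\<^sup>2 * (K * K)"
      proof -
        have "N (PT x) \<le> K" using PT_bound[OF x(1)] x by simp
        moreover have "N (PT (PT x)) \<le> K * K"
          using PT_bound[OF PT_mem[OF x(1)]] calculation K by (meson mult_left_mono order_trans)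
        ultimately show ?thesis using m by (intro add_mono mult_left_mono) auto
      qed
      finally have "1 + s * m \<le> 1 + 3 * s\<^sup>2 + (s\<^sup>2 * m * K + s\<^sup>2 * (K * K))" using up by simp
      then have "s * m \<le> s * (s * (m * K + K\<^sup>2 + 3))" by (simp add: algebra_simps power2_eq_square)
      then show ?thesis using s by simp
    qed
    \<comment> \<open>m K + K^2 bounds |w| / s^2, and 3 comes from (1 + s^2)^2 \<le> 1 + 3 s^2; so m
      \<le> s L for every s in (0, 1].\<close>
    define L where "L = m * K + K\<^sup>2 + 3"
    have L: "0 < L" unfolding L_def using m K by (intro add_nonneg_pos add_nonneg_nonneg) auto
    define s where "s = min 1 (m / (2 * L))"
    have s: "0 < s" "s \<le> 1" "s \<le> m / (2 * L)" using m L by (auto simp: s_def)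
    have "m \<le> s * L" using est[OF s(1,2)] by (simp add: L_def)
    also have "\<dots> \<le> m / (2 * L) * L" using s L by (intro mult_right_mono) auto
    also have "\<dots> < m" using m L by simp
    finally show False by simp
  qed
  define r where "r = inverse (N y + 1)"
  have r: "0 < r" "r * N y \<le> 1" using N_nonneg[OF y(1)] by (auto simp: r_def field_simps)
  have "P (T (sc (complex_of_real r) y)) = 0"
    by (rule unit) (use y r P in \<open>auto simp: sc_mem MP_sc N_sc\<close>)
  then show ?thesis using y r P by (simp add: T_sc T_mem MP_sc)
qed

end

locale cnormed_algebra = cseminormed_algebra sc V N mul e + cnormed sc V N
  for sc :: "complex \<Rightarrow> 'v::ab_group_add \<Rightarrow> 'v" and V N mul e
begin

lemma M_projection_idempotent_annihilates:
  assumes P: "M_projection P" and z: "z = P e" "mul z z = z"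
    and central: "\<And>x. x \<in> V \<Longrightarrow> mul z x = mul x z"
    and c: "c \<in> V" "P c = 0"
  shows "mul z c = 0"
proof -
  have zV: "z \<in> V" using z(1) P by (simp add: MP_mem e_mem)
  have Nz: "N z \<le> 1" using MP_contractive[OF P e_mem] N_e z(1) by simp
  have z0: "mul z 0 = 0" using mul_sc_right[of z 0 0] zV zero_mem by simp
  have zmul: "mul z (mul x y) = mul x y" if "x \<in> V" "y \<in> V" "mul z x = x" for x y
    using mul_assoc[of z x y] zV that by simp
  have unit: "mul x z = x" if "x \<in> V" "mul z x = x" for x
    using central[of x] that by simp
  \<comment> \<open>The numerical radius of z c is measured against the unit z of the corner. This
    is what lets the M-norm act, since P z = z and P c = 0; centrality makes z a two-sided
    unit.\<close>
  interpret Z: cseminormed_algebra sc "{x \<in> V. mul z x = x}" N mul z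
    by unfold_locales
      (auto simp: zero_mem add_mem sc_mem mul_mem N_add N_sc mul_add_left mul_add_right mul_sc_left
        mul_sc_right mul_assoc N_mul zV Nz z(2) z0 zmul unit)
  have b: "mul z c \<in> {x \<in> V. mul z x = x}"
    using zV c by (simp add: mul_mem mul_assoc[symmetric] z(2))
  have "N (mul z c) = 0"
  proof (rule Z.numerical_radius_zero[OF b])
    fix w :: complex and d :: real
    assume w: "w \<in> {1, -1, \<i>, -\<i>}" and d: "0 < d"
    then have w: "cmod w = 1" by auto
    show "\<exists>s0>0. \<forall>s. 0 < s \<and> s < s0 \<longrightarrow> N (z + sc (complex_of_real s * w) (mul z c)) \<le> 1 + d * s"
    proof (intro exI[of _ "inverse (N c + 1)"] conjI allI impI)
      show "0 < inverse (N c + 1)" using N_nonneg[OF c(1)] by simp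
      fix s assume s: "0 < s \<and> s < inverse (N c + 1)"
      then have sc1: "s * N c \<le> 1" using N_nonneg[OF c(1)] by (simp add: field_simps)
      have "z + sc (complex_of_real s * w) (mul z c) = mul z (z + sc (complex_of_real s * w) c)"
        using zV c by (simp add: mul_add_right sc_mem mul_sc_right z(2))
      then have "N (z + sc (complex_of_real s * w) (mul z c)) \<le> N z * N (z + sc (complex_of_real s * w) c)"
        using zV c by (simp add: N_mul add_mem sc_mem)
      also have "N (z + sc (complex_of_real s * w) c) = max (N z) (N (sc (complex_of_real s * w) c))"
        by (rule MP_norm_add[OF P]) (use zV c P in \<open>auto simp: sc_mem MP_sc z(1) MP_idem e_mem\<close>)
      also have "\<dots> \<le> 1" using Nz sc1 s w c by (simp add: N_sc norm_mult)
      also have "N z * 1 \<le> 1" using Nz by simp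
      finally show "N (z + sc (complex_of_real s * w) (mul z c)) \<le> 1 + d * s"
        using N_nonneg[OF zV] s d by (smt (verit) mult_pos_pos mult_left_mono)
    qed
  qed
  then show ?thesis using N_eq_zero zV c by (simp add: mul_mem)
qed

lemma M_projection_central:
  assumes P: "M_projection P" and z: "z = P e"
    and central: "\<And>x. x \<in> V \<Longrightarrow> mul z x = mul x z"
  shows "mul z z = z" "x \<in> V \<Longrightarrow> P x = mul z x"
proof -
  have zV: "z \<in> V" using z P by (simp add: MP_mem e_mem)
  have Nz: "N z \<le> 1" using MP_contractive[OF P e_mem] N_e z by simp
  have Ne: "N (e - z) \<le> 1" using MP_norm[OF P e_mem] N_e z by simp
  have Pz: "P z = z" using P z by (simp add: MP_idem e_mem)
  have Pe: "P (e - z) = 0" using P Pz z zV by (simp add: MP_diff e_mem)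
  \<comment> \<open>1 + i s z is the sum of (1 + i s) z in the range of P and e - z in its kernel,
    so its norm is at most |1 + i s| = sqrt(1 + s^2) \<le> 1 + s^2.\<close>
  have herm: "N (x + sc (\<i> * complex_of_real s) (mul z x)) \<le> (1 + s\<^sup>2) * N x" if x: "x \<in> V" for s x
  proof -
    let ?c = "1 + \<i> * complex_of_real s"
    have "x + sc (\<i> * complex_of_real s) (mul z x) = mul (sc ?c z + (e - z)) x"
      using x zV by (simp add: mul_add_left mul_diff_left sc_mem diff_mem e_mem mul_sc_left mul_e_left
          scale_left_distrib mul_mem)
    then have "N (x + sc (\<i> * complex_of_real s) (mul z x)) \<le> N (sc ?c z + (e - z)) * N x"
      using x zV by (simp add: N_mul add_mem sc_mem diff_mem e_mem)
    also have "N (sc ?c z + (e - z)) = max (N (sc ?c z)) (N (e - z))"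
      by (rule MP_norm_add[OF P]) (use zV P Pz Pe in \<open>auto simp: sc_mem diff_mem e_mem MP_sc\<close>)
    also have "\<dots> \<le> 1 + s\<^sup>2"
    proof -
      have "cmod ?c = sqrt (1 + s\<^sup>2)" by (simp add: cmod_def)
      also have "\<dots> \<le> 1 + s\<^sup>2" by (rule real_le_lsqrt) (auto intro: self_le_power)
      finally have "cmod ?c * N z \<le> (1 + s\<^sup>2) * 1" using Nz N_nonneg[OF zV] by (intro mult_mono) auto
      then show ?thesis using Ne zV by (simp add: N_sc add_increasing2)
    qed
    finally show ?thesis using N_nonneg[OF x] by (simp add: mult_right_mono)
  qed
  have *: "P' (mul z y) = 0" if "M_projection P'" "y \<in> V" "P' y = 0" for P' y
    by (rule M_projection_Hermitian[where T="mul z" and K="N z"])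
      (use that zV in \<open>auto simp: mul_mem mul_add_right mul_sc_right N_mul N_nonneg intro: herm\<close>)
  \<comment> \<open>For P at e - z the invariance reads P(z^2) = z; for the complementary projection
    at z it reads z^2 = P(z^2).\<close>
  have "P (mul z (e - z)) = 0" by (rule *[OF P]) (use zV Pe in \<open>auto simp: diff_mem e_mem\<close>)
  then have "z - P (mul z z) = 0"
    using zV P Pz by (simp add: mul_diff_right e_mem mul_e_right MP_diff mul_mem)
  moreover have "mul z z - P (mul z z) = 0"
    using *[OF MP_complement[OF P] zV] Pz by simp
  ultimately show zz: "mul z z = z" by simp
  assume x: "x \<in> V"
  have "mul z (x - P x) = 0"
    by (rule M_projection_idempotent_annihilates[OF P z zz central])
      (use x P in \<open>auto simp: diff_mem MP_mem MP_diff MP_idem\<close>)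
  \<comment> \<open>The same annihilation for the complementary projection, whose value at the unit
    is e - z and whose kernel is the range of P.\<close>
  moreover have "mul (e - z) (P x) = 0"
  proof (rule M_projection_idempotent_annihilates[OF MP_complement[OF P]])
    show "e - z = e - P e" by (simp add: z)
    show "mul (e - z) (e - z) = e - z"
      using zV by (simp add: mul_diff_left mul_diff_right e_mem mul_e_left mul_e_right diff_mem zz)
    show "mul (e - z) y = mul y (e - z)" if "y \<in> V" for y
      using zV that by (simp add: mul_diff_left mul_diff_right e_mem mul_e_left mul_e_right central)
  qed (use x P in \<open>auto simp: MP_mem MP_idem\<close>)
  ultimately show "P x = mul z x"
    using x zV P by (simp add: mul_diff_left mul_diff_right MP_mem e_mem mul_e_left)
qed

text \<open>By \<open>M_projection_central\<close>, multiplications by such elements are exactly the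
  M-projections with central value at the unit. Elements have an advantage over projections: joins
  are given by a formula, and through \<open>lact\<close> they act on the dual.\<close>

definition M_central :: "'v \<Rightarrow> bool" where
  "M_central z \<longleftrightarrow> z \<in> V \<and> (\<forall>x\<in>V. mul z x = mul x z) \<and> mul z z = z \<and>
     (\<forall>x\<in>V. N x = max (N (mul z x)) (N (x - mul z x)))"

lemma M_central_zero: "M_central 0"
  using mul_sc_left[of 0 _ 0] mul_sc_right[of _ 0 0]
  by (auto simp: M_central_def zero_mem N_zero N_nonneg max_def)

text \<open>Split x by z, and then y = x - z x by w: the norm of x is the maximum over three pieces.
  With u = z + w - z w, the pieces z x and w y = u x - z x make up u x, and the third is x - u
  x.\<close>

lemma M_central_join:
  assumes z: "M_central z" and w: "M_central w"
  shows "M_central (z + w - mul z w)"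
    and "mul (z + w - mul z w) z = z" and "mul (z + w - mul z w) w = w"
proof -
  have zV: "z \<in> V" and wV: "w \<in> V" and zz: "mul z z = z" and ww: "mul w w = w"
    and zc: "\<And>x. x \<in> V \<Longrightarrow> mul z x = mul x z" and wc: "\<And>x. x \<in> V \<Longrightarrow> mul w x = mul x w"
    and zN: "\<And>x. x \<in> V \<Longrightarrow> N x = max (N (mul z x)) (N (x - mul z x))"
    and wN: "\<And>x. x \<in> V \<Longrightarrow> N x = max (N (mul w x)) (N (x - mul w x))"
    using z w unfolding M_central_def by blast+
  define u where "u = z + w - mul z w"
  have uV: "u \<in> V" using zV wV by (simp add: u_def add_mem diff_mem mul_mem)
  have ux: "mul u x = mul z x + mul w x - mul z (mul w x)" if "x \<in> V" for x
    using that zV wV by (simp add: u_def mul_diff_left mul_add_left add_mem mul_mem mul_assoc)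
  have xu: "mul x u = mul x z + mul x w - mul x (mul z w)" if "x \<in> V" for x
    using that zV wV by (simp add: u_def mul_diff_right mul_add_right add_mem mul_mem)
  have uc: "mul u x = mul x u" if x: "x \<in> V" for x
  proof -
    have "mul z (mul w x) = mul z (mul x w)" using wc[OF x] by simp
    also have "\<dots> = mul (mul x w) z" using x wV by (intro zc mul_mem)
    also have "\<dots> = mul x (mul w z)" using x wV zV by (simp add: mul_assoc)
    also have "mul w z = mul z w" using wc[OF zV] .
    finally show ?thesis using ux[OF x] xu[OF x] zc[OF x] wc[OF x] by simp
  qed
  have uz: "mul u z = z"
  proof -
    have "mul z (mul w z) = mul w z"
      using zV wV wc[OF zV] by (simp add: mul_assoc[symmetric] zz)
    then show ?thesis using ux[OF zV] by (simp add: zz)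
  qed
  have uw: "mul u w = w" using ux[OF wV] by (simp add: ww)
  have uu: "mul u u = u"
  proof -
    have "mul u (mul z w) = mul z w" using uV zV wV uz by (simp add: mul_assoc[symmetric])
    then show ?thesis using xu[OF uV] uz uw by (simp add: u_def)
  qed
  have uN: "N x = max (N (mul u x)) (N (x - mul u x))" if x: "x \<in> V" for x
  proof -
    define y where "y = x - mul z x"
    have yV: "y \<in> V" using x zV by (simp add: y_def diff_mem mul_mem)
    have wy: "mul w y = mul u x - mul z x"
    proof -
      have "mul w y = mul w x - mul w (mul z x)" using x zV wV by (simp add: y_def mul_diff_right mul_mem)
      also have "mul w (mul z x) = mul z (mul w x)"
        using x zV wV wc[OF zV] by (simp add: mul_assoc[symmetric])
      finally show ?thesis using ux[OF x] by simp
    qed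
    have zu: "mul z (mul u x) = mul z x"
      using x zV uV uc[OF zV] uz by (simp add: mul_assoc[symmetric])
    have "N x = max (N (mul z x)) (max (N (mul w y)) (N (y - mul w y)))"
      using zN[OF x] wN[OF yV] by (simp add: y_def)
    moreover have "N (mul u x) = max (N (mul z x)) (N (mul w y))"
      using zN[of "mul u x"] x uV zu wy by (simp add: mul_mem)
    moreover have "y - mul w y = x - mul u x" unfolding wy by (simp add: y_def)
    ultimately show ?thesis by (simp add: max.assoc)
  qed
  show "M_central (z + w - mul z w)"
    using uV uc uu uN unfolding M_central_def u_def by blast
  show "mul (z + w - mul z w) z = z" "mul (z + w - mul z w) w = w"
    using uz uw by (simp_all add: u_def)
qed

end

section \<open>The second Arens product\<close>

lemma fsm_apply: "fsm c f x = c * f x"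
  by (simp add: fsm_def)

lemma unimodular_phase: "\<exists>u. cmod u = 1 \<and> u * w = complex_of_real (cmod w)"
proof (cases "w = 0")
  case True
  then show ?thesis by (intro exI[of _ 1]) auto
next
  case False
  then show ?thesis using complex_norm_square[of w]
    by (intro exI[of _ "cnj w / cmod w"]) (simp add: norm_divide field_simps power2_eq_square)
qed

locale unital_cseminormed_algebra = cseminormed_algebra sc UNIV N mul e
  for sc :: "complex \<Rightarrow> 'v::ab_group_add \<Rightarrow> 'v" and N mul e
begin

sublocale D: cseminormed fsm dual dnorm
  by (rule cseminormed_dual)

abbreviation bidual where "bidual \<equiv> D.dual"
abbreviation bnorm where "bnorm \<equiv> D.dnorm"
abbreviation arens where "arens \<equiv> arens2 dual mul"
abbreviation emb where "emb \<equiv> cemb dual"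

text \<open>In module notation \<open>rslice f a\<close> is a \<cdot> f, and \<open>lact\<close>
  below gives f \<cdot> \<eta>. They get names because left multiplication by \<eta> on the bidual
  is the adjoint of f \<mapsto> f \<cdot> \<eta>, so norm and limit questions can be settled on the
  dual.\<close>

definition rslice :: "('v \<Rightarrow> complex) \<Rightarrow> 'v \<Rightarrow> 'v \<Rightarrow> complex" where
  "rslice f a = (\<lambda>b. f (mul b a))"

definition lact :: "(('v \<Rightarrow> complex) \<Rightarrow> complex) \<Rightarrow> ('v \<Rightarrow> complex) \<Rightarrow> 'v \<Rightarrow> complex" where
  "lact \<eta> f = (\<lambda>a. \<eta> (rslice f a))"

lemma arens_eq: "f \<in> dual \<Longrightarrow> arens \<eta> \<xi> f = \<xi> (lact \<eta> f)"
  by (simp add: arens2_def lact_def rslice_def)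

lemma arens_outside: "f \<notin> dual \<Longrightarrow> arens \<eta> \<xi> f = 0"
  by (simp add: arens2_def)

lemma emb_apply: "f \<in> dual \<Longrightarrow> emb x f = f x"
  by (simp add: cemb_def)

lemma emb_outside: "f \<notin> dual \<Longrightarrow> emb x f = 0"
  by (simp add: cemb_def)

lemma emb_mem: "emb x \<in> bidual" and bnorm_emb: "bnorm (emb x) \<le> N x"
proof -
  have *: "cmod (emb x f) \<le> N x * dnorm f" if "f \<in> dual" for f
    using dual_bound[OF that, of x] that by (simp add: emb_apply mult.commute)
  show "emb x \<in> bidual"
    by (rule D.dualI[where K="N x"])
      (use * in \<open>auto simp: emb_apply D.add_mem D.sc_mem fsm_apply emb_outside\<close>)
  show "bnorm (emb x) \<le> N x"
    by (rule D.dnorm_least) (use * in \<open>auto simp: N_nonneg\<close>)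
qed

lemma rslice_mem: "f \<in> dual \<Longrightarrow> rslice f a \<in> dual"
  and dnorm_rslice: "f \<in> dual \<Longrightarrow> dnorm (rslice f a) \<le> dnorm f * N a"
proof -
  assume f: "f \<in> dual"
  have *: "cmod (rslice f a b) \<le> (dnorm f * N a) * N b" for b
  proof -
    have "cmod (f (mul b a)) \<le> dnorm f * N (mul b a)" by (rule dual_bound[OF f]) simp
    also have "\<dots> \<le> dnorm f * (N b * N a)" by (intro mult_left_mono N_mul dnorm_nonneg f) auto
    finally show ?thesis by (simp add: rslice_def mult_ac)
  qed
  show "rslice f a \<in> dual"
    by (rule dualI[where K="dnorm f * N a"])
      (use * f in \<open>auto simp: rslice_def mul_add_left mul_sc_left dual_add dual_sc\<close>)
  show "dnorm (rslice f a) \<le> dnorm f * N a"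
    by (rule dnorm_least) (use * f in \<open>auto simp: dnorm_nonneg N_nonneg\<close>)
qed

lemma rslice_add: "rslice (f + g) a = rslice f a + rslice g a"
  and rslice_fsm: "rslice (fsm c f) a = fsm c (rslice f a)"
  by (auto simp: rslice_def fsm_def)

lemma lact_mem: "f \<in> dual \<Longrightarrow> \<eta> \<in> bidual \<Longrightarrow> lact \<eta> f \<in> dual"
  and dnorm_lact: "f \<in> dual \<Longrightarrow> \<eta> \<in> bidual \<Longrightarrow> dnorm (lact \<eta> f) \<le> bnorm \<eta> * dnorm f"
proof -
  assume f: "f \<in> dual" and \<eta>: "\<eta> \<in> bidual"
  have *: "cmod (lact \<eta> f a) \<le> (bnorm \<eta> * dnorm f) * N a" for a
  proof -
    have "cmod (\<eta> (rslice f a)) \<le> bnorm \<eta> * dnorm (rslice f a)"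
      by (intro D.dual_bound \<eta> rslice_mem f)
    also have "\<dots> \<le> bnorm \<eta> * (dnorm f * N a)"
      by (intro mult_left_mono dnorm_rslice f D.dnorm_nonneg \<eta>)
    finally show ?thesis by (simp add: lact_def mult_ac)
  qed
  have radd: "rslice f (x + y) = rslice f x + rslice f y" for x y
    using f by (auto simp: rslice_def mul_add_right dual_add)
  have rsc: "rslice f (sc c x) = fsm c (rslice f x)" for c x
    using f by (auto simp: rslice_def mul_sc_right dual_sc fsm_def)
  show "lact \<eta> f \<in> dual"
    by (rule dualI[where K="bnorm \<eta> * dnorm f"])
      (use * f \<eta> in \<open>auto simp: lact_def radd rsc D.dual_add D.dual_sc rslice_mem\<close>)
  show "dnorm (lact \<eta> f) \<le> bnorm \<eta> * dnorm f"
    by (rule dnorm_least) (use * f \<eta> in \<open>auto simp: dnorm_nonneg D.dnorm_nonneg\<close>)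
qed

lemma lact_add: "f \<in> dual \<Longrightarrow> g \<in> dual \<Longrightarrow> \<eta> \<in> bidual \<Longrightarrow> lact \<eta> (f + g) = lact \<eta> f + lact \<eta> g"
  by (auto simp: lact_def rslice_add D.dual_add rslice_mem)

lemma lact_fsm: "f \<in> dual \<Longrightarrow> \<eta> \<in> bidual \<Longrightarrow> lact \<eta> (fsm c f) = fsm c (lact \<eta> f)"
  by (auto simp: lact_def rslice_fsm D.dual_sc rslice_mem) (simp add: fsm_def)

lemma lact_diff:
  assumes "f \<in> dual" "g \<in> dual" "\<eta> \<in> bidual"
  shows "lact \<eta> (f - g) = lact \<eta> f - lact \<eta> g"
proof -
  have "lact \<eta> (f + fsm (-1) g) = lact \<eta> f + fsm (-1) (lact \<eta> g)"
    using assms by (simp only: lact_add D.sc_mem lact_fsm)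
  then show ?thesis by simp
qed

lemma lact_arens:
  assumes "f \<in> dual" "\<eta> \<in> bidual" "\<xi> \<in> bidual"
  shows "lact (arens \<eta> \<xi>) f = lact \<xi> (lact \<eta> f)"
proof
  fix a
  have "rslice (lact \<eta> f) a = lact \<eta> (rslice f a)"
    by (auto simp: rslice_def lact_def mul_assoc)
  then show "lact (arens \<eta> \<xi>) f a = lact \<xi> (lact \<eta> f) a"
    using assms by (simp add: lact_def[of "arens \<eta> \<xi>"] lact_def[of \<xi>] arens_eq rslice_mem)
qed

lemma lact_emb_unit: "f \<in> dual \<Longrightarrow> lact (emb e) f = f"
  by (auto simp: lact_def emb_apply rslice_mem) (simp add: rslice_def mul_e_left)

lemma lact_apply_unit: "lact \<eta> f e = \<eta> f"
  by (simp add: lact_def rslice_def mul_e_right)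

lemma arens_mem: "\<eta> \<in> bidual \<Longrightarrow> \<xi> \<in> bidual \<Longrightarrow> arens \<eta> \<xi> \<in> bidual"
  and bnorm_arens: "\<eta> \<in> bidual \<Longrightarrow> \<xi> \<in> bidual \<Longrightarrow> bnorm (arens \<eta> \<xi>) \<le> bnorm \<eta> * bnorm \<xi>"
proof -
  assume \<eta>: "\<eta> \<in> bidual" and \<xi>: "\<xi> \<in> bidual"
  have *: "cmod (arens \<eta> \<xi> f) \<le> (bnorm \<eta> * bnorm \<xi>) * dnorm f" if f: "f \<in> dual" for f
  proof -
    have "cmod (\<xi> (lact \<eta> f)) \<le> bnorm \<xi> * dnorm (lact \<eta> f)"
      by (intro D.dual_bound \<xi> lact_mem f \<eta>)
    also have "\<dots> \<le> bnorm \<xi> * (bnorm \<eta> * dnorm f)"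
      by (intro mult_left_mono dnorm_lact f \<eta> \<xi> D.dnorm_nonneg)
    finally show ?thesis using f by (simp add: arens_eq mult_ac)
  qed
  show "arens \<eta> \<xi> \<in> bidual"
    by (rule D.dualI[where K="bnorm \<eta> * bnorm \<xi>"])
      (use * \<eta> \<xi> in \<open>auto simp: arens_eq D.add_mem D.sc_mem lact_add lact_fsm lact_mem D.dual_add
        D.dual_sc arens_outside\<close>)
  show "bnorm (arens \<eta> \<xi>) \<le> bnorm \<eta> * bnorm \<xi>"
    by (rule D.dnorm_least) (use * \<eta> \<xi> in \<open>auto simp: D.dnorm_nonneg\<close>)
qed

sublocale B: cnormed_algebra fsm bidual bnorm arens "emb e"
proof -
  interpret BS: cseminormed fsm bidual bnorm by (rule D.cseminormed_dual)
  show "cnormed_algebra fsm bidual bnorm arens (emb e)"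
  proof unfold_locales
    fix \<eta> \<xi> \<omega> assume [simp]: "\<eta> \<in> bidual" "\<xi> \<in> bidual" "\<omega> \<in> bidual"
    have "lact (\<eta> + \<xi>) f = lact \<eta> f + lact \<xi> f" for f by (auto simp: lact_def)
    then have "arens (\<eta> + \<xi>) \<omega> f = (arens \<eta> \<omega> + arens \<xi> \<omega>) f" for f
      by (cases "f \<in> dual") (auto simp: arens_eq arens_outside D.dual_add lact_mem)
    then show "arens (\<eta> + \<xi>) \<omega> = arens \<eta> \<omega> + arens \<xi> \<omega>" ..
    show "arens \<omega> (\<eta> + \<xi>) = arens \<omega> \<eta> + arens \<omega> \<xi>"
      by (auto simp: fun_eq_iff arens2_def)
    show "arens (arens \<eta> \<xi>) \<omega> = arens \<eta> (arens \<xi> \<omega>)"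
    proof
      fix f show "arens (arens \<eta> \<xi>) \<omega> f = arens \<eta> (arens \<xi> \<omega>) f"
        by (cases "f \<in> dual") (auto simp: arens_eq lact_arens lact_mem arens_outside)
    qed
  next
    fix \<eta> \<xi> c assume [simp]: "\<eta> \<in> bidual" "\<xi> \<in> bidual"
    have "lact (fsm c \<eta>) f = fsm c (lact \<eta> f)" for f by (auto simp: lact_def fsm_def)
    then have "arens (fsm c \<eta>) \<xi> f = fsm c (arens \<eta> \<xi>) f" for f
      by (cases "f \<in> dual") (auto simp: arens_eq arens_outside D.dual_sc lact_mem fsm_apply)
    then show "arens (fsm c \<eta>) \<xi> = fsm c (arens \<eta> \<xi>)" ..
    show "arens \<eta> (fsm c \<xi>) = fsm c (arens \<eta> \<xi>)"
      by (auto simp: fun_eq_iff arens2_def fsm_def)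
    show "arens \<eta> \<xi> \<in> bidual" "bnorm (arens \<eta> \<xi>) \<le> bnorm \<eta> * bnorm \<xi>"
      by (auto intro: arens_mem bnorm_arens)
  next
    show "emb e \<in> bidual" by (rule emb_mem)
    show "bnorm (emb e) \<le> 1" using bnorm_emb[of e] N_e by simp
  next
    fix \<eta> assume [simp]: "\<eta> \<in> bidual"
    show "arens (emb e) \<eta> = \<eta>"
    proof
      fix f show "arens (emb e) \<eta> f = \<eta> f"
        by (cases "f \<in> dual") (auto simp: arens_eq lact_emb_unit arens_outside D.dual_outside)
    qed
    show "arens \<eta> (emb e) = \<eta>"
    proof
      fix f show "arens \<eta> (emb e) f = \<eta> f"
        by (cases "f \<in> dual") (auto simp: arens_eq emb_apply lact_mem lact_apply_unit arens_outside D.dual_outside)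
    qed
    show "\<eta> = 0" if "bnorm \<eta> = 0" using D.dnorm_eq_zero that by simp
  qed
qed

text \<open>Multiplication by z is the adjoint of \<open>lact z\<close>, and a map whose adjoint is
  an M-projection is an L-projection.\<close>

lemma lact_L_projection:
  assumes z: "B.M_central z" and f: "f \<in> dual"
  shows "dnorm f = dnorm (lact z f) + dnorm (f - lact z f)"
proof (rule antisym)
  have zB: "z \<in> bidual" using z by (simp add: B.M_central_def)
  have lz: "lact z f \<in> dual" using f zB by (rule lact_mem)
  then have fz: "f - lact z f \<in> dual" using f by (intro D.diff_mem)
  show "dnorm f \<le> dnorm (lact z f) + dnorm (f - lact z f)"
    using D.N_add[OF lz fz] by simp
  have est: "cmod (lact z f x) + cmod ((f - lact z f) y) \<le> dnorm f" if xy: "N x \<le> 1" "N y \<le> 1" for x y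
  proof -
    obtain u where u: "cmod u = 1" "u * lact z f x = cmod (lact z f x)" using unimodular_phase by blast
    obtain v where v: "cmod v = 1" "v * (f - lact z f) y = cmod ((f - lact z f) y)" using unimodular_phase by blast
    define \<eta> where "\<eta> = emb (sc u x)"
    define \<xi> where "\<xi> = emb (sc v y)"
    have B: "\<eta> \<in> bidual" "\<xi> \<in> bidual" by (auto simp: \<eta>_def \<xi>_def emb_mem)
    have N1: "bnorm \<eta> \<le> 1" "bnorm \<xi> \<le> 1"
      using bnorm_emb[of "sc u x"] bnorm_emb[of "sc v y"] u v xy by (auto simp: \<eta>_def \<xi>_def N_sc)
    \<comment> \<open>The M-norm keeps z \<eta> + (1 - z) \<xi> in the unit ball, and the phases
      make its value at f the sum of the two absolute values.\<close>
    define \<zeta> where "\<zeta> = arens z \<eta> + (\<xi> - arens z \<xi>)"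
    have zB2: "\<zeta> \<in> bidual" using B zB by (simp add: \<zeta>_def B.add_mem B.diff_mem arens_mem)
    have "arens z (arens z x) = arens z x" if "x \<in> bidual" for x
      using B.mul_assoc[of z z x] that zB z by (simp add: B.M_central_def)
    then have "arens z \<zeta> = arens z \<eta>"
      using B zB by (simp add: \<zeta>_def B.mul_add_right B.mul_diff_right B.diff_mem arens_mem)
    then have "bnorm \<zeta> = max (bnorm (arens z \<eta>)) (bnorm (\<xi> - arens z \<xi>))"
      using z zB2 by (simp add: B.M_central_def) (simp add: \<zeta>_def)
    also have "\<dots> \<le> 1"
      using z N1 B by (auto simp: B.M_central_def)
    finally have "cmod (\<zeta> f) \<le> 1 * dnorm f"
      using D.dual_bound[OF zB2 f] dnorm_nonneg[OF f] by (meson mult_right_mono order_trans)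
    moreover have "\<zeta> f = u * lact z f x + v * (f - lact z f) y"
      using f lz by (simp add: \<zeta>_def arens_eq \<eta>_def \<xi>_def emb_apply dual_sc right_diff_distrib)
    ultimately show ?thesis
      using u v by (simp del: of_real_add add: of_real_add[symmetric])
  qed
  have "dnorm (f - lact z f) \<le> dnorm f - dnorm (lact z f)"
  proof (rule dnorm_least_ball)
    fix y assume y: "N y \<le> 1"
    have "dnorm (lact z f) \<le> dnorm f - cmod ((f - lact z f) y)"
      by (rule dnorm_least_ball) (use est y in force)
    then show "cmod ((f - lact z f) y) \<le> dnorm f - dnorm (lact z f)" by simp
  qed
  then show "dnorm (lact z f) + dnorm (f - lact z f) \<le> dnorm f" by simp
qed

end

section \<open>Suprema of central M-idempotents\<close>

context unital_cseminormed_algebra begin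

text \<open>Here \<open>arens u z = z\<close> says that z lies below u. Going up, the norm gained
  equals the distance moved, so control of the norms alone gives the Cauchy property.\<close>

lemma lact_increasing:
  assumes z: "B.M_central z" and u: "B.M_central u" and uz: "arens u z = z" and f: "f \<in> dual"
  shows "dnorm (lact u f) = dnorm (lact z f) + dnorm (lact u f - lact z f)"
proof -
  have B: "z \<in> bidual" "u \<in> bidual" using z u by (auto simp: B.M_central_def)
  have "lact z (lact u f) = lact z f" using lact_arens[OF f, of u z] B uz by simp
  then show ?thesis using lact_L_projection[OF z lact_mem[OF f B(2)]] by simp
qed

text \<open>An element whose norm |f \<cdot> z| nearly attains the supremum can hardly be moved by
  passing above it. Two such elements are compared through their join, which yields a Cauchy
  sequence; its limit then serves the whole directed family.\<close>

lemma lact_directed_limit: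
  assumes Z: "\<And>z. z \<in> Z \<Longrightarrow> B.M_central z" "Z \<noteq> {}"
    and join: "\<And>z w. z \<in> Z \<Longrightarrow> w \<in> Z \<Longrightarrow> z + w - arens z w \<in> Z"
    and f: "f \<in> dual"
  shows "\<exists>g\<in>dual. \<forall>d>0. \<exists>z0\<in>Z. \<forall>z\<in>Z. arens z z0 = z0 \<longrightarrow> dnorm (lact z f - g) \<le> d"
proof -
  have ZB: "z \<in> bidual" if "z \<in> Z" for z using Z(1)[OF that] by (simp add: B.M_central_def)
  define S where "S = (SUP z\<in>Z. dnorm (lact z f))"
  have "dnorm (lact z f) \<le> dnorm f" if "z \<in> Z" for z
    using lact_L_projection[OF Z(1)[OF that] f] D.N_nonneg[of "f - lact z f"] f lact_mem[OF f ZB[OF that]]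
    by (simp add: D.diff_mem)
  then have bdd: "bdd_above ((\<lambda>z. dnorm (lact z f)) ` Z)" by (rule bdd_aboveI2)
  have up: "dnorm (lact z f) \<le> S" if "z \<in> Z" for z
    unfolding S_def by (rule cSUP_upper[OF that bdd])
  have "\<exists>z\<in>Z. S - 1 / Suc n < dnorm (lact z f)" for n
    using less_cSUP_iff[OF Z(2) bdd, of "S - 1 / Suc n"] by (simp add: S_def)
  then obtain z where z: "\<And>n. z n \<in> Z" "\<And>n. S - 1 / Suc n < dnorm (lact (z n) f)" by metis
  have above: "dnorm (lact u f - lact (z n) f) \<le> 1 / Suc n" if "u \<in> Z" "arens u (z n) = z n" for u n
    using lact_increasing[OF Z(1)[OF z(1)] Z(1)[OF that(1)] that(2) f] up[OF that(1)] z(2)[of n] by simp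
  define F where "F n = lact (z n) f" for n
  have F: "F n \<in> dual" for n by (simp add: F_def lact_mem f ZB z)
  have cauchy: "dnorm (F m - F n) \<le> 1 / Suc m + 1 / Suc n" for m n
  proof -
    define u where "u = z m + z n - arens (z m) (z n)"
    have u: "u \<in> Z" "arens u (z m) = z m" "arens u (z n) = z n"
      using join z B.M_central_join[OF Z(1)[OF z(1)] Z(1)[OF z(1)], of m n] by (auto simp: u_def)
    have lu: "lact u f \<in> dual" by (simp add: lact_mem f ZB u)
    have "dnorm (F m - F n) = dnorm ((lact u f - F n) - (lact u f - F m))" by simp
    also have "\<dots> \<le> dnorm (lact u f - F n) + dnorm (lact u f - F m)"
      by (intro D.N_diff D.diff_mem lu F)
    also have "\<dots> \<le> 1 / Suc n + 1 / Suc m" unfolding F_def by (intro add_mono above u)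
    finally show ?thesis by simp
  qed
  \<comment> \<open>From here on, completeness of the dual: the limit is taken pointwise in the
    complex numbers.\<close>
  have pt: "cmod (F m x - F n x) \<le> (1 / Suc m + 1 / Suc n) * N x" for m n x
  proof -
    have "cmod ((F m - F n) x) \<le> dnorm (F m - F n) * N x"
      by (intro dual_bound D.diff_mem F) simp
    also have "\<dots> \<le> (1 / Suc m + 1 / Suc n) * N x"
      by (intro mult_right_mono cauchy N_nonneg) simp
    finally show ?thesis by simp
  qed
  have lim0: "(\<lambda>n. (1 / Suc n) * c) \<longlonglongrightarrow> 0" for c :: real
    using tendsto_mult_right[OF LIMSEQ_Suc[OF lim_1_over_n], of c] by simp
  have "Cauchy (\<lambda>n. F n x)" for x
  proof (rule CauchyI)
    fix d :: real assume d: "0 < d"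
    then obtain M where M: "\<And>n. n \<ge> M \<Longrightarrow> \<bar>(1 / Suc n) * N x\<bar> < d / 2"
      using lim0[of "N x"] unfolding LIMSEQ_def dist_real_def
      by (metis diff_zero half_gt_zero)
    have "norm (F m x - F n x) < d" if "m \<ge> M" "n \<ge> M" for m n
      using pt[of m x n] M[OF that(1)] M[OF that(2)] unfolding distrib_right by linarith
    then show "\<exists>M. \<forall>m\<ge>M. \<forall>n\<ge>M. norm (F m x - F n x) < d" by blast
  qed
  then have "\<exists>l. (\<lambda>n. F n x) \<longlonglongrightarrow> l" for x
    by (simp add: Cauchy_convergent_iff convergent_def)
  then obtain g where g: "\<And>x. (\<lambda>n. F n x) \<longlonglongrightarrow> g x" by metis
  have gF: "cmod (F m x - g x) \<le> (1 / Suc m) * N x" for m x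
  proof (rule tendsto_le[OF sequentially_bot])
    show "(\<lambda>n. cmod (F m x - F n x)) \<longlonglongrightarrow> cmod (F m x - g x)"
      by (intro tendsto_intros g)
    show "(\<lambda>n. (1 / Suc m) * N x + (1 / Suc n) * N x) \<longlonglongrightarrow> (1 / Suc m) * N x"
      using tendsto_add[OF tendsto_const lim0] by simp
    show "\<forall>\<^sub>F n in sequentially. cmod (F m x - F n x) \<le> (1 / Suc m) * N x + (1 / Suc n) * N x"
      using pt by (simp add: distrib_right)
  qed
  have gD: "g \<in> dual"
  proof (rule dualI[where K="dnorm (F 0) + 1"])
    fix x y c
    have "(\<lambda>n. F n x + F n y) \<longlonglongrightarrow> g x + g y" by (intro tendsto_intros g)
    then have "(\<lambda>n. F n (x + y)) \<longlonglongrightarrow> g x + g y" by (simp add: dual_add[OF F])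
    then show "g (x + y) = g x + g y" using g[of "x + y"] LIMSEQ_unique by blast
    have "(\<lambda>n. c * F n x) \<longlonglongrightarrow> c * g x" by (intro tendsto_intros g)
    then have "(\<lambda>n. F n (sc c x)) \<longlonglongrightarrow> c * g x" by (simp add: dual_sc[OF F])
    then show "g (sc c x) = c * g x" using g[of "sc c x"] LIMSEQ_unique by blast
    show "cmod (g x) \<le> (dnorm (F 0) + 1) * N x"
      using dual_bound[OF F, of x 0] gF[of 0 x] norm_triangle_ineq2[of "g x" "F 0 x"]
      by (simp add: distrib_right norm_minus_commute)
  qed auto
  have dF: "dnorm (F n - g) \<le> 1 / Suc n" for n
    by (rule dnorm_least) (use gF in auto)
  have "\<exists>z0\<in>Z. \<forall>u\<in>Z. arens u z0 = z0 \<longrightarrow> dnorm (lact u f - g) \<le> d" if d: "0 < d" for d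
  proof -
    obtain n where n: "inverse (real (Suc n)) < d / 2" using reals_Archimedean[of "d/2"] d by auto
    have "dnorm (lact u f - g) \<le> d" if u: "u \<in> Z" "arens u (z n) = z n" for u
    proof -
      have "dnorm (lact u f - g) = dnorm ((lact u f - F n) + (F n - g))" by simp
      also have "\<dots> \<le> dnorm (lact u f - F n) + dnorm (F n - g)"
        by (intro D.N_add D.diff_mem F gD lact_mem f ZB u)
      also have "\<dots> \<le> 1 / Suc n + 1 / Suc n" using above[OF u] dF[of n] by (simp add: F_def)
      also have "\<dots> \<le> d" using n by (simp add: inverse_eq_divide)
      finally show ?thesis .
    qed
    then show ?thesis using z(1) by blast
  qed
  then show ?thesis using gD by blast
qed

text \<open>P is the adjoint of the strong limit \<Lambda> of the L-projections f \<mapsto> f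
  \<cdot> z. Its range is the annihilator of the kernel of \<Lambda>, and this kernel is the common
  kernel of those L-projections.\<close>

theorem M_central_supremum:
  assumes Z: "\<And>z. z \<in> Z \<Longrightarrow> B.M_central z" "Z \<noteq> {}"
    and join: "\<And>z w. z \<in> Z \<Longrightarrow> w \<in> Z \<Longrightarrow> z + w - arens z w \<in> Z"
  obtains P where "B.M_projection P"
    "P ` bidual = {\<eta> \<in> bidual. \<forall>f\<in>dual. (\<forall>z\<in>Z. lact z f = 0) \<longrightarrow> \<eta> f = 0}"
    "\<And>\<eta>. \<eta> \<in> bidual \<Longrightarrow> arens (P (emb e)) \<eta> = arens \<eta> (P (emb e))"
proof -
  have ZB: "z \<in> bidual" if "z \<in> Z" for z using Z(1)[OF that] by (simp add: B.M_central_def)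
  have "\<forall>f\<in>dual. \<exists>g. g \<in> dual \<and> (\<forall>d>0. \<exists>z0\<in>Z. \<forall>z\<in>Z. arens z z0 = z0 \<longrightarrow> dnorm (lact z f - g) \<le> d)"
    using lact_directed_limit[OF Z join] by blast
  then obtain \<Lambda> where \<Lambda>: "\<And>f. f \<in> dual \<Longrightarrow> \<Lambda> f \<in> dual"
    and \<Lambda>lim: "\<And>f d. f \<in> dual \<Longrightarrow> 0 < d \<Longrightarrow>
      \<exists>z0\<in>Z. \<forall>z\<in>Z. arens z z0 = z0 \<longrightarrow> dnorm (lact z f - \<Lambda> f) \<le> d"
    by metis
  \<comment> \<open>The filter of upper sections of Z. Joins make the sections a filter base, and
    the filter turns the epsilon statement about \<Lambda> into limits.\<close>
  define \<F> where "\<F> = (INF z0\<in>Z. principal {z \<in> Z. arens z z0 = z0})"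
  have idem: "arens z z = z" if "z \<in> Z" for z using Z(1)[OF that] by (simp add: B.M_central_def)
  have ev: "eventually Q \<F> \<longleftrightarrow> (\<exists>z0\<in>Z. \<forall>z\<in>Z. arens z z0 = z0 \<longrightarrow> Q z)" for Q
    unfolding \<F>_def
  proof (subst eventually_INF_base)
    fix a b assume ab: "a \<in> Z" "b \<in> Z"
    define u where "u = a + b - arens a b"
    have u: "u \<in> Z" "arens u a = a" "arens u b = b"
      using ab join B.M_central_join[OF Z(1) Z(1)] by (auto simp: u_def)
    have "arens z a = a \<and> arens z b = b" if "z \<in> Z" "arens z u = u" for z
      using B.mul_assoc[of z u a] B.mul_assoc[of z u b] that u ab ZB by simp
    then show "\<exists>x\<in>Z. principal {z \<in> Z. arens z x = x}
        \<le> inf (principal {z \<in> Z. arens z a = a}) (principal {z \<in> Z. arens z b = b})"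
      using u(1) by (intro bexI[of _ u]) auto
  qed (use Z(2) in \<open>auto simp: eventually_principal\<close>)
  have nbot: "\<F> \<noteq> bot"
    using idem by (auto simp: trivial_limit_def ev)
  have ev_Z: "eventually (\<lambda>z. z \<in> Z) \<F>" using Z(2) by (auto simp: ev)
  have ev_above: "eventually (\<lambda>z. arens z w = w) \<F>" if "w \<in> Z" for w
    using that by (auto simp: ev)
  have lim: "((\<lambda>z. dnorm (lact z f - \<Lambda> f)) \<longlongrightarrow> 0) \<F>" if f: "f \<in> dual" for f
  proof (rule tendstoI)
    fix d :: real assume "0 < d"
    then have "eventually (\<lambda>z. dnorm (lact z f - \<Lambda> f) \<le> d / 2) \<F>"
      using \<Lambda>lim[OF f, of "d / 2"] by (simp add: ev)
    with ev_Z show "\<forall>\<^sub>F z in \<F>. dist (dnorm (lact z f - \<Lambda> f)) 0 < d"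
    proof eventually_elim
      case (elim z)
      then show ?case using \<open>0 < d\<close> dnorm_nonneg[of "lact z f - \<Lambda> f"]
        by (simp add: dist_real_def D.diff_mem lact_mem f ZB \<Lambda>)
    qed
  qed
  \<comment> \<open>Norm convergence of f \<cdot> z is what admits an arbitrary \<eta>; pointwise
    convergence would cover only the embedded elements.\<close>
  have lim_B: "((\<lambda>z. \<eta> (lact z f)) \<longlongrightarrow> \<eta> (\<Lambda> f)) \<F>" if f: "f \<in> dual" and \<eta>: "\<eta> \<in> bidual" for f \<eta>
  proof (rule LIM_zero_cancel, rule Lim_null_comparison)
    show "((\<lambda>z. bnorm \<eta> * dnorm (lact z f - \<Lambda> f)) \<longlongrightarrow> 0) \<F>"
      using tendsto_mult_left[OF lim[OF f], of "bnorm \<eta>"] by simp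
    show "\<forall>\<^sub>F z in \<F>. norm (\<eta> (lact z f) - \<eta> (\<Lambda> f)) \<le> bnorm \<eta> * dnorm (lact z f - \<Lambda> f)"
      using ev_Z
    proof eventually_elim
      case (elim z)
      have m: "lact z f \<in> dual" "\<Lambda> f \<in> dual" using elim f by (auto simp: lact_mem ZB \<Lambda>)
      show ?case using D.dual_bound[OF \<eta> D.diff_mem[OF m]] m \<eta>
        by (simp add: D.dual_diff)
    qed
  qed
  have lim_pt: "((\<lambda>z. lact z f x) \<longlongrightarrow> \<Lambda> f x) \<F>" if f: "f \<in> dual" for f x
  proof (rule Lim_transform_eventually)
    show "((\<lambda>z. emb x (lact z f)) \<longlongrightarrow> \<Lambda> f x) \<F>"
      using lim_B[OF f emb_mem[of x]] by (simp add: emb_apply \<Lambda> f)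
  qed (use ev_Z in \<open>auto elim!: eventually_mono simp: emb_apply lact_mem f ZB\<close>)
  have lim_unit: "((\<lambda>z. z f) \<longlongrightarrow> \<Lambda> f e) \<F>" if f: "f \<in> dual" for f
    using lim_pt[OF f, of e] by (simp add: lact_apply_unit)
  have \<Lambda>_add: "\<Lambda> (f + g) = \<Lambda> f + \<Lambda> g" if fg: "f \<in> dual" "g \<in> dual" for f g
  proof
    fix x
    have "((\<lambda>z. lact z f x + lact z g x) \<longlongrightarrow> \<Lambda> f x + \<Lambda> g x) \<F>"
      by (intro tendsto_intros lim_pt fg)
    then have "((\<lambda>z. lact z (f + g) x) \<longlongrightarrow> \<Lambda> f x + \<Lambda> g x) \<F>"
      by (rule Lim_transform_eventually)
        (use ev_Z in \<open>auto elim!: eventually_mono simp: lact_add fg ZB\<close>)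
    then show "\<Lambda> (f + g) x = (\<Lambda> f + \<Lambda> g) x"
      using tendsto_unique[OF nbot lim_pt[of "f + g" x]] fg by (simp add: D.add_mem)
  qed
  have \<Lambda>_sc: "\<Lambda> (fsm c f) = fsm c (\<Lambda> f)" if f: "f \<in> dual" for c f
  proof
    fix x
    have "((\<lambda>z. c * lact z f x) \<longlongrightarrow> c * \<Lambda> f x) \<F>" by (intro tendsto_intros lim_pt f)
    then have "((\<lambda>z. lact z (fsm c f) x) \<longlongrightarrow> c * \<Lambda> f x) \<F>"
      by (rule Lim_transform_eventually)
        (use ev_Z in \<open>auto elim!: eventually_mono simp: lact_fsm f ZB fsm_apply\<close>)
    then show "\<Lambda> (fsm c f) x = fsm c (\<Lambda> f) x"
      using tendsto_unique[OF nbot lim_pt[of "fsm c f" x]] f by (simp add: D.sc_mem fsm_apply)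
  qed
  have \<Lambda>_norm: "dnorm f = dnorm (\<Lambda> f) + dnorm (f - \<Lambda> f)" if f: "f \<in> dual" for f
  proof (rule antisym)
    show "dnorm f \<le> dnorm (\<Lambda> f) + dnorm (f - \<Lambda> f)"
      using D.N_add[OF \<Lambda>[OF f] D.diff_mem[OF f \<Lambda>[OF f]]] by simp
    show "dnorm (\<Lambda> f) + dnorm (f - \<Lambda> f) \<le> dnorm f"
    proof (rule tendsto_lowerbound[OF _ _ nbot])
      \<comment> \<open>Replacing \<Lambda> f by f \<cdot> z in both summands costs the distance
        between them twice.\<close>
      show "((\<lambda>z. dnorm f + 2 * dnorm (lact z f - \<Lambda> f)) \<longlongrightarrow> dnorm f) \<F>"
        using tendsto_add[OF tendsto_const[of "dnorm f"] tendsto_mult_left[OF lim[OF f], of 2]] by simp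
      show "\<forall>\<^sub>F z in \<F>. dnorm (\<Lambda> f) + dnorm (f - \<Lambda> f) \<le> dnorm f + 2 * dnorm (lact z f - \<Lambda> f)"
        using ev_Z
      proof eventually_elim
        case (elim z)
        have m: "lact z f \<in> dual" "\<Lambda> f \<in> dual" using elim f by (auto simp: lact_mem ZB \<Lambda>)
        have "dnorm (\<Lambda> f) \<le> dnorm (lact z f) + dnorm (lact z f - \<Lambda> f)"
          using D.N_diff[OF m(1) D.diff_mem[OF m]] by simp
        moreover have "dnorm (f - \<Lambda> f) \<le> dnorm (f - lact z f) + dnorm (lact z f - \<Lambda> f)"
          using D.N_add[OF D.diff_mem[OF f m(1)] D.diff_mem[OF m]] by simp
        ultimately show ?case using lact_L_projection[OF Z(1)[OF elim] f] by simp
      qed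
    qed
  qed
  have lact_\<Lambda>: "lact w (\<Lambda> f) = lact w f" if f: "f \<in> dual" and w: "w \<in> Z" for f w
  proof
    fix x
    \<comment> \<open>This element of the bidual evaluates h \<cdot> w at x, so \<open>lim_B\<close>
      applies to it; as soon as z lies above w, (f \<cdot> z) \<cdot> w is constantly f \<cdot>
      w.\<close>
    define \<eta> where "\<eta> = arens w (emb x)"
    have \<eta>: "\<eta> \<in> bidual" unfolding \<eta>_def by (intro arens_mem ZB w emb_mem)
    have \<eta>_eq: "\<eta> h = lact w h x" if "h \<in> dual" for h
      using that w by (simp add: \<eta>_def arens_eq emb_apply lact_mem ZB)
    have "((\<lambda>z. \<eta> (lact z f)) \<longlongrightarrow> lact w f x) \<F>"
    proof (rule tendsto_eventually)
      show "\<forall>\<^sub>F z in \<F>. \<eta> (lact z f) = lact w f x"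
        using ev_Z ev_above[OF w]
      proof eventually_elim
        case (elim z)
        then show ?case using lact_arens[OF f, of z w] w by (simp add: \<eta>_eq lact_mem f ZB)
      qed
    qed
    then have "\<eta> (\<Lambda> f) = lact w f x" using tendsto_unique[OF nbot lim_B[OF f \<eta>]] by simp
    then show "lact w (\<Lambda> f) x = lact w f x" by (simp add: \<eta>_eq \<Lambda> f)
  qed
  have \<Lambda>_idem: "\<Lambda> (\<Lambda> f) = \<Lambda> f" if f: "f \<in> dual" for f
  proof
    fix x
    have "((\<lambda>z. lact z (\<Lambda> f) x) \<longlongrightarrow> \<Lambda> f x) \<F>"
      by (rule Lim_transform_eventually[OF lim_pt[OF f]])
        (use ev_Z in \<open>auto elim!: eventually_mono simp: lact_\<Lambda> f\<close>)
    then show "\<Lambda> (\<Lambda> f) x = \<Lambda> f x" using tendsto_unique[OF nbot lim_pt[OF \<Lambda>[OF f], of x]] by simp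
  qed
  define P where "P \<eta> = (\<lambda>f. if f \<in> dual then \<eta> (\<Lambda> f) else 0)" for \<eta> :: "('v \<Rightarrow> complex) \<Rightarrow> complex"
  have P_apply: "P \<eta> f = \<eta> (\<Lambda> f)" if "f \<in> dual" for \<eta> f using that by (simp add: P_def)
  have P_out: "P \<eta> f = 0" if "f \<notin> dual" for \<eta> f using that by (simp add: P_def)
  have \<Lambda>_le: "dnorm (\<Lambda> f) \<le> dnorm f" "dnorm (f - \<Lambda> f) \<le> dnorm f" if f: "f \<in> dual" for f
    using \<Lambda>_norm[OF f] dnorm_nonneg[OF \<Lambda>[OF f]] dnorm_nonneg[OF D.diff_mem[OF f \<Lambda>[OF f]]] by auto
  have P_mem: "P \<eta> \<in> bidual" if \<eta>: "\<eta> \<in> bidual" for \<eta>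
  proof (rule D.dualI[where K="bnorm \<eta>"])
    show "cmod (P \<eta> f) \<le> bnorm \<eta> * dnorm f" if f: "f \<in> dual" for f
      using D.dual_bound[OF \<eta> \<Lambda>[OF f]] mult_left_mono[OF \<Lambda>_le(1)[OF f] D.dnorm_nonneg[OF \<eta>]] f
      by (simp add: P_apply)
  qed (use \<eta> in \<open>auto simp: P_apply P_out D.add_mem D.sc_mem \<Lambda>_add \<Lambda>_sc \<Lambda> D.dual_add D.dual_sc\<close>)
  have diff_apply: "(\<eta> - P \<eta>) f = \<eta> (f - \<Lambda> f)" if "\<eta> \<in> bidual" "f \<in> dual" for \<eta> f
    using that by (simp add: P_apply D.dual_diff \<Lambda>)
  have MP: "B.M_projection P"
    unfolding B.M_projection_def
  proof (intro conjI ballI allI)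
    fix \<eta> assume \<eta>: "\<eta> \<in> bidual"
    show "P \<eta> \<in> bidual" by (rule P_mem[OF \<eta>])
    show "P (P \<eta>) = P \<eta>" by (auto simp: fun_eq_iff P_def \<Lambda> \<Lambda>_idem)
    show "P (fsm c \<eta>) = fsm c (P \<eta>)" for c by (auto simp: fun_eq_iff P_def fsm_apply)
    show "P (\<eta> + \<xi>) = P \<eta> + P \<xi>" for \<xi> by (auto simp: fun_eq_iff P_def)
    have d: "\<eta> - P \<eta> \<in> bidual" by (intro B.diff_mem \<eta> P_mem)
    show "bnorm \<eta> = max (bnorm (P \<eta>)) (bnorm (\<eta> - P \<eta>))"
    proof (rule antisym)
      show "bnorm \<eta> \<le> max (bnorm (P \<eta>)) (bnorm (\<eta> - P \<eta>))" (is "_ \<le> ?m")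
      proof (rule D.dnorm_least)
        fix f assume f: "f \<in> dual"
        have m: "\<Lambda> f \<in> dual" "f - \<Lambda> f \<in> dual" using f by (auto simp: \<Lambda> D.diff_mem)
        have 1: "\<eta> (\<Lambda> f) = P \<eta> (\<Lambda> f)" by (simp add: P_apply \<Lambda>_idem \<Lambda> f)
        have "\<Lambda> (f - \<Lambda> f) = 0"
          using \<Lambda>_add[OF f D.minus_mem[OF m(1)]] \<Lambda>_sc[OF m(1), of "-1"] \<Lambda>_idem[OF f] by simp
        then have 2: "\<eta> (f - \<Lambda> f) = (\<eta> - P \<eta>) (f - \<Lambda> f)"
          using m D.dual_zero[OF \<eta>] by (simp add: P_apply)
        have "\<eta> f = \<eta> (\<Lambda> f) + \<eta> (f - \<Lambda> f)" using D.dual_add[OF \<eta> m] by simp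
        then have "cmod (\<eta> f) \<le> cmod (P \<eta> (\<Lambda> f)) + cmod ((\<eta> - P \<eta>) (f - \<Lambda> f))"
          unfolding 1 2 using norm_triangle_ineq by metis
        also have "\<dots> \<le> bnorm (P \<eta>) * dnorm (\<Lambda> f) + bnorm (\<eta> - P \<eta>) * dnorm (f - \<Lambda> f)"
          by (intro add_mono D.dual_bound P_mem \<eta> m d)
        also have "\<dots> \<le> ?m * dnorm (\<Lambda> f) + ?m * dnorm (f - \<Lambda> f)"
          by (intro add_mono mult_right_mono dnorm_nonneg m) auto
        also have "\<dots> = ?m * dnorm f" using \<Lambda>_norm[OF f] by (simp add: distrib_left)
        finally show "cmod (\<eta> f) \<le> ?m * dnorm f" .
      qed (use D.dnorm_nonneg[OF d] in auto)
      have "bnorm (P \<eta>) \<le> bnorm \<eta>"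
      proof (rule D.dnorm_least)
        fix f assume f: "f \<in> dual"
        show "cmod (P \<eta> f) \<le> bnorm \<eta> * dnorm f"
          using D.dual_bound[OF \<eta> \<Lambda>[OF f]] mult_left_mono[OF \<Lambda>_le(1)[OF f] D.dnorm_nonneg[OF \<eta>]] f
          by (simp add: P_apply)
      qed (rule D.dnorm_nonneg[OF \<eta>])
      moreover have "bnorm (\<eta> - P \<eta>) \<le> bnorm \<eta>"
      proof (rule D.dnorm_least)
        fix f assume f: "f \<in> dual"
        show "cmod ((\<eta> - P \<eta>) f) \<le> bnorm \<eta> * dnorm f"
          unfolding diff_apply[OF \<eta> f]
          using D.dual_bound[OF \<eta> D.diff_mem[OF f \<Lambda>[OF f]]]
            mult_left_mono[OF \<Lambda>_le(2)[OF f] D.dnorm_nonneg[OF \<eta>]] by simp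
      qed (rule D.dnorm_nonneg[OF \<eta>])
      ultimately show "max (bnorm (P \<eta>)) (bnorm (\<eta> - P \<eta>)) \<le> bnorm \<eta>" by simp
    qed
  qed
  have range: "P ` bidual = {\<eta> \<in> bidual. \<forall>f\<in>dual. (\<forall>z\<in>Z. lact z f = 0) \<longrightarrow> \<eta> f = 0}"
  proof (intro equalityI subsetI)
    fix \<eta> assume "\<eta> \<in> P ` bidual"
    then obtain \<xi> where \<xi>: "\<xi> \<in> bidual" "\<eta> = P \<xi>" by auto
    have "\<eta> f = 0" if f: "f \<in> dual" and z0: "\<forall>z\<in>Z. lact z f = 0" for f
    proof -
      have "\<Lambda> f x = 0" for x
      proof -
        have "((\<lambda>z. lact z f x) \<longlongrightarrow> 0) \<F>"
          by (rule tendsto_eventually) (use ev_Z z0 in \<open>auto elim!: eventually_mono\<close>)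
        then show ?thesis using tendsto_unique[OF nbot lim_pt[OF f, of x]] by simp
      qed
      then have "\<Lambda> f = 0" by auto
      then show ?thesis using \<xi> f D.dual_zero[OF \<xi>(1)] by (simp add: P_apply)
    qed
    then show "\<eta> \<in> {\<eta> \<in> bidual. \<forall>f\<in>dual. (\<forall>z\<in>Z. lact z f = 0) \<longrightarrow> \<eta> f = 0}"
      using \<xi> P_mem by auto
  next
    fix \<eta> assume "\<eta> \<in> {\<eta> \<in> bidual. \<forall>f\<in>dual. (\<forall>z\<in>Z. lact z f = 0) \<longrightarrow> \<eta> f = 0}"
    then have \<eta>: "\<eta> \<in> bidual" and k: "\<And>f. f \<in> dual \<Longrightarrow> (\<And>z. z \<in> Z \<Longrightarrow> lact z f = 0) \<Longrightarrow> \<eta> f = 0"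
      by auto
    have "P \<eta> f = \<eta> f" for f
    proof (cases "f \<in> dual")
      case f: True
      have "\<eta> (f - \<Lambda> f) = 0"
        by (rule k) (use f \<Lambda> ZB in \<open>auto simp: D.diff_mem lact_diff lact_\<Lambda>\<close>)
      then show ?thesis using f \<eta> by (simp add: P_apply D.dual_diff \<Lambda>)
    qed (use \<eta> in \<open>simp add: P_out D.dual_outside\<close>)
    then have "\<eta> = P \<eta>" by auto
    then show "\<eta> \<in> P ` bidual" using \<eta> by blast
  qed
  \<comment> \<open>One order is computed from f \<cdot> P(1) = \<Lambda> f. The other is the limit
    of z(f \<cdot> \<eta>) = \<eta>(f \<cdot> z), which is the centrality of z tested at f.\<close>
  have comm: "arens (P (emb e)) \<eta> = arens \<eta> (P (emb e))" if \<eta>: "\<eta> \<in> bidual" for \<eta>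
  proof
    fix f
    have Pe: "P (emb e) h = \<Lambda> h e" if "h \<in> dual" for h
      using that by (simp add: P_apply emb_apply \<Lambda>)
    show "arens (P (emb e)) \<eta> f = arens \<eta> (P (emb e)) f"
    proof (cases "f \<in> dual")
      case f: True
      have "lact (P (emb e)) f a = \<Lambda> f a" for a
      proof -
        have "lact (P (emb e)) f a = \<Lambda> (rslice f a) e" by (simp add: lact_def Pe rslice_mem f)
        moreover have "((\<lambda>z. z (rslice f a)) \<longlongrightarrow> \<Lambda> (rslice f a) e) \<F>"
          by (intro lim_unit rslice_mem f)
        ultimately show ?thesis
          using tendsto_unique[OF nbot lim_pt[OF f, of a]] by (simp add: lact_def)
      qed
      then have "lact (P (emb e)) f = \<Lambda> f" by auto
      then have 1: "arens (P (emb e)) \<eta> f = \<eta> (\<Lambda> f)" using f by (simp add: arens_eq)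
      have lf: "lact \<eta> f \<in> dual" by (rule lact_mem[OF f \<eta>])
      have "((\<lambda>z. \<eta> (lact z f)) \<longlongrightarrow> \<Lambda> (lact \<eta> f) e) \<F>"
      proof (rule Lim_transform_eventually[OF lim_unit[OF lf]])
        show "\<forall>\<^sub>F z in \<F>. z (lact \<eta> f) = \<eta> (lact z f)"
          using ev_Z
        proof eventually_elim
          case (elim z)
          have "arens z \<eta> f = arens \<eta> z f" using Z(1)[OF elim] \<eta> by (simp add: B.M_central_def)
          then show ?case using f by (simp add: arens_eq)
        qed
      qed
      then have "\<Lambda> (lact \<eta> f) e = \<eta> (\<Lambda> f)" using tendsto_unique[OF nbot lim_B[OF f \<eta>]] by simp
      then show ?thesis using 1 f lf by (simp add: arens_eq Pe)
    qed (simp add: arens_outside)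
  qed
  show thesis by (rule that[OF MP range comm])
qed

end

section \<open>Quotient seminorms and states\<close>

locale real_cseminormed = cseminormed sc UNIV N
  for sc :: "complex \<Rightarrow> 'v::real_vector \<Rightarrow> 'v" and N +
  assumes sc_of_real: "sc (complex_of_real r) x = r *\<^sub>R x"
begin

lemma sublinear_N: "sublinear N"
  by (rule sublinearI) (auto simp: N_add N_zero N_sc simp flip: sc_of_real)

lemma linear_functional_complexify:
  assumes "linear f" "\<And>x. f x \<le> N x"
  obtains F where "F \<in> dual" "\<And>x. Re (F x) = f x" "\<And>x. cmod (F x) \<le> N x"
proof -
  obtain F where F: "\<And>x y. F (x + y) = F x + F y" "\<And>c x. F (sc c x) = c * F x"
    "\<And>x. Re (F x) = f x" "\<And>x. cmod (F x) \<le> N x"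
    using complexify_functional[OF vector_space_axioms sc_of_real assms] N_sc by blast
  have "F \<in> dual" by (rule dualI[where K=1]) (use F in auto)
  then show thesis using that F by blast
qed

lemma norming_functional:
  obtains F where "F \<in> dual" "\<And>x. cmod (F x) \<le> N x" "Re (F x0) = N x0"
proof -
  obtain f where f: "linear f" "\<And>x. f x \<le> N x" "f x0 = N x0"
    using Hahn_Banach_sublinear[OF sublinear_N] by blast
  obtain F where "F \<in> dual" "\<And>x. Re (F x) = f x" "\<And>x. cmod (F x) \<le> N x"
    using linear_functional_complexify[OF f(1,2)] by blast
  then show thesis using that f(3) by metis
qed

text \<open>The quotient by W stays on the same type with a smaller seminorm, so a bounded
  functional on the quotient is a functional on the original space that vanishes on W.\<close>

definition qnorm :: "'v set \<Rightarrow> 'v \<Rightarrow> real" where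
  "qnorm W x = (INF w\<in>W. N (x - w))"

context
  fixes W :: "'v set"
  assumes W0: "0 \<in> W" and W_add: "\<And>x y. x \<in> W \<Longrightarrow> y \<in> W \<Longrightarrow> x + y \<in> W"
    and W_sc: "\<And>c x. x \<in> W \<Longrightarrow> sc c x \<in> W"
begin

lemma qnorm_bdd_below: "bdd_below ((\<lambda>w. N (x - w)) ` W)"
  by (rule bdd_belowI2[of _ 0]) (simp add: N_nonneg)

lemma qnorm_le: "w \<in> W \<Longrightarrow> qnorm W x \<le> N (x - w)"
  unfolding qnorm_def by (rule cINF_lower[OF qnorm_bdd_below])

lemma qnorm_le_N: "qnorm W x \<le> N x"
  using qnorm_le[OF W0, of x] by simp

lemma qnorm_approx: "qnorm W x < c \<Longrightarrow> \<exists>w\<in>W. N (x - w) < c"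
  unfolding qnorm_def using W0 by (subst (asm) cINF_less_iff[OF _ qnorm_bdd_below]) auto

lemma qnorm_nonneg: "0 \<le> qnorm W x"
  unfolding qnorm_def using W0 by (intro cINF_greatest) (auto simp: N_nonneg)

lemma qnorm_subspace: "w \<in> W \<Longrightarrow> qnorm W w = 0"
  using qnorm_le[of w w] qnorm_nonneg[of w] by (simp add: N_zero)

lemma qnorm_add: "qnorm W (x + y) \<le> qnorm W x + qnorm W y"
proof (rule field_le_epsilon)
  fix d :: real assume "0 < d"
  then obtain v w where v: "v \<in> W" "N (x - v) < qnorm W x + d / 2"
    and w: "w \<in> W" "N (y - w) < qnorm W y + d / 2"
    using qnorm_approx[of x "qnorm W x + d / 2"] qnorm_approx[of y "qnorm W y + d / 2"] by auto
  have "qnorm W (x + y) \<le> N ((x + y) - (v + w))" by (intro qnorm_le W_add v w)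
  also have "(x + y) - (v + w) = (x - v) + (y - w)" by simp
  also have "N \<dots> \<le> N (x - v) + N (y - w)" by (intro N_add) auto
  finally show "qnorm W (x + y) \<le> qnorm W x + qnorm W y + d" using v w by simp
qed

lemma qnorm_sc: "qnorm W (sc c x) = cmod c * qnorm W x"
proof -
  have le: "qnorm W (sc c x) \<le> cmod c * qnorm W x" for c x
  proof (rule field_le_epsilon)
    fix d :: real assume d: "0 < d"
    have pos: "0 < cmod c + 1" using norm_ge_zero[of c] by linarith
    then obtain v where v: "v \<in> W" "N (x - v) < qnorm W x + d / (cmod c + 1)"
      using qnorm_approx[of x "qnorm W x + d / (cmod c + 1)"] d by auto
    have "qnorm W (sc c x) \<le> N (sc c x - sc c v)" by (intro qnorm_le W_sc v)
    also have "\<dots> = cmod c * N (x - v)" by (simp add: N_sc flip: scale_right_diff_distrib)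
    also have "\<dots> \<le> cmod c * (qnorm W x + d / (cmod c + 1))" using v by (intro mult_left_mono) auto
    also have "\<dots> = cmod c * qnorm W x + cmod c / (cmod c + 1) * d" by (simp add: distrib_left)
    also have "cmod c / (cmod c + 1) * d \<le> 1 * d" using d pos by (intro mult_right_mono) auto
    finally show "qnorm W (sc c x) \<le> cmod c * qnorm W x + d" by simp
  qed
  show ?thesis
  proof (cases "c = 0")
    case True
    then show ?thesis using qnorm_subspace[OF W0] by simp
  next
    case False
    have "qnorm W x = qnorm W (sc (inverse c) (sc c x))" using False by simp
    also have "\<dots> \<le> cmod (inverse c) * qnorm W (sc c x)" by (rule le)
    finally have "cmod c * qnorm W x \<le> qnorm W (sc c x)"
      using False by (simp add: norm_inverse norm_divide field_simps)
    then show ?thesis using le[of c x] by simp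
  qed
qed

lemma real_cseminormed_qnorm: "real_cseminormed sc (qnorm W)"
  by unfold_locales (auto simp: qnorm_add qnorm_sc sc_of_real)

end

end

locale real_cseminormed_algebra = unital_cseminormed_algebra sc N mul e + real_cseminormed sc N
  for sc :: "complex \<Rightarrow> 'v::real_vector \<Rightarrow> 'v" and N mul e
begin

text \<open>A real functional f below \<open>shrink N e\<close> has f(- e) \<le> -1, so its
  complexification is a state; Hahn-Banach lets one of them attain the value at
  \<open>x0\<close>.\<close>

lemma state_attaining_shrink:
  assumes "N e = 1"
  obtains F where "F \<in> dual" "\<And>x. cmod (F x) \<le> N x" "F e = 1" "Re (F x0) = shrink N e x0"
proof -
  obtain f where f: "linear f" "\<And>x. f x \<le> shrink N e x" "f x0 = shrink N e x0"
    using Hahn_Banach_sublinear[OF sublinear_shrink[OF sublinear_N]] by blast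
  have fN: "f x \<le> N x" for x using f(2)[of x] shrink_le_self[OF sublinear_N, of e x] by simp
  obtain F where F: "F \<in> dual" "\<And>x. Re (F x) = f x" "\<And>x. cmod (F x) \<le> N x"
    using linear_functional_complexify[OF f(1) fN] by blast
  have "f (- e) \<le> -1"
    using f(2)[of "- e"] shrink_le[OF sublinear_N, of 1 e "- e"] assms by (simp add: N_zero)
  then have "1 \<le> f e" by (simp add: linear_neg[OF f(1)])
  moreover have "cmod (F e) \<le> 1" using F(3)[of e] assms by simp
  ultimately have "Re (F e) = 1" "cmod (F e) = 1"
    using F(2)[of e] complex_Re_le_cmod[of "F e"] by linarith+
  then have "F e = 1" using cmod_power2[of "F e"] by (simp add: complex_eq_iff)
  then show thesis using that F f(3) by metis
qed

text \<open>If every state vanished at b, \<open>shrink N e\<close> would vanish at all complex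
  multiples of b. The norm would then have derivative 0 at e in the four directions, and
  \<open>numerical_radius_zero\<close> would apply.\<close>

lemma states_separate:
  assumes b: "N b \<noteq> 0"
  obtains F where "F \<in> dual" "\<And>x. cmod (F x) \<le> N x" "F e = 1" "F b \<noteq> 0"
proof (rule ccontr)
  assume "\<not> thesis"
  then have zero: "F b = 0" if "F \<in> dual" "\<And>x. cmod (F x) \<le> N x" "F e = 1" for F
    using that \<open>\<And>F. F \<in> dual \<Longrightarrow> (\<And>x. cmod (F x) \<le> N x) \<Longrightarrow> F e = 1 \<Longrightarrow> F b \<noteq> 0 \<Longrightarrow> thesis\<close> by blast
  have "N b \<le> N b * N e" using N_mul[of b e] by (simp add: mul_e_right)
  then have "1 \<le> N e" using b N_nonneg[of b] by (simp add: less_le)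
  then have Ne: "N e = 1" using N_e by simp
  have "N b = 0"
  proof (rule numerical_radius_zero)
    fix z :: complex and d :: real
    assume d: "0 < d"
    obtain F where F: "F \<in> dual" "\<And>x. cmod (F x) \<le> N x" "F e = 1" "Re (F (sc z b)) = shrink N e (sc z b)"
      using state_attaining_shrink[OF Ne, of "sc z b"] by blast
    have "shrink N e (sc z b) = 0" using zero[OF F(1-3)] F(4) dual_sc[OF F(1)] by simp
    then obtain t where t: "0 \<le> t" "N (sc z b + t *\<^sub>R e) - t * N e < d"
      using shrink_approx[OF sublinear_N, of e "sc z b" d] d by auto
    show "\<exists>s0>0. \<forall>s. 0 < s \<and> s < s0 \<longrightarrow> N (e + sc (complex_of_real s * z) b) \<le> 1 + d * s"
    proof (intro exI[of _ "inverse (t + 1)"] conjI allI impI)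
      show "0 < inverse (t + 1)" using t by simp
      fix s assume s: "0 < s \<and> s < inverse (t + 1)"
      have st: "s * t \<le> 1" using s t by (simp add: field_simps)
      \<comment> \<open>Difference quotients grow with the step: the bound found at t passes to each
        smaller step s, and s < 1/(t + 1) keeps the coefficient 1 - s t nonnegative.\<close>
      have "e + sc (complex_of_real s * z) b
          = sc (complex_of_real s) (sc z b + t *\<^sub>R e) + sc (complex_of_real (1 - s * t)) e"
        by (simp add: scale_right_distrib scale_left_diff_distrib flip: sc_of_real)
      then have "N (e + sc (complex_of_real s * z) b)
          \<le> N (sc (complex_of_real s) (sc z b + t *\<^sub>R e)) + N (sc (complex_of_real (1 - s * t)) e)"
        by (simp add: N_add del: of_real_diff)
      also have "\<dots> = s * N (sc z b + t *\<^sub>R e) + (1 - s * t)"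
        using s st unfolding N_sc[OF UNIV_I] by (simp add: Ne del: of_real_diff)
      also have "\<dots> \<le> s * (t + d) + (1 - s * t)"
        using s t Ne by (intro add_right_mono mult_left_mono) auto
      also have "\<dots> = 1 + d * s" by (simp add: algebra_simps)
      finally show "N (e + sc (complex_of_real s * z) b) \<le> 1 + d * s" .
    qed
  qed simp
  then show False using b by simp
qed

lemma real_cseminormed_algebra_qnorm:
  assumes W: "0 \<in> W" "\<And>x y. x \<in> W \<Longrightarrow> y \<in> W \<Longrightarrow> x + y \<in> W" "\<And>c x. x \<in> W \<Longrightarrow> sc c x \<in> W"
    and ideal: "\<And>x y. x \<in> W \<Longrightarrow> mul x y \<in> W" "\<And>x y. x \<in> W \<Longrightarrow> mul y x \<in> W"
  shows "real_cseminormed_algebra sc (qnorm W) mul e"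
proof -
  interpret Q: real_cseminormed sc "qnorm W" by (rule real_cseminormed_qnorm[OF W])
  have mulq: "qnorm W (mul x y) \<le> N (x - v) * N (y - w)" if vw: "v \<in> W" "w \<in> W" for x y v w
  proof -
    have "mul x y = mul (x - v) (y - w) + (mul v y + mul (x - v) w)"
      by (simp add: mul_diff_left mul_diff_right)
    then have "qnorm W (mul x y) \<le> qnorm W (mul (x - v) (y - w)) + qnorm W (mul v y + mul (x - v) w)"
      using Q.N_add by simp
    also have "qnorm W (mul v y + mul (x - v) w) = 0"
      by (intro qnorm_subspace[OF W] W ideal vw)
    also have "qnorm W (mul (x - v) (y - w)) \<le> N (mul (x - v) (y - w))" by (rule qnorm_le_N[OF W])
    also have "\<dots> \<le> N (x - v) * N (y - w)" by (rule N_mul) auto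
    finally show ?thesis by simp
  qed
  have "qnorm W (mul x y) \<le> qnorm W x * qnorm W y" for x y
  proof -
    have step: "qnorm W (mul x y) \<le> N (x - v) * qnorm W y" if v: "v \<in> W" for v
    proof (rule field_le_epsilon)
      fix d :: real assume d: "0 < d"
      have pos: "0 < N (x - v) + 1" using N_nonneg[of "x - v"] by simp
      then obtain w where w: "w \<in> W" "N (y - w) < qnorm W y + d / (N (x - v) + 1)"
        using qnorm_approx[OF W, of y "qnorm W y + d / (N (x - v) + 1)"] d by auto
      have "qnorm W (mul x y) \<le> N (x - v) * N (y - w)" by (rule mulq[OF v w(1)])
      also have "\<dots> \<le> N (x - v) * (qnorm W y + d / (N (x - v) + 1))"
        using w by (intro mult_left_mono N_nonneg) auto
      also have "\<dots> = N (x - v) * qnorm W y + N (x - v) / (N (x - v) + 1) * d" by (simp add: distrib_left)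
      also have "N (x - v) / (N (x - v) + 1) * d \<le> 1 * d" using d pos by (intro mult_right_mono) auto
      finally show "qnorm W (mul x y) \<le> N (x - v) * qnorm W y + d" by simp
    qed
    show ?thesis
    proof (rule field_le_epsilon)
      fix d :: real assume d: "0 < d"
      have q: "0 \<le> qnorm W y" by (rule qnorm_nonneg[OF W])
      then have pos: "0 < qnorm W y + 1" by simp
      then obtain v where v: "v \<in> W" "N (x - v) < qnorm W x + d / (qnorm W y + 1)"
        using qnorm_approx[OF W, of x "qnorm W x + d / (qnorm W y + 1)"] d by auto
      have "qnorm W (mul x y) \<le> N (x - v) * qnorm W y" by (rule step[OF v(1)])
      also have "\<dots> \<le> (qnorm W x + d / (qnorm W y + 1)) * qnorm W y"
        using v q by (intro mult_right_mono) auto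
      also have "\<dots> = qnorm W x * qnorm W y + qnorm W y / (qnorm W y + 1) * d" by (simp add: distrib_right)
      also have "qnorm W y / (qnorm W y + 1) * d \<le> 1 * d" using d pos by (intro mult_right_mono) auto
      finally show "qnorm W (mul x y) \<le> qnorm W x * qnorm W y + d" by simp
    qed
  qed
  moreover have "qnorm W e \<le> 1" using qnorm_le_N[OF W, of e] N_e by simp
  ultimately show ?thesis
    by unfold_locales
      (auto simp: mul_add_left mul_add_right mul_sc_left mul_sc_right mul_assoc mul_e_left mul_e_right)
qed

end

section \<open>The multiplier unitization\<close>

lemma (in unital_cseminormed_algebra) arens_emb: "arens (emb x) (emb y) = emb (mul x y)"
proof
  fix f
  show "arens (emb x) (emb y) f = emb (mul x y) f"
  proof (cases "f \<in> dual")
    case True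
    have "emb x (rslice f y) = rslice f y x" by (rule emb_apply[OF rslice_mem[OF True]])
    moreover have "emb y (lact (emb x) f) = lact (emb x) f y"
      by (rule emb_apply[OF lact_mem[OF True emb_mem]])
    ultimately show ?thesis
      using True by (simp only: arens_eq emb_apply) (simp add: lact_def rslice_def)
  qed (simp add: emb_outside arens_outside)
qed

locale approx_unital_algebra =
  fixes cs :: "complex \<Rightarrow> 'a::{real_normed_algebra,banach} \<Rightarrow> 'a"
  assumes cba: "cbanach_alg cs" and au: "approx_unital TYPE('a)"
begin

lemma cs_of_real: "cs (complex_of_real r) x = r *\<^sub>R x"
  and cs_cs: "cs a (cs b x) = cs (a * b) x"
  and cs_one: "cs 1 x = x"
  and cs_add_right: "cs a (x + y) = cs a x + cs a y"
  and cs_add_left: "cs (a + b) x = cs a x + cs b x"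
  and norm_cs: "norm (cs a x) = cmod a * norm x"
  and cs_mult_left: "cs a x * y = cs a (x * y)"
  and cs_mult_right: "x * cs a y = cs a (x * y)"
  using cba unfolding cbanach_alg_def by metis+

sublocale A: real_cseminormed cs norm
  by unfold_locales
    (auto simp: cs_add_right cs_add_left cs_cs cs_one norm_triangle_ineq norm_cs cs_of_real)

sublocale AD: cseminormed fsm A.dual A.dnorm
  by (rule A.cseminormed_dual)

text \<open>A^1 acts on A from the left and \<open>norm1\<close> is the operator norm of this
  action; submultiplicativity follows even when the action is not faithful.\<close>

definition act :: "'a \<times> complex \<Rightarrow> 'a \<Rightarrow> 'a" where
  "act x c = fst x * c + cs (snd x) c"

lemma norm1_eq: "norm1 cs x = Sup {norm (act x c) | c. norm c \<le> 1}"
  by (simp add: norm1_def act_def)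

lemma norm_act_le: "norm (act x c) \<le> (norm (fst x) + cmod (snd x)) * norm c"
  unfolding act_def distrib_right
  by (rule norm_triangle_le, rule add_mono) (auto simp: norm_mult_ineq norm_cs)

lemma act_le_norm1: "norm c \<le> 1 \<Longrightarrow> norm (act x c) \<le> norm1 cs x"
  unfolding norm1_eq
proof (rule cSup_upper)
  show "bdd_above {norm (act x c) |c. norm c \<le> 1}"
  proof (rule bdd_aboveI)
    fix y assume "y \<in> {norm (act x c) |c. norm c \<le> 1}"
    then obtain c where c: "y = norm (act x c)" "norm c \<le> 1" by auto
    have "y \<le> (norm (fst x) + cmod (snd x)) * norm c" using c norm_act_le by simp
    also have "\<dots> \<le> (norm (fst x) + cmod (snd x)) * 1" using c by (intro mult_left_mono) auto
    finally show "y \<le> norm (fst x) + cmod (snd x)" by simp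
  qed
qed auto

lemma norm1_least: "(\<And>c. norm c \<le> 1 \<Longrightarrow> norm (act x c) \<le> K) \<Longrightarrow> norm1 cs x \<le> K"
  unfolding norm1_eq by (rule cSup_least) (auto intro: exI[of _ 0])

lemma act_add: "act (x + y) c = act x c + act y c"
  and act_sm1: "act (sm1 cs b x) c = cs b (act x c)"
  and act_mult1: "act (mult1 cs x y) c = act x (act y c)"
  and act_cs: "act x (cs b c) = cs b (act x c)"
  by (simp_all add: act_def sm1_def mult1_def algebra_simps cs_add_left cs_add_right cs_cs
      cs_mult_left cs_mult_right)

lemma norm1_nonneg: "0 \<le> norm1 cs x"
  using act_le_norm1[of 0 x] by (simp, metis norm_ge_zero order_trans)

lemma act_bound: "norm (act x c) \<le> norm1 cs x * norm c"
proof (cases "c = 0")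
  case True
  then show ?thesis by (simp add: act_def A.scale_zero_right)
next
  case False
  let ?r = "complex_of_real (inverse (norm c))"
  have "norm (act x (cs ?r c)) \<le> norm1 cs x"
    using False by (intro act_le_norm1) (simp add: norm_cs norm_inverse)
  then have "inverse (norm c) * norm (act x c) \<le> norm1 cs x"
    using False by (simp add: act_cs norm_cs norm_inverse)
  then show ?thesis using False by (simp add: field_simps)
qed

lemma norm1_mult: "norm1 cs (mult1 cs x y) \<le> norm1 cs x * norm1 cs y"
proof (rule norm1_least)
  fix c :: 'a assume c: "norm c \<le> 1"
  have "norm (act (mult1 cs x y) c) \<le> norm1 cs x * norm (act y c)"
    unfolding act_mult1 by (rule act_bound)
  also have "\<dots> \<le> norm1 cs x * norm1 cs y"
    by (intro mult_left_mono act_le_norm1 c norm1_nonneg)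
  finally show "norm (act (mult1 cs x y) c) \<le> norm1 cs x * norm1 cs y" .
qed

lemma norm1_sm1: "norm1 cs (sm1 cs c x) = cmod c * norm1 cs x"
proof -
  have le: "norm1 cs (sm1 cs c x) \<le> cmod c * norm1 cs x" for c x
    by (rule norm1_least) (simp add: act_sm1 norm_cs act_le_norm1 mult_left_mono)
  show ?thesis
  proof (cases "c = 0")
    case True
    then show ?thesis using le[of 0 x] norm1_nonneg[of "sm1 cs 0 x"] by simp
  next
    case False
    have "norm1 cs x = norm1 cs (sm1 cs (inverse c) (sm1 cs c x))"
      using False by (simp add: sm1_def cs_cs cs_one mult.assoc[symmetric])
    also have "\<dots> \<le> cmod (inverse c) * norm1 cs (sm1 cs c x)" by (rule le)
    finally have "cmod c * norm1 cs x \<le> norm1 cs (sm1 cs c x)"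
      using False by (simp add: norm_inverse norm_divide field_simps)
    then show ?thesis using le[of c x] by simp
  qed
qed

sublocale X: real_cseminormed_algebra "sm1 cs" "norm1 cs" "mult1 cs" "(0, 1)"
proof unfold_locales
  fix x y :: "'a \<times> complex"
  show "norm1 cs (x + y) \<le> norm1 cs x + norm1 cs y"
    by (rule norm1_least) (auto simp: act_add intro!: norm_triangle_le add_mono act_le_norm1)
  show "norm1 cs (mult1 cs x y) \<le> norm1 cs x * norm1 cs y" by (rule norm1_mult)
  show "norm1 cs (0, 1) \<le> 1"
    by (rule norm1_least) (simp add: act_def cs_one)
qed (auto simp: sm1_def mult1_def cs_add_right cs_add_left cs_cs cs_one norm1_sm1[unfolded sm1_def]
    algebra_simps cs_mult_left cs_mult_right cs_of_real
    A.scale_zero_right A.scale_zero_left scaleR_prod_def scaleR_conv_of_real)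

lemma dualA_eq: "dualA cs = A.dual"
  and dnormA_eq: "dnormA = A.dnorm"
  and bidualA_eq: "bidualA cs = AD.dual"
  and dual1_eq: "dual1 cs = X.dual"
  and dnorm1_eq: "dnorm1 cs = X.dnorm"
  and bidual1_eq: "bidual1 cs = X.bidual"
  and bnorm1_eq: "bnorm1 cs = X.bnorm"
  and prod1_eq: "prod1 cs = X.arens"
  and one1_eq: "one1 cs = X.emb (0, 1)"
proof -
  have add1: "add1 = ((+) :: 'a \<times> complex \<Rightarrow> _)"
    by (simp add: fun_eq_iff add1_def prod_eq_iff)
  show a: "dualA cs = A.dual" by (simp add: dualA_def)
  show b: "dnormA = A.dnorm" by (simp add: dnormA_def fun_eq_iff)
  show "bidualA cs = AD.dual" by (simp add: bidualA_def a b fadd_eq_plus)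
  show c: "dual1 cs = X.dual" by (simp add: dual1_def add1)
  show d: "dnorm1 cs = X.dnorm" by (simp add: dnorm1_def fun_eq_iff)
  show "bidual1 cs = X.bidual" by (simp add: bidual1_def c d fadd_eq_plus)
  show "bnorm1 cs = X.bnorm" by (simp add: bnorm1_def fun_eq_iff c d)
  show "prod1 cs = X.arens" by (simp add: prod1_def c)
  show "one1 cs = X.emb (0, 1)" by (simp add: one1_def c)
qed

lemma Mproj_iff: "Mproj cs J P \<longleftrightarrow> X.B.M_projection P \<and> P ` X.bidual = perpperp1 cs J"
proof -
  have "fadd \<eta> (fsm (-1) \<xi>) = \<eta> - \<xi>" for \<eta> \<xi> :: "('a \<times> complex \<Rightarrow> complex) \<Rightarrow> complex"
    by (simp add: fun_eq_iff fadd_def fsm_def)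
  then show ?thesis
    unfolding Mproj_def X.B.M_projection_def bidual1_eq bnorm1_eq by (auto simp: fadd_eq_plus)
qed

lemma norm1_fst_le: "norm1 cs (a, 0) \<le> norm a"
proof (rule norm1_least)
  fix c :: 'a assume c: "norm c \<le> 1"
  have "norm (act (a, 0) c) \<le> norm a * norm c" by (simp add: act_def A.scale_zero_left norm_mult_ineq)
  also have "\<dots> \<le> norm a * 1" using c by (intro mult_left_mono) auto
  finally show "norm (act (a, 0) c) \<le> norm a" by simp
qed

text \<open>Along the approximate identity a e tends to a while |e| \<le> 1; with
  \<open>norm1_fst_le\<close> this makes A isometric in A^1.\<close>

lemma norm_le_norm1: "norm a \<le> norm1 cs (a, 0)"
proof -
  obtain F :: "'a filter" where F: "F \<noteq> bot" "eventually (\<lambda>e. norm e \<le> 1) F"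
    "\<And>a. ((\<lambda>e. a * e) \<longlongrightarrow> a) F"
    using au unfolding approx_unital_def by blast
  show ?thesis
  proof (rule tendsto_upperbound[OF tendsto_norm[OF F(3)] _ F(1)])
    show "\<forall>\<^sub>F e in F. norm (a * e) \<le> norm1 cs (a, 0)"
      using F(2)
    proof eventually_elim
      case (elim e)
      then show ?case using act_le_norm1[of e "(a, 0)"] by (simp add: act_def A.scale_zero_left)
    qed
  qed
qed

section \<open>Restriction to A, extension to A^1, and the bidual of A inside that of A^1\<close>

definition rest :: "('a \<times> complex \<Rightarrow> complex) \<Rightarrow> 'a \<Rightarrow> complex" where
  "rest \<psi> = (\<lambda>a. \<psi> (a, 0))"

lemma rest_mem: "\<psi> \<in> X.dual \<Longrightarrow> rest \<psi> \<in> A.dual"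
  and dnorm_rest: "\<psi> \<in> X.dual \<Longrightarrow> A.dnorm (rest \<psi>) \<le> X.dnorm \<psi>"
proof -
  assume \<psi>: "\<psi> \<in> X.dual"
  have *: "cmod (rest \<psi> a) \<le> X.dnorm \<psi> * norm a" for a
    using X.dual_bound[OF \<psi>, of "(a, 0)"] mult_left_mono[OF norm1_fst_le[of a] X.dnorm_nonneg[OF \<psi>]]
    by (simp add: rest_def)
  show "rest \<psi> \<in> A.dual"
  proof (rule A.dualI[OF _ _ *])
    show "rest \<psi> (x + y) = rest \<psi> x + rest \<psi> y" for x y
      using X.dual_add[OF \<psi>, of "(x, 0)" "(y, 0)"] by (simp add: rest_def)
    show "rest \<psi> (cs c x) = c * rest \<psi> x" for c x
      using X.dual_sc[OF \<psi>, of "(x, 0)" c] by (simp add: rest_def sm1_def)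
  qed auto
  show "A.dnorm (rest \<psi>) \<le> X.dnorm \<psi>"
    by (rule A.dnorm_least) (use * X.dnorm_nonneg[OF \<psi>] in auto)
qed

lemma dual1_split:
  assumes "\<psi> \<in> X.dual"
  shows "\<psi> (a, c) = \<psi> (a, 0) + c * \<psi> (0, 1)"
  using X.dual_add[OF assms, of "(a, 0)" "(0, c)"] X.dual_sc[OF assms, of "(0, 1)" c]
  by (simp add: sm1_def A.scale_zero_right)

text \<open>The value of the extension at the unit is a cluster point of the functional along the
  approximate identity.\<close>

lemma extension_exists:
  assumes \<phi>: "\<phi> \<in> A.dual"
  obtains \<psi> where "\<psi> \<in> X.dual" "rest \<psi> = \<phi>" "X.dnorm \<psi> \<le> A.dnorm \<phi>"
proof -
  let ?K = "A.dnorm \<phi>"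
  have K: "0 \<le> ?K" by (rule A.dnorm_nonneg[OF \<phi>])
  obtain F :: "'a filter" where F: "F \<noteq> bot" "eventually (\<lambda>e. norm e \<le> 1) F"
    "\<And>a. ((\<lambda>e. a * e) \<longlongrightarrow> a) F"
    using au unfolding approx_unital_def by blast
  have "eventually (\<lambda>y. y \<in> cball 0 ?K) (filtermap \<phi> F)"
    unfolding eventually_filtermap using F(2)
  proof eventually_elim
    case (elim e)
    then show ?case using A.dnorm_upper[OF \<phi>, of e] by simp
  qed
  then obtain c where c: "inf (nhds c) (filtermap \<phi> F) \<noteq> bot"
    using compact_cball[of "0::complex" ?K] F(1) unfolding compact_filter
    by (metis filtermap_bot_iff)
  \<comment> \<open>The functional need not converge along the filter. A cluster point still lets
    any eventual property hold at some e with \<phi> e as close to c as desired.\<close>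
  have pick: "\<exists>e. Q e \<and> dist (\<phi> e) c < d" if "eventually Q F" "0 < d" for Q d
  proof (rule ccontr)
    assume "\<nexists>e. Q e \<and> dist (\<phi> e) c < d"
    then have "eventually (\<lambda>y. \<not> dist y c < d) (filtermap \<phi> F)"
      unfolding eventually_filtermap using that(1) by (auto elim!: eventually_mono)
    moreover have "eventually (\<lambda>y. dist y c < d) (nhds c)"
      using that(2) eventually_nhds_metric by blast
    ultimately have "eventually (\<lambda>_. False) (inf (nhds c) (filtermap \<phi> F))"
      unfolding eventually_inf by blast
    then show False using c by (simp add: trivial_limit_def)
  qed
  define \<psi> where "\<psi> x = \<phi> (fst x) + snd x * c" for x
  have bound: "cmod (\<psi> x) \<le> ?K * norm1 cs x" for x
  proof (rule field_le_epsilon)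
    fix d :: real assume d: "0 < d"
    define r where "r = d / (?K + cmod (snd x) + 1)"
    have den: "0 < ?K + cmod (snd x) + 1" using K norm_ge_zero[of "snd x"] by linarith
    have r: "0 < r" using d den by (simp add: r_def)
    have "eventually (\<lambda>e. norm e \<le> 1 \<and> dist (fst x * e) (fst x) < r) F"
      using F(2) tendstoD[OF F(3)[of "fst x"] r] by (rule eventually_conj)
    then obtain e where e: "norm e \<le> 1" "dist (fst x * e) (fst x) < r" "dist (\<phi> e) c < r"
      using pick[OF _ r] by blast
    \<comment> \<open>The first term is bounded through \<open>norm1\<close> because |e| \<le> 1;
      the other two are the errors made small by the choice of e.\<close>
    have "\<psi> x = \<phi> (act x e) + \<phi> (fst x - fst x * e) + snd x * (c - \<phi> e)"
      by (simp add: \<psi>_def act_def A.dual_add[OF \<phi>] A.dual_diff[OF \<phi>] A.dual_sc[OF \<phi>] algebra_simps)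
    then have "cmod (\<psi> x) \<le> cmod (\<phi> (act x e)) + cmod (\<phi> (fst x - fst x * e)) + cmod (snd x * (c - \<phi> e))"
      by (metis norm_triangle_ineq norm_triangle_le add_right_mono)
    also have "cmod (\<phi> (act x e)) \<le> ?K * norm1 cs x"
      using A.dual_bound[OF \<phi>, of "act x e"] mult_left_mono[OF act_le_norm1[OF e(1), of x] K] by simp
    also have "cmod (\<phi> (fst x - fst x * e)) \<le> ?K * r"
      using A.dual_bound[OF \<phi>, of "fst x - fst x * e"] e(2) K
      by (simp add: dist_norm norm_minus_commute) (meson less_imp_le mult_left_mono order_trans)
    also have "cmod (snd x * (c - \<phi> e)) \<le> cmod (snd x) * r"
      using e(3) unfolding norm_mult by (intro mult_left_mono) (auto simp: dist_norm norm_minus_commute)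
    also have "?K * norm1 cs x + ?K * r + cmod (snd x) * r = ?K * norm1 cs x + (?K + cmod (snd x)) * r"
      by (simp add: algebra_simps)
    also have "(?K + cmod (snd x)) * r \<le> (?K + cmod (snd x) + 1) * r"
      using r by (intro mult_right_mono) auto
    also have "\<dots> = d" using den by (simp add: r_def)
    finally show "cmod (\<psi> x) \<le> ?K * norm1 cs x + d" by simp
  qed
  have "\<psi> \<in> X.dual"
    by (rule X.dualI[OF _ _ bound])
      (auto simp: \<psi>_def sm1_def A.dual_add[OF \<phi>] A.dual_sc[OF \<phi>] algebra_simps)
  moreover have "rest \<psi> = \<phi>" by (simp add: rest_def \<psi>_def fun_eq_iff)
  moreover have "X.dnorm \<psi> \<le> ?K" by (rule X.dnorm_least) (use bound K in auto)
  ultimately show thesis by (rule that)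
qed

lemma iota1_apply: "\<psi> \<in> X.dual \<Longrightarrow> iota1 cs \<eta> \<psi> = \<eta> (rest \<psi>)"
  by (simp add: iota1_def dual1_eq rest_def)

lemma iota1_outside: "\<psi> \<notin> X.dual \<Longrightarrow> iota1 cs \<eta> \<psi> = 0"
  by (simp add: iota1_def dual1_eq)

lemma rest_add: "rest (f + g) = rest f + rest g" and rest_fsm: "rest (fsm c f) = fsm c (rest f)"
  by (auto simp: rest_def fsm_def)

lemma iota1_mem: "\<eta> \<in> AD.dual \<Longrightarrow> iota1 cs \<eta> \<in> X.bidual"
proof (rule X.D.dualI[where K="AD.dnorm \<eta>"])
  assume \<eta>: "\<eta> \<in> AD.dual"
  fix f assume f: "f \<in> X.dual"
  show "cmod (iota1 cs \<eta> f) \<le> AD.dnorm \<eta> * X.dnorm f"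
    using AD.dual_bound[OF \<eta> rest_mem[OF f]] mult_left_mono[OF dnorm_rest[OF f] AD.dnorm_nonneg[OF \<eta>]] f
    by (simp add: iota1_apply)
qed (auto simp: iota1_apply iota1_outside X.D.add_mem X.D.sc_mem rest_add rest_fsm AD.dual_add
    AD.dual_sc rest_mem)

lemma iota1_inj:
  assumes "iota1 cs \<eta> = iota1 cs \<xi>" "\<And>\<phi>. \<phi> \<notin> A.dual \<Longrightarrow> \<eta> \<phi> = 0" "\<And>\<phi>. \<phi> \<notin> A.dual \<Longrightarrow> \<xi> \<phi> = 0"
  shows "\<eta> = \<xi>"
proof
  fix \<phi>
  show "\<eta> \<phi> = \<xi> \<phi>"
  proof (cases "\<phi> \<in> A.dual")
    case True
    obtain \<psi> where \<psi>: "\<psi> \<in> X.dual" "rest \<psi> = \<phi>" by (rule extension_exists[OF True])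
    then show ?thesis using iota1_apply[of \<psi> \<eta>] iota1_apply[of \<psi> \<xi>] assms(1) by simp
  qed (simp add: assms)
qed

text \<open>The preimage evaluates \<xi> at a chosen extension. The extensions need not depend
  linearly on the functional; the kernel condition removes the dependence on the choice and thus
  gives linearity, and their norm bound gives boundedness.\<close>

lemma iota1_surj:
  assumes \<xi>: "\<xi> \<in> X.bidual" and k: "\<And>\<psi>. \<psi> \<in> X.dual \<Longrightarrow> rest \<psi> = 0 \<Longrightarrow> \<xi> \<psi> = 0"
  obtains \<eta> where "\<eta> \<in> AD.dual" "iota1 cs \<eta> = \<xi>"
proof -
  have "\<forall>\<phi>. \<exists>\<psi>. \<phi> \<in> A.dual \<longrightarrow> \<psi> \<in> X.dual \<and> rest \<psi> = \<phi> \<and> X.dnorm \<psi> \<le> A.dnorm \<phi>"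
    using extension_exists by metis
  then obtain E where E: "\<And>\<phi>. \<phi> \<in> A.dual \<Longrightarrow> E \<phi> \<in> X.dual"
    "\<And>\<phi>. \<phi> \<in> A.dual \<Longrightarrow> rest (E \<phi>) = \<phi>" "\<And>\<phi>. \<phi> \<in> A.dual \<Longrightarrow> X.dnorm (E \<phi>) \<le> A.dnorm \<phi>"
    by metis
  have eq: "\<xi> \<psi> = \<xi> \<psi>'" if "\<psi> \<in> X.dual" "\<psi>' \<in> X.dual" "rest \<psi> = rest \<psi>'" for \<psi> \<psi>'
  proof -
    have "rest (\<psi> - \<psi>') = 0" using that(3) by (simp add: rest_def fun_eq_iff)
    then have "\<xi> (\<psi> - \<psi>') = 0" using that by (intro k X.D.diff_mem)
    then show ?thesis using X.D.dual_diff[OF \<xi>] that by simp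
  qed
  define \<eta> where "\<eta> \<phi> = (if \<phi> \<in> A.dual then \<xi> (E \<phi>) else 0)" for \<phi>
  have "\<eta> \<in> AD.dual"
  proof (rule AD.dualI[where K="X.bnorm \<xi>"])
    fix f g c assume f: "f \<in> A.dual"
    show "cmod (\<eta> f) \<le> X.bnorm \<xi> * A.dnorm f"
      using X.D.dual_bound[OF \<xi> E(1)[OF f]] mult_left_mono[OF E(3)[OF f] X.D.dnorm_nonneg[OF \<xi>]] f
      by (simp add: \<eta>_def)
    have "\<xi> (E (fsm c f)) = \<xi> (fsm c (E f))"
      by (rule eq) (use f in \<open>auto simp: E X.D.sc_mem AD.sc_mem rest_fsm\<close>)
    then show "\<eta> (fsm c f) = c * \<eta> f" using f \<xi> by (simp add: \<eta>_def AD.sc_mem X.D.dual_sc E)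
    assume g: "g \<in> A.dual"
    have "\<xi> (E (f + g)) = \<xi> (E f + E g)"
      by (rule eq) (use f g in \<open>auto simp: E X.D.add_mem AD.add_mem rest_add\<close>)
    then show "\<eta> (f + g) = \<eta> f + \<eta> g" using f g \<xi> by (simp add: \<eta>_def AD.add_mem X.D.dual_add E)
  qed (simp add: \<eta>_def)
  moreover have "iota1 cs \<eta> \<psi> = \<xi> \<psi>" for \<psi>
  proof (cases "\<psi> \<in> X.dual")
    case True
    then show ?thesis using eq[of "E (rest \<psi>)" \<psi>] by (simp add: iota1_apply \<eta>_def rest_mem E)
  qed (simp add: iota1_outside X.D.dual_outside[OF \<xi>])
  ultimately show thesis by (intro that[of \<eta>]) auto
qed

lemma prodA_outside: "\<phi> \<notin> A.dual \<Longrightarrow> prodA cs \<eta> \<xi> \<phi> = 0"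
  by (simp add: prodA_def arens2_def dualA_eq)

lemma prodA_apply: "\<phi> \<in> A.dual \<Longrightarrow> prodA cs \<eta> \<xi> \<phi> = \<xi> (\<lambda>a. \<eta> (\<lambda>b. \<phi> (b * a)))"
  by (simp add: prodA_def arens2_def dualA_eq)

text \<open>The embedding is multiplicative because restricting \<psi> \<cdot> \<iota>(\<eta>) to A
  gives (\<open>rest\<close> \<psi>) \<cdot> \<eta>.\<close>

lemma iota1_prodA:
  assumes "\<eta> \<in> AD.dual"
  shows "iota1 cs (prodA cs \<eta> \<xi>) = X.arens (iota1 cs \<eta>) (iota1 cs \<xi>)"
proof
  fix \<psi>
  show "iota1 cs (prodA cs \<eta> \<xi>) \<psi> = X.arens (iota1 cs \<eta>) (iota1 cs \<xi>) \<psi>"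
  proof (cases "\<psi> \<in> X.dual")
    case True
    have "rest (X.lact (iota1 cs \<eta>) \<psi>) = (\<lambda>a. \<eta> (\<lambda>b. rest \<psi> (b * a)))"
    proof
      fix a
      have "rest (X.lact (iota1 cs \<eta>) \<psi>) a = iota1 cs \<eta> (X.rslice \<psi> (a, 0))"
        by (simp add: rest_def X.lact_def)
      also have "\<dots> = \<eta> (rest (X.rslice \<psi> (a, 0)))" by (simp add: iota1_apply X.rslice_mem True)
      also have "rest (X.rslice \<psi> (a, 0)) = (\<lambda>b. rest \<psi> (b * a))"
        by (simp add: rest_def X.rslice_def mult1_def A.scale_zero_left)
      finally show "rest (X.lact (iota1 cs \<eta>) \<psi>) a = \<eta> (\<lambda>b. rest \<psi> (b * a))" .
    qed
    then show ?thesis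
      using True iota1_mem[OF assms]
      by (simp add: iota1_apply X.arens_eq X.lact_mem prodA_apply rest_mem)
  qed (simp add: iota1_outside X.arens_outside)
qed

lemma embA_mem: "embA cs a \<in> AD.dual"
proof (rule AD.dualI[where K="norm a"])
  show "cmod (embA cs a f) \<le> norm a * A.dnorm f" if "f \<in> A.dual" for f
    using A.dual_bound[OF that, of a] that by (simp add: embA_def cemb_def dualA_eq mult.commute)
qed (use AD.add_mem AD.sc_mem in \<open>auto simp: embA_def cemb_def dualA_eq fsm_apply\<close>)

lemma iota1_embA: "iota1 cs (embA cs a) = X.emb (a, 0)"
proof
  fix \<psi>
  show "iota1 cs (embA cs a) \<psi> = X.emb (a, 0) \<psi>"
    by (cases "\<psi> \<in> X.dual")
      (auto simp: iota1_apply iota1_outside X.emb_apply X.emb_outside embA_def cemb_def dualA_eq rest_mem,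
       simp add: rest_def)
qed

text \<open>The functional \<open>(a, \<lambda>) \<mapsto> \<lambda>\<close> spans the annihilator of \<open>A\<close>; it fails to be bounded exactly
  when \<open>A\<close> is unital, and then \<open>\<eta>\<close> takes the junk value 0 on it.\<close>

lemma bidual1_decompose:
  assumes \<eta>: "\<eta> \<in> X.bidual"
  obtains \<xi> c where "\<xi> \<in> AD.dual" "\<eta> = iota1 cs \<xi> + fsm c (X.emb (0, 1))"
proof -
  define ch :: "'a \<times> complex \<Rightarrow> complex" where "ch = snd"
  define \<eta>' where "\<eta>' = \<eta> - fsm (\<eta> ch) (X.emb (0, 1))"
  have m: "\<eta>' \<in> X.bidual" unfolding \<eta>'_def by (intro X.B.diff_mem \<eta> X.B.sc_mem X.emb_mem)
  have "\<eta>' \<psi> = 0" if \<psi>: "\<psi> \<in> X.dual" and r: "rest \<psi> = 0" for \<psi>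
  proof -
    have "\<psi> (a, c) = c * \<psi> (0, 1)" for a c
      using dual1_split[OF \<psi>, of a c] r by (simp add: rest_def fun_eq_iff)
    then have \<psi>_eq: "\<psi> x = ch x * \<psi> (0, 1)" for x by (metis ch_def prod.collapse)
    then have eq: "fsm (\<psi> (0, 1)) ch = \<psi>" by (intro ext) (metis fsm_apply mult.commute)
    have "\<eta> \<psi> = \<psi> (0, 1) * \<eta> ch"
    proof (cases "\<psi> (0, 1) = 0")
      case True
      then have "\<psi> = 0" using \<psi>_eq by (intro ext) (metis mult_zero_right zero_fun_apply)
      then show ?thesis using True X.D.dual_zero[OF \<eta>] by simp
    next
      case False
      have "fsm (inverse (\<psi> (0, 1))) \<psi> = ch"
      proof
        fix x
        show "fsm (inverse (\<psi> (0, 1))) \<psi> x = ch x" using False \<psi>_eq[of x] by (simp add: fsm_apply)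
      qed
      then have "ch \<in> X.dual" using X.D.sc_mem[OF \<psi>] by metis
      then show ?thesis using X.D.dual_sc[OF \<eta>, of ch "\<psi> (0, 1)"] eq by simp
    qed
    then show ?thesis using \<psi> by (simp add: \<eta>'_def fsm_apply X.emb_apply)
  qed
  then obtain \<xi> where "\<xi> \<in> AD.dual" "iota1 cs \<xi> = \<eta>'" using iota1_surj[OF m] by blast
  then show thesis by (intro that[of \<xi> "\<eta> ch"]) (auto simp: \<eta>'_def)
qed

section \<open>Supports of M-ideal ideals\<close>

lemma perp1_iff: "\<psi> \<in> perp1 cs J \<longleftrightarrow> \<psi> \<in> X.dual \<and> (\<forall>a\<in>J. rest \<psi> a = 0)"
  by (simp add: perp1_def dual1_eq rest_def)

lemma perpperp1_iff: "\<eta> \<in> perpperp1 cs J \<longleftrightarrow> \<eta> \<in> X.bidual \<and> (\<forall>\<psi>\<in>perp1 cs J. \<eta> \<psi> = 0)"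
  by (simp add: perpperp1_def bidual1_eq)

text \<open>\<open>supp_proj\<close> is a choice and does not mention centrality. Uniqueness of the
  M-projection with a given range carries the properties of the projection supplied by
  \<open>Mideal_ideal\<close> over to the chosen element.\<close>

lemma Mideal_ideal_support:
  assumes J: "Mideal_ideal cs J"
  defines "z \<equiv> iota1 cs (supp_proj cs J)"
  shows "supp_proj cs J \<in> AD.dual" "X.B.M_central z"
    "\<And>\<eta>. \<eta> \<in> perpperp1 cs J \<longleftrightarrow> \<eta> \<in> X.bidual \<and> X.arens z \<eta> = \<eta>"
proof -
  obtain P where P: "X.B.M_projection P" "P ` X.bidual = perpperp1 cs J"
    and comm: "\<And>\<eta>. \<eta> \<in> AD.dual \<Longrightarrow>
      X.arens (P (X.emb (0, 1))) (iota1 cs \<eta>) = X.arens (iota1 cs \<eta>) (P (X.emb (0, 1)))"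
    using J unfolding Mideal_ideal_def Mproj_iff bidualA_eq prod1_eq one1_eq by blast
  define w where "w = P (X.emb (0, 1))"
  have wB: "w \<in> X.bidual" by (simp add: w_def X.B.MP_mem[OF P(1)] X.emb_mem)
  have wJ: "w \<in> perpperp1 cs J" using P(2) X.emb_mem[of "(0,1)"] by (auto simp: w_def)
  have "w \<psi> = 0" if "\<psi> \<in> X.dual" "rest \<psi> = 0" for \<psi>
    using wJ that by (simp add: perpperp1_iff perp1_iff)
  then obtain p where p: "p \<in> AD.dual" "iota1 cs p = w" using iota1_surj[OF wB] by blast
  have "supp_proj cs J \<in> bidualA cs \<and> (\<exists>P. Mproj cs J P \<and> iota1 cs (supp_proj cs J) = P (one1 cs))"
    unfolding supp_proj_def
    by (rule someI[of _ p]) (use p P in \<open>auto simp: Mproj_iff bidualA_eq one1_eq w_def\<close>)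
  then obtain P' where P': "supp_proj cs J \<in> AD.dual" "X.B.M_projection P'" "P' ` X.bidual = perpperp1 cs J"
    "z = P' (X.emb (0, 1))"
    unfolding Mproj_iff bidualA_eq one1_eq z_def by blast
  then have zw: "z = w"
    using X.B.M_projection_unique[OF P'(2) P(1), of "X.emb (0,1)"] P(2) by (simp add: w_def X.emb_mem)
  show "supp_proj cs J \<in> AD.dual" by (rule P'(1))
  \<comment> \<open>Commutation is given against A** only, but the bidual of A^1 consists of A** and
    multiples of the unit.\<close>
  have central: "X.arens w \<eta> = X.arens \<eta> w" if \<eta>: "\<eta> \<in> X.bidual" for \<eta>
  proof -
    obtain \<xi> c where \<xi>: "\<xi> \<in> AD.dual" "\<eta> = iota1 cs \<xi> + fsm c (X.emb (0, 1))"
      by (rule bidual1_decompose[OF \<eta>])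
    show ?thesis
      using comm[OF \<xi>(1)] wB iota1_mem[OF \<xi>(1)]
      by (simp add: \<xi>(2) X.B.mul_add_left X.B.mul_add_right X.B.mul_sc_left X.B.mul_sc_right X.emb_mem
          X.B.sc_mem X.B.mul_e_left X.B.mul_e_right w_def[symmetric])
  qed
  have ww: "X.arens w w = w" and Pw: "\<And>x. x \<in> X.bidual \<Longrightarrow> P x = X.arens w x"
    using X.B.M_projection_central[OF P(1) w_def central] by auto
  show "X.B.M_central z"
    unfolding X.B.M_central_def zw
  proof (intro conjI ballI wB central ww)
    show "X.bnorm x = max (X.bnorm (X.arens w x)) (X.bnorm (x - X.arens w x))" if "x \<in> X.bidual" for x
      using X.B.MP_norm[OF P(1) that] Pw[OF that] by simp
  qed
  show "\<eta> \<in> perpperp1 cs J \<longleftrightarrow> \<eta> \<in> X.bidual \<and> X.arens z \<eta> = \<eta>" for \<eta>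
  proof
    assume "\<eta> \<in> perpperp1 cs J"
    then obtain \<xi> where "\<xi> \<in> X.bidual" "\<eta> = P \<xi>" using P(2) by auto
    then show "\<eta> \<in> X.bidual \<and> X.arens z \<eta> = \<eta>"
      using X.B.MP_mem[OF P(1)] X.B.MP_idem[OF P(1)] Pw[of "P \<xi>"] zw by simp
  next
    assume "\<eta> \<in> X.bidual \<and> X.arens z \<eta> = \<eta>"
    then show "\<eta> \<in> perpperp1 cs J" using P(2) Pw zw by (metis image_eqI)
  qed
qed

lemma csubspaceD:
  assumes "csubspace cs J"
  shows "0 \<in> J" "\<And>x y. x \<in> J \<Longrightarrow> y \<in> J \<Longrightarrow> x + y \<in> J" "\<And>c x. x \<in> J \<Longrightarrow> cs c x \<in> J"
  using assms unfolding csubspace_def by auto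

lemma closed_subspace_separation:
  assumes J: "csubspace cs J" "closed J" and a: "a \<notin> J"
  obtains \<phi> where "\<phi> \<in> A.dual" "\<And>x. x \<in> J \<Longrightarrow> \<phi> x = 0" "\<phi> a \<noteq> 0"
proof -
  note W = csubspaceD[OF J(1)]
  interpret Q: real_cseminormed cs "A.qnorm J" by (rule A.real_cseminormed_qnorm[OF W])
  have "A.qnorm J a \<noteq> 0"
  proof
    assume q: "A.qnorm J a = 0"
    have "a \<in> closure J"
      unfolding closure_approachable
    proof (intro allI impI)
      fix d :: real assume "0 < d"
      then obtain w where "w \<in> J" "norm (a - w) < d" using A.qnorm_approx[OF W, of a d] q by auto
      then show "\<exists>y\<in>J. dist y a < d" by (auto simp: dist_norm norm_minus_commute)
    qed
    then show False using J(2) a by simp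
  qed
  obtain F where F: "F \<in> Q.dual" "\<And>x. cmod (F x) \<le> A.qnorm J x" "Re (F a) = A.qnorm J a"
    using Q.norming_functional[of a] by blast
  have "F \<in> A.dual"
  proof (rule A.dualI[where K=1])
    show "cmod (F x) \<le> 1 * norm x" for x using F(2)[of x] A.qnorm_le_N[OF W, of x] by simp
  qed (use Q.dual_add[OF F(1)] Q.dual_sc[OF F(1)] in auto)
  moreover have "F x = 0" if "x \<in> J" for x using F(2)[of x] A.qnorm_subspace[OF W that] by simp
  moreover have "F a \<noteq> 0" using F(3) \<open>A.qnorm J a \<noteq> 0\<close> by auto
  ultimately show thesis by (rule that)
qed

lemma mem_iff_emb_perpperp1:
  assumes "csubspace cs J" "closed J"
  shows "a \<in> J \<longleftrightarrow> X.emb (a, 0) \<in> perpperp1 cs J"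
proof
  assume "a \<in> J"
  then show "X.emb (a, 0) \<in> perpperp1 cs J"
    by (auto simp: perpperp1_iff perp1_iff X.emb_mem X.emb_apply rest_def)
next
  assume h: "X.emb (a, 0) \<in> perpperp1 cs J"
  show "a \<in> J"
  proof (rule ccontr)
    assume "a \<notin> J"
    then obtain \<phi> where \<phi>: "\<phi> \<in> A.dual" "\<And>x. x \<in> J \<Longrightarrow> \<phi> x = 0" "\<phi> a \<noteq> 0"
      using closed_subspace_separation[OF assms] by blast
    obtain \<psi> where \<psi>: "\<psi> \<in> X.dual" "rest \<psi> = \<phi>" by (rule extension_exists[OF \<phi>(1)])
    then have "\<psi> \<in> perp1 cs J" using \<phi> by (simp add: perp1_iff)
    then have "X.emb (a, 0) \<psi> = 0" using h by (simp add: perpperp1_iff)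
    then show False using \<psi> \<phi>(3) by (auto simp: X.emb_apply rest_def)
  qed
qed

end

section \<open>Faces of the quasi-state space\<close>

context approx_unital_algebra begin

abbreviation sz :: "'a set \<Rightarrow> ('a \<times> complex \<Rightarrow> complex) \<Rightarrow> complex" where
  "sz J \<equiv> iota1 cs (supp_proj cs J)"

lemma sz_M_central: "Mideal_ideal cs J \<Longrightarrow> X.B.M_central (sz J)"
  by (rule Mideal_ideal_support)

lemma
  assumes "Mideal_ideal cs J"
  shows sz_mem: "sz J \<in> X.bidual"
    and sz_idem: "X.arens (sz J) (sz J) = sz J"
    and sz_comm: "\<eta> \<in> X.bidual \<Longrightarrow> X.arens (sz J) \<eta> = X.arens \<eta> (sz J)"
    and sz_norm: "\<eta> \<in> X.bidual \<Longrightarrow>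
      X.bnorm \<eta> = max (X.bnorm (X.arens (sz J) \<eta>)) (X.bnorm (\<eta> - X.arens (sz J) \<eta>))"
  using sz_M_central[OF assms] unfolding X.B.M_central_def by blast+

lemma sz_perpperp: "Mideal_ideal cs J \<Longrightarrow> \<eta> \<in> X.bidual \<Longrightarrow> X.arens (sz J) \<eta> \<in> perpperp1 cs J"
  using Mideal_ideal_support(3)[of J "X.arens (sz J) \<eta>"]
  by (simp add: X.arens_mem sz_mem sz_idem flip: X.B.mul_assoc)

lemma Mideal_idealD: "Mideal_ideal cs J \<Longrightarrow> csubspace cs J" "Mideal_ideal cs J \<Longrightarrow> closed J"
  by (auto simp: Mideal_ideal_def)

lemma Mideal_mem_iff:
  assumes "Mideal_ideal cs J"
  shows "a \<in> J \<longleftrightarrow> X.arens (sz J) (X.emb (a, 0)) = X.emb (a, 0)"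
  using mem_iff_emb_perpperp1[OF Mideal_idealD[OF assms], of a]
    Mideal_ideal_support(3)[OF assms, of "X.emb (a, 0)"] X.emb_mem[of "(a, 0)"] by simp

lemma Mideal_two_sided:
  assumes J: "Mideal_ideal cs J" and a: "a \<in> J"
  shows "x * a \<in> J" "a * x \<in> J"
proof -
  let ?a = "X.emb (a, 0)" and ?x = "X.emb (x, 0)" and ?z = "sz J"
  have z: "X.arens ?z ?a = ?a" using Mideal_mem_iff[OF J] a by simp
  have m: "?a \<in> X.bidual" "?x \<in> X.bidual" "?z \<in> X.bidual" by (auto simp: X.emb_mem sz_mem[OF J])
  have xa: "X.emb (x * a, 0) = X.arens ?x ?a" and ax: "X.emb (a * x, 0) = X.arens ?a ?x"
    by (simp_all add: X.arens_emb mult1_def A.scale_zero_left)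
  have "X.arens ?z (X.arens ?x ?a) = X.arens (X.arens ?z ?x) ?a" using m by (simp add: X.B.mul_assoc)
  also have "X.arens ?z ?x = X.arens ?x ?z" by (rule sz_comm[OF J m(2)])
  also have "X.arens (X.arens ?x ?z) ?a = X.arens ?x ?a" using m z by (simp add: X.B.mul_assoc)
  finally show "x * a \<in> J" unfolding Mideal_mem_iff[OF J] xa .
  have "X.arens ?z (X.arens ?a ?x) = X.arens ?a ?x"
    using X.B.mul_assoc[of ?z ?a ?x] m z by simp
  then show "a * x \<in> J" unfolding Mideal_mem_iff[OF J] ax .
qed

lemma ideal_of_supp_proj:
  assumes J: "Mideal_ideal cs J"
  shows "ideal_of cs (supp_proj cs J) = J"
proof (intro equalityI subsetI)
  note p = Mideal_ideal_support(1)[OF J]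
  fix a
  show "a \<in> J" if "a \<in> ideal_of cs (supp_proj cs J)"
  proof -
    obtain \<eta> where \<eta>: "\<eta> \<in> AD.dual" "embA cs a = prodA cs (supp_proj cs J) \<eta>"
      using \<open>a \<in> ideal_of cs (supp_proj cs J)\<close> unfolding ideal_of_def bidualA_eq by blast
    have "X.emb (a, 0) = X.arens (sz J) (iota1 cs \<eta>)"
      using \<eta>(2) iota1_embA[of a] iota1_prodA[OF p, of \<eta>] by simp
    then show "a \<in> J"
      unfolding mem_iff_emb_perpperp1[OF Mideal_idealD[OF J]] using sz_perpperp[OF J iota1_mem[OF \<eta>(1)]] by simp
  qed
  assume a: "a \<in> J"
  have "embA cs a = prodA cs (supp_proj cs J) (embA cs a)"
  proof (rule iota1_inj)
    show "iota1 cs (embA cs a) = iota1 cs (prodA cs (supp_proj cs J) (embA cs a))"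
      using Mideal_mem_iff[OF J, of a] a by (simp add: iota1_prodA[OF p] iota1_embA)
  qed (simp_all add: prodA_outside AD.dual_outside[OF embA_mem])
  then show "a \<in> ideal_of cs (supp_proj cs J)"
    unfolding ideal_of_def bidualA_eq using embA_mem by blast
qed

section \<open>Values of states at supports\<close>

lemma states1_iff: "\<psi> \<in> states1 cs \<longleftrightarrow> \<psi> \<in> X.dual \<and> X.dnorm \<psi> = 1 \<and> \<psi> (0, 1) = 1"
  by (simp add: states1_def dual1_eq dnorm1_eq)

lemma state_support_bound:
  assumes J: "Mideal_ideal cs J" and \<psi>: "\<psi> \<in> states1 cs" and \<eta>: "\<eta> \<in> X.bidual" "X.bnorm \<eta> \<le> 1"
  shows "cmod (X.arens (sz J) \<eta> \<psi>) \<le> Re (sz J \<psi>)"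
proof -
  let ?z = "sz J" and ?e = "X.emb (0, 1)"
  have \<psi>D: "\<psi> \<in> X.dual" "X.dnorm \<psi> = 1" "\<psi> (0, 1) = 1" using \<psi> by (auto simp: states1_iff)
  obtain u where u: "cmod u = 1" "u * X.arens ?z \<eta> \<psi> = complex_of_real (cmod (X.arens ?z \<eta> \<psi>))"
    using unimodular_phase by blast
  \<comment> \<open>The z-part of \<zeta> is u z \<eta> and the remaining part is 1 - z, so
    |\<zeta>| \<le> 1. Then Re \<psi>(\<zeta>) \<le> 1 reads |\<psi>(z \<eta>)| + 1 - Re \<psi>(z)
    \<le> 1.\<close>
  define \<zeta> where "\<zeta> = fsm u (X.arens ?z \<eta>) + (?e - ?z)"
  have m: "?z \<in> X.bidual" "?e \<in> X.bidual" "X.arens ?z \<eta> \<in> X.bidual" 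
    using \<eta> by (auto simp: sz_mem[OF J] X.emb_mem X.arens_mem)
  have \<zeta>: "\<zeta> \<in> X.bidual" unfolding \<zeta>_def by (intro X.B.add_mem X.B.sc_mem X.B.diff_mem m)
  have "X.arens ?z (X.arens ?z \<eta>) = X.arens ?z \<eta>"
    using X.B.mul_assoc[of ?z ?z \<eta>] m \<eta> sz_idem[OF J] by simp
  then have z\<zeta>: "X.arens ?z \<zeta> = fsm u (X.arens ?z \<eta>)"
    using m by (simp add: \<zeta>_def X.B.mul_add_right X.B.mul_diff_right X.B.mul_sc_right X.B.sc_mem
        X.B.diff_mem X.B.mul_e_right sz_idem[OF J])
  have "X.bnorm \<zeta> = max (X.bnorm (fsm u (X.arens ?z \<eta>))) (X.bnorm (?e - ?z))"
    using sz_norm[OF J \<zeta>] unfolding z\<zeta> by (simp add: \<zeta>_def)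
  also have "\<dots> \<le> 1"
  proof -
    have "X.bnorm (X.arens ?z \<eta>) \<le> 1" using sz_norm[OF J \<eta>(1)] \<eta>(2) by simp
    moreover have "X.bnorm (?e - ?z) \<le> 1"
      using sz_norm[OF J m(2)] X.B.N_e m by (simp add: X.B.mul_e_right)
    ultimately show ?thesis using u m by (simp add: X.B.N_sc)
  qed
  finally have "cmod (\<zeta> \<psi>) \<le> 1" using X.D.dual_bound[OF \<zeta> \<psi>D(1)] \<psi>D(2) by simp
  then have "Re (\<zeta> \<psi>) \<le> 1" using complex_Re_le_cmod[of "\<zeta> \<psi>"] by simp
  then show ?thesis using u \<psi>D by (simp add: \<zeta>_def fsm_apply X.emb_apply)
qed

lemma state_support_nonneg:
  assumes "Mideal_ideal cs J" "\<psi> \<in> states1 cs"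
  shows "cmod (sz J \<psi>) \<le> Re (sz J \<psi>)"
  using state_support_bound[OF assms X.emb_mem[of "(0,1)"] X.B.N_e] sz_mem[OF assms(1)]
  by (simp add: X.B.mul_e_right)

lemma state_support_zero_iff:
  assumes J: "Mideal_ideal cs J" and \<psi>: "\<psi> \<in> states1 cs"
  shows "sz J \<psi> = 0 \<longleftrightarrow> (\<forall>a\<in>J. rest \<psi> a = 0)"
proof
  assume "\<forall>a\<in>J. rest \<psi> a = 0"
  moreover have "sz J \<in> perpperp1 cs J"
    using sz_perpperp[OF J sz_mem[OF J]] by (simp add: sz_idem[OF J])
  ultimately show "sz J \<psi> = 0" using \<psi> by (simp add: perpperp1_iff perp1_iff states1_iff)
next
  assume z: "sz J \<psi> = 0"
  show "\<forall>a\<in>J. rest \<psi> a = 0"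
  proof
    fix a assume a: "a \<in> J"
    define r where "r = inverse (norm a + 1)"
    have pos: "0 < norm a + 1" using norm_ge_zero[of a] by linarith
    define b where "b = cs (complex_of_real r) a"
    have r: "0 < r" "r * norm a \<le> 1" using pos by (auto simp: r_def field_simps)
    then have "norm b \<le> 1" by (simp add: b_def norm_cs)
    then have "X.bnorm (X.emb (b, 0)) \<le> 1"
      using X.bnorm_emb[of "(b, 0)"] norm1_fst_le[of b] by simp
    moreover have "b \<in> J" unfolding b_def by (intro csubspaceD(3)[OF Mideal_idealD(1)[OF J]] a)
    ultimately have "cmod (X.emb (b, 0) \<psi>) \<le> 0"
      using state_support_bound[OF J \<psi> X.emb_mem[of "(b, 0)"]] z Mideal_mem_iff[OF J, of b] by simp
    then have "rest \<psi> b = 0" using \<psi> by (simp add: X.emb_apply states1_iff rest_def)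
    then show "rest \<psi> a = 0"
      using A.dual_sc[OF rest_mem, of \<psi> a "complex_of_real r"] \<psi> r by (simp add: b_def states1_iff)
  qed
qed

lemma Mideal_subset_imp_proj_le:
  assumes J: "Mideal_ideal cs J1" "Mideal_ideal cs J2" and sub: "J1 \<subseteq> J2"
  shows "proj_le cs (supp_proj cs J1) (supp_proj cs J2)"
proof -
  note p = Mideal_ideal_support(1)[OF J(1)] Mideal_ideal_support(1)[OF J(2)]
  have "sz J1 \<in> perpperp1 cs J1" using sz_perpperp[OF J(1) sz_mem[OF J(1)]] by (simp add: sz_idem[OF J(1)])
  moreover have "perp1 cs J2 \<subseteq> perp1 cs J1" using sub unfolding subset_iff perp1_iff by blast
  ultimately have "sz J1 \<in> perpperp1 cs J2" by (auto simp: perpperp1_iff)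
  then have 1: "X.arens (sz J2) (sz J1) = sz J1" using Mideal_ideal_support(3)[OF J(2)] by simp
  then have 2: "X.arens (sz J1) (sz J2) = sz J1" using sz_comm[OF J(2) sz_mem[OF J(1)]] by simp
  show ?thesis
    unfolding proj_le_def
    by (intro conjI; rule iota1_inj)
      (simp_all add: iota1_prodA p 1 2 prodA_outside AD.dual_outside[OF p(1)])
qed

section \<open>Closed spans of families of M-ideal ideals\<close>

lemma vanishes_on_closure_cspan:
  assumes \<phi>: "\<phi> \<in> A.dual" and S: "\<And>a. a \<in> S \<Longrightarrow> \<phi> a = 0" and a: "a \<in> closure (cspan cs S)"
  shows "\<phi> a = 0"
proof -
  define V where "V = {x. \<phi> x = 0}"
  have "csubspace cs V"
    unfolding csubspace_def V_def using A.dual_zero[OF \<phi>] by (auto simp: A.dual_add[OF \<phi>] A.dual_sc[OF \<phi>])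
  then have sub: "cspan cs S \<subseteq> V" unfolding cspan_def using S by (auto simp: V_def)
  have "closed V"
    unfolding closed_sequential_limits
  proof (intro allI impI, elim conjE)
    fix x l assume x: "\<forall>n. x n \<in> V" and l: "x \<longlonglongrightarrow> l"
    have "(\<lambda>n. \<phi> (x n) - \<phi> l) \<longlonglongrightarrow> 0"
    proof (rule Lim_null_comparison)
      show "\<forall>\<^sub>F n in sequentially. norm (\<phi> (x n) - \<phi> l) \<le> A.dnorm \<phi> * norm (x n - l)"
        using A.dual_bound[OF \<phi>, of "_ - l"] by (simp add: A.dual_diff[OF \<phi>])
      show "(\<lambda>n. A.dnorm \<phi> * norm (x n - l)) \<longlonglongrightarrow> 0"
        by (rule tendsto_mult_right_zero) (use l in \<open>simp add: LIM_zero tendsto_norm_zero\<close>)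
    qed
    then have "(\<lambda>n. - \<phi> l) \<longlonglongrightarrow> 0" using x by (simp add: V_def)
    then show "l \<in> V" by (simp add: V_def LIMSEQ_const_iff)
  qed
  then have "closure (cspan cs S) \<subseteq> V" using sub by (intro closure_minimal)
  then show ?thesis using a by (auto simp: V_def)
qed

lemma subset_cspan: "S \<subseteq> cspan cs S"
  by (auto simp: cspan_def)

lemma csubspace_closure_cspan: "csubspace cs (closure (cspan cs S))"
proof -
  have sp: "csubspace cs (cspan cs S)"
    unfolding csubspace_def cspan_def by blast
  show ?thesis
    unfolding csubspace_def
  proof (intro conjI ballI allI)
    show "0 \<in> closure (cspan cs S)" using csubspaceD(1)[OF sp] closure_subset by blast
  next
    fix x y assume "x \<in> closure (cspan cs S)" "y \<in> closure (cspan cs S)"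
    then obtain u v where u: "\<And>n. u n \<in> cspan cs S" "u \<longlonglongrightarrow> x" and v: "\<And>n. v n \<in> cspan cs S" "v \<longlonglongrightarrow> y"
      unfolding closure_sequential by blast
    then show "x + y \<in> closure (cspan cs S)"
      unfolding closure_sequential using csubspaceD(2)[OF sp]
      by (intro exI[of _ "\<lambda>n. u n + v n"]) (auto intro: tendsto_add)
  next
    fix c x assume "x \<in> closure (cspan cs S)"
    then obtain u where u: "\<And>n. u n \<in> cspan cs S" "u \<longlonglongrightarrow> x" unfolding closure_sequential by blast
    have "(\<lambda>n. cs c (u n) - cs c x) \<longlonglongrightarrow> 0"
    proof (rule Lim_null_comparison)
      show "\<forall>\<^sub>F n in sequentially. norm (cs c (u n) - cs c x) \<le> cmod c * norm (u n - x)"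
        by (simp add: norm_cs flip: A.scale_right_diff_distrib)
      show "(\<lambda>n. cmod c * norm (u n - x)) \<longlonglongrightarrow> 0"
        by (rule tendsto_mult_right_zero) (use u in \<open>simp add: LIM_zero tendsto_norm_zero\<close>)
    qed
    then have "(\<lambda>n. cs c (u n)) \<longlonglongrightarrow> cs c x" by (rule LIM_zero_cancel)
    then show "cs c x \<in> closure (cspan cs S)"
      unfolding closure_sequential using csubspaceD(3)[OF sp] u
      by (intro exI[of _ "\<lambda>n. cs c (u n)"]) auto
  qed
qed

text \<open>The supremum runs over all M-central elements whose action kills the annihilator of J,
  rather than over finite joins of supports. This set is closed under joins, contains 0, which
  covers the empty family, and contains every support, so its common kernel is exactly that
  annihilator.\<close>

theorem Mideal_ideal_closure_cspan:
  assumes \<J>: "\<And>J. J \<in> \<J> \<Longrightarrow> Mideal_ideal cs J"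
  shows "Mideal_ideal cs (closure (cspan cs (\<Union>\<J>)))"
proof -
  define J where "J = closure (cspan cs (\<Union>\<J>))"
  have sub: "Ji \<subseteq> J" if "Ji \<in> \<J>" for Ji
    using that subset_cspan[of "\<Union>\<J>"] closure_subset[of "cspan cs (\<Union>\<J>)"] by (auto simp: J_def)
  define Z where "Z = {z. X.B.M_central z \<and> (\<forall>f\<in>perp1 cs J. X.lact z f = 0)}"
  have Z: "X.B.M_central z" if "z \<in> Z" for z using that by (simp add: Z_def)
  have perpD: "f \<in> X.dual" if "f \<in> perp1 cs J" for f using that by (simp add: perp1_iff)
  have lact_z: "X.lact z f x = X.arens z (X.emb x) f" if "z \<in> X.bidual" "f \<in> X.dual" for z f x
    using that by (simp add: X.arens_eq X.emb_apply X.lact_mem)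
  have zero: "0 \<in> Z"
    using X.B.M_central_zero by (simp add: Z_def X.lact_def fun_eq_iff)
  have join: "z + w - X.arens z w \<in> Z" if zw: "z \<in> Z" "w \<in> Z" for z w
  proof -
    have m: "z \<in> X.bidual" "w \<in> X.bidual" using zw by (auto simp: Z_def X.B.M_central_def)
    have "X.lact (z + w - X.arens z w) f = 0" if f: "f \<in> perp1 cs J" for f
    proof -
      have 1: "X.lact (z + w - X.arens z w) f = X.lact z f + X.lact w f - X.lact (X.arens z w) f"
        by (simp add: X.lact_def fun_eq_iff)
      have 2: "X.lact (X.arens z w) f = X.lact w (X.lact z f)" by (rule X.lact_arens[OF perpD[OF f] m])
      have 3: "X.lact w 0 = 0" using X.lact_fsm[of 0 w 0] m X.D.zero_mem by simp
      show ?thesis unfolding 1 2 using zw f 3 by (simp add: Z_def)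
    qed
    then show ?thesis using X.B.M_central_join(1)[OF Z[OF zw(1)] Z[OF zw(2)]] by (simp add: Z_def)
  qed
  have sz_Z: "sz Ji \<in> Z" if Ji: "Ji \<in> \<J>" for Ji
  proof -
    note M = \<J>[OF Ji]
    have "X.lact (sz Ji) f x = 0" if f: "f \<in> perp1 cs J" for f x
    proof -
      have "f \<in> perp1 cs Ji" using f sub[OF Ji] by (auto simp: perp1_iff)
      then show ?thesis
        using sz_perpperp[OF M X.emb_mem[of x]] lact_z[OF sz_mem[OF M] perpD[OF f], of x]
        by (simp add: perpperp1_iff)
    qed
    then show ?thesis using sz_M_central[OF M] by (auto simp: Z_def fun_eq_iff)
  qed
  obtain P where P: "X.B.M_projection P"
    "P ` X.bidual = {\<eta> \<in> X.bidual. \<forall>f\<in>X.dual. (\<forall>z\<in>Z. X.lact z f = 0) \<longrightarrow> \<eta> f = 0}"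
    "\<And>\<eta>. \<eta> \<in> X.bidual \<Longrightarrow> X.arens (P (X.emb (0, 1))) \<eta> = X.arens \<eta> (P (X.emb (0, 1)))"
    using X.M_central_supremum[of Z] Z zero join by blast
  have "f \<in> perp1 cs J" if f: "f \<in> X.dual" and z: "\<forall>z\<in>Z. X.lact z f = 0" for f
  proof -
    have "rest f a = 0" if aU: "a \<in> \<Union>\<J>" for a
    proof -
      obtain Ji where Ji: "Ji \<in> \<J>" "a \<in> Ji" using aU by auto
      note M = \<J>[OF Ji(1)]
      have "X.lact (sz Ji) f (a, 0) = 0" using z sz_Z[OF Ji(1)] by simp
      then have "X.emb (a, 0) f = 0"
        using lact_z[OF sz_mem[OF M] f, of "(a, 0)"] Mideal_mem_iff[OF M, of a] Ji(2) by simp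
      then show ?thesis using f by (simp add: X.emb_apply rest_def)
    qed
    then have "rest f a = 0" if "a \<in> J" for a
      using vanishes_on_closure_cspan[OF rest_mem[OF f], of "\<Union>\<J>" a] that by (auto simp: J_def)
    then show ?thesis using f by (simp add: perp1_iff)
  qed
  moreover have "\<forall>z\<in>Z. X.lact z f = 0" if "f \<in> perp1 cs J" for f using that by (simp add: Z_def)
  ultimately have "P ` X.bidual = perpperp1 cs J"
    unfolding P(2) using perpD by (auto simp: perpperp1_iff)
  then have "Mproj cs J P" using P(1) by (simp add: Mproj_iff)
  then show ?thesis
    unfolding Mideal_ideal_def J_def[symmetric] bidualA_eq prod1_eq one1_eq
    using P(3)[OF iota1_mem] csubspace_closure_cspan by (auto simp: J_def)
qed

end

section \<open>The quasi-state space of a scaled algebra\<close>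

locale scaled_algebra = approx_unital_algebra +
  assumes sca: "scaled cs"
begin

lemma SA_state:
  assumes "\<phi> \<in> SA cs"
  obtains \<psi> where "\<psi> \<in> states1 cs" "rest \<psi> = \<phi>" "\<phi> \<in> A.dual" "A.dnorm \<phi> = 1"
  using assms unfolding SA_def dualA_eq dnormA_eq rest_def by auto

lemma dnorm_scaled_SA:
  assumes "\<phi> \<in> SA cs" "0 \<le> t"
  shows "A.dnorm (\<lambda>a. complex_of_real t * \<phi> a) = t"
proof -
  have "\<phi> \<in> A.dual" "A.dnorm \<phi> = 1" using SA_state[OF assms(1)] by blast+
  then show ?thesis using AD.N_sc[of \<phi> "complex_of_real t"] assms(2) by (simp add: fsm_def)
qed

text \<open>Scaledness writes a member of the cone as t times a state, and t is recovered as the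
  norm, so t \<le> 1 becomes a norm bound.\<close>

lemma QA_iff: "\<phi> \<in> QA cs \<longleftrightarrow> \<phi> \<in> cA cs \<and> A.dnorm \<phi> \<le> 1"
proof
  assume "\<phi> \<in> QA cs"
  then obtain t \<phi>0 where t: "0 \<le> t" "t \<le> 1" "\<phi>0 \<in> SA cs" "\<phi> = (\<lambda>a. complex_of_real t * \<phi>0 a)"
    unfolding QA_def by blast
  then have "\<phi> \<in> cA cs" using sca unfolding scaled_def by blast
  moreover have "A.dnorm \<phi> = t"
    using dnorm_scaled_SA[OF t(3,1)] t(4) by simp
  ultimately show "\<phi> \<in> cA cs \<and> A.dnorm \<phi> \<le> 1" using t by simp
next
  assume h: "\<phi> \<in> cA cs \<and> A.dnorm \<phi> \<le> 1"
  then obtain t \<phi>0 where t: "0 \<le> t" "\<phi>0 \<in> SA cs" "\<phi> = (\<lambda>a. complex_of_real t * \<phi>0 a)"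
    using sca unfolding scaled_def by blast
  have "A.dnorm \<phi> = t"
    using dnorm_scaled_SA[OF t(2,1)] t(3) by simp
  then have "t \<le> 1" using h by simp
  with t show "\<phi> \<in> QA cs"
    unfolding QA_def mem_Collect_eq by (intro exI[of _ t] exI[of _ \<phi>0]) simp
qed

lemma QA_dual: "\<phi> \<in> QA cs \<Longrightarrow> \<phi> \<in> A.dual"
  by (simp add: QA_iff cA_def dualA_eq)

lemma QA_state:
  assumes "\<phi> \<in> QA cs"
  obtains t \<psi> where "0 \<le> t" "\<psi> \<in> states1 cs" "\<phi> = fsm (complex_of_real t) (rest \<psi>)"
proof -
  obtain t \<phi>0 where t: "0 \<le> t" "\<phi>0 \<in> SA cs" "\<phi> = (\<lambda>a. complex_of_real t * \<phi>0 a)"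
    using assms unfolding QA_def by blast
  obtain \<psi> where "\<psi> \<in> states1 cs" "rest \<psi> = \<phi>0" by (rule SA_state[OF t(2)])
  then show thesis using that[of t \<psi>] t by (simp add: fsm_def)
qed

text \<open>The restriction can have norm below 1, or be 0, and then it is outside
  \<open>SA\<close>. Its real part is nonnegative on the accretive elements, and scaledness puts it
  into Q(A).\<close>

lemma rest_state_QA:
  assumes \<psi>: "\<psi> \<in> states1 cs"
  shows "rest \<psi> \<in> QA cs"
proof -
  have "\<psi> \<in> X.dual" "X.dnorm \<psi> = 1" using \<psi> by (auto simp: states1_iff)
  moreover have "0 \<le> Re (rest \<psi> a)" if "a \<in> rA cs" for a
    using that \<psi> unfolding rA_def rest_def by blast
  ultimately show ?thesis
    using dnorm_rest[of \<psi>] rest_mem[of \<psi>] by (simp add: QA_iff cA_def dualA_eq)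
qed

lemma QA_convex:
  assumes x: "x \<in> QA cs" and y: "y \<in> QA cs" and t: "0 \<le> t" "t \<le> 1"
  shows "fsm (complex_of_real t) x + fsm (complex_of_real (1 - t)) y \<in> QA cs"
proof -
  have xy: "x \<in> A.dual" "y \<in> A.dual" "A.dnorm x \<le> 1" "A.dnorm y \<le> 1"
    "\<And>a. a \<in> rA cs \<Longrightarrow> 0 \<le> Re (x a)" "\<And>a. a \<in> rA cs \<Longrightarrow> 0 \<le> Re (y a)"
    using x y by (auto simp: QA_iff cA_def dualA_eq)
  have m: "fsm (complex_of_real t) x \<in> A.dual" "fsm (complex_of_real (1 - t)) y \<in> A.dual"
    by (intro AD.sc_mem xy)+
  have "A.dnorm (fsm (complex_of_real t) x + fsm (complex_of_real (1 - t)) y)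
      \<le> A.dnorm (fsm (complex_of_real t) x) + A.dnorm (fsm (complex_of_real (1 - t)) y)"
    by (rule AD.N_add[OF m])
  also have "\<dots> = t * A.dnorm x + (1 - t) * A.dnorm y"
    unfolding AD.N_sc[OF xy(1)] AD.N_sc[OF xy(2)] norm_of_real using t by simp
  also have "\<dots> \<le> t * 1 + (1 - t) * 1" using t xy by (intro add_mono mult_left_mono) auto
  finally have "A.dnorm (fsm (complex_of_real t) x + fsm (complex_of_real (1 - t)) y) \<le> 1" by simp
  moreover have "0 \<le> Re ((fsm (complex_of_real t) x + fsm (complex_of_real (1 - t)) y) a)"
    if "a \<in> rA cs" for a
    using xy(5,6)[OF that] t by (simp add: fsm_apply del: of_real_diff)
  ultimately show ?thesis using AD.add_mem[OF m] by (simp add: QA_iff cA_def dualA_eq)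
qed

lemma supp_proj_state:
  assumes J: "Mideal_ideal cs J" and \<psi>: "\<psi> \<in> states1 cs"
  shows "supp_proj cs J (fsm c (rest \<psi>)) = c * sz J \<psi>"
  using AD.dual_sc[OF Mideal_ideal_support(1)[OF J] rest_mem, of \<psi> c] \<psi>
  by (simp add: iota1_apply states1_iff)

lemma supp_proj_nonneg:
  assumes J: "Mideal_ideal cs J" and \<phi>: "\<phi> \<in> QA cs"
  shows "cmod (supp_proj cs J \<phi>) \<le> Re (supp_proj cs J \<phi>)"
proof -
  obtain t \<psi> where t: "0 \<le> t" "\<psi> \<in> states1 cs" "\<phi> = fsm (complex_of_real t) (rest \<psi>)"
    by (rule QA_state[OF \<phi>])
  then show ?thesis
    using state_support_nonneg[OF J t(2)] by (simp add: supp_proj_state[OF J] norm_mult mult_left_mono)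
qed

lemma Fp_supp_proj:
  assumes J: "Mideal_ideal cs J"
  shows "Fp cs (supp_proj cs J) = QA cs \<inter> perpA cs J"
proof -
  have "supp_proj cs J \<phi> = 0 \<longleftrightarrow> \<phi> \<in> perpA cs J" if \<phi>: "\<phi> \<in> QA cs" for \<phi>
  proof -
    obtain t \<psi> where t: "0 \<le> t" "\<psi> \<in> states1 cs" "\<phi> = fsm (complex_of_real t) (rest \<psi>)"
      by (rule QA_state[OF \<phi>])
    have "supp_proj cs J \<phi> = complex_of_real t * sz J \<psi>" using supp_proj_state[OF J t(2)] t(3) by simp
    then have "supp_proj cs J \<phi> = 0 \<longleftrightarrow> t = 0 \<or> (\<forall>a\<in>J. rest \<psi> a = 0)"
      using state_support_zero_iff[OF J t(2)] by simp
    also have "\<dots> \<longleftrightarrow> \<phi> \<in> perpA cs J"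
      using QA_dual[OF \<phi>] by (auto simp: perpA_def dualA_eq t(3) fsm_apply)
    finally show ?thesis .
  qed
  then show ?thesis unfolding Fp_def by blast
qed

lemma fface_Fp:
  assumes J: "Mideal_ideal cs J"
  shows "fface (Fp cs (supp_proj cs J)) (QA cs)"
proof -
  let ?p = "supp_proj cs J"
  have comb: "(\<lambda>a. complex_of_real t * x a + (1 - complex_of_real t) * y a)
      = fsm (complex_of_real t) x + fsm (complex_of_real (1 - t)) y" for t and x y :: "'a \<Rightarrow> complex"
    by (simp add: fun_eq_iff fsm_apply)
  have p: "?p (fsm (complex_of_real t) x + fsm (complex_of_real (1 - t)) y)
      = complex_of_real t * ?p x + complex_of_real (1 - t) * ?p y" if "x \<in> QA cs" "y \<in> QA cs" for x y t
    using Mideal_ideal_support(1)[OF J] that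
    by (simp only: AD.dual_add AD.dual_sc AD.sc_mem QA_dual)
  \<comment> \<open>Both values are nonnegative reals by \<open>supp_proj_nonneg\<close>, so
    positive weights leave no room for cancellation.\<close>
  have ext: "?p x = 0 \<and> ?p y = 0"
    if xy: "x \<in> QA cs" "y \<in> QA cs" and t: "0 < t" "t < 1"
      and 0: "complex_of_real t * ?p x + complex_of_real (1 - t) * ?p y = 0" for x y t
  proof -
    have nn: "cmod (?p x) \<le> Re (?p x)" "cmod (?p y) \<le> Re (?p y)"
      using supp_proj_nonneg[OF J] xy by auto
    have R: "0 \<le> Re (?p x)" "0 \<le> Re (?p y)"
      using nn norm_ge_zero[of "?p x"] norm_ge_zero[of "?p y"] by linarith+
    have "t * Re (?p x) + (1 - t) * Re (?p y) = 0"
      using arg_cong[OF 0, of Re] by (simp del: of_real_diff)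
    moreover have "0 \<le> t * Re (?p x)" "0 \<le> (1 - t) * Re (?p y)" using R t by auto
    ultimately have "t * Re (?p x) = 0" "(1 - t) * Re (?p y) = 0" by linarith+
    then show ?thesis using nn t by simp
  qed
  show ?thesis
    unfolding fface_def
  proof (intro conjI ballI allI impI)
    show "Fp cs ?p \<subseteq> QA cs" by (auto simp: Fp_def)
  next
    fix x y and t :: real
    \<comment> \<open>In \<open>fface\<close> the coercion of t reaches into the inequalities, which
      are therefore read in the order of the complex numbers.\<close>
    assume "x \<in> Fp cs ?p" "y \<in> Fp cs ?p" "0 \<le> complex_of_real t \<and> complex_of_real t \<le> 1"
    then show "(\<lambda>a. complex_of_real t * x a + (1 - complex_of_real t) * y a) \<in> Fp cs ?p"
      using QA_convex[of x y t] p[of x y t]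
      by (auto simp: Fp_def comb less_eq_complex_def simp del: of_real_diff)
  next
    fix x y and t :: real
    assume xy: "x \<in> QA cs" "y \<in> QA cs"
      and t: "0 < complex_of_real t \<and> complex_of_real t < 1 \<and>
        (\<lambda>a. complex_of_real t * x a + (1 - complex_of_real t) * y a) \<in> Fp cs ?p"
    then have "?p x = 0 \<and> ?p y = 0"
      using p[OF xy, of t]
      by (intro ext[of x y t]) (auto simp: Fp_def comb less_complex_def simp del: of_real_diff)
    then show "x \<in> Fp cs ?p" "y \<in> Fp cs ?p" using xy by (auto simp: Fp_def)
  qed
qed

lemma wstar_closed_Fp:
  assumes J: "Mideal_ideal cs J"
  shows "wstar_closed cs (Fp cs (supp_proj cs J))"
proof -
  \<comment> \<open>Every condition is closed under pointwise convergence. The bound on the dual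
    norm appears as |\<phi> a| \<le> |a| for each a, since the dual norm need not be continuous in
    this topology.\<close>
  define C where "C = (\<Inter>a\<in>rA cs. {\<phi>::'a \<Rightarrow> complex. 0 \<le> Re (\<phi> a)}) \<inter> (\<Inter>a. {\<phi>. cmod (\<phi> a) \<le> norm a})
    \<inter> (\<Inter>a\<in>J. {\<phi>. \<phi> a = 0})"
  have cont: "continuous_on UNIV (\<lambda>\<phi>::'a \<Rightarrow> complex. \<phi> a)" for a
    by (rule continuous_on_product_coordinates)
  have "closed C"
    unfolding C_def
    by (intro closed_Int closed_INT ballI closed_Collect_le closed_Collect_eq continuous_intros cont)
  moreover have "Fp cs (supp_proj cs J) = A.dual \<inter> C"
  proof (intro equalityI subsetI)
    fix \<phi> assume "\<phi> \<in> Fp cs (supp_proj cs J)"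
    then have h: "\<phi> \<in> A.dual" "A.dnorm \<phi> \<le> 1" "\<And>a. a \<in> rA cs \<Longrightarrow> 0 \<le> Re (\<phi> a)" "\<And>a. a \<in> J \<Longrightarrow> \<phi> a = 0"
      by (auto simp: Fp_supp_proj[OF J] QA_iff cA_def dualA_eq perpA_def)
    have "cmod (\<phi> a) \<le> norm a" for a
      using A.dual_bound[OF h(1), of a] mult_right_mono[OF h(2) norm_ge_zero[of a]] by simp
    then show "\<phi> \<in> A.dual \<inter> C" using h by (auto simp: C_def)
  next
    fix \<phi> assume h: "\<phi> \<in> A.dual \<inter> C"
    then have "A.dnorm \<phi> \<le> 1" by (intro A.dnorm_least) (auto simp: C_def)
    then show "\<phi> \<in> Fp cs (supp_proj cs J)"
      using h by (auto simp: Fp_supp_proj[OF J] QA_iff cA_def dualA_eq perpA_def C_def)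
  qed
  ultimately show ?thesis unfolding wstar_closed_def dualA_eq by (auto simp: closedin_closed)
qed

text \<open>A point b of J1 outside J2 would be seen by a state of A^1/J2. Pulled back to A^1 and
  restricted to A, this state lies in the face of J2 but does not vanish at b, so it lies outside
  the face of J1.\<close>

lemma Fp_subset_imp_subset:
  assumes J1: "Mideal_ideal cs J1" and J2: "Mideal_ideal cs J2"
    and sub: "Fp cs (supp_proj cs J2) \<subseteq> Fp cs (supp_proj cs J1)"
  shows "J1 \<subseteq> J2"
proof
  fix b assume b: "b \<in> J1"
  define W where "W = (\<lambda>a. (a, 0::complex)) ` J2"
  note sp = csubspaceD[OF Mideal_idealD(1)[OF J2]]
  have W: "0 \<in> W" "\<And>x y. x \<in> W \<Longrightarrow> y \<in> W \<Longrightarrow> x + y \<in> W" "\<And>c x. x \<in> W \<Longrightarrow> sm1 cs c x \<in> W"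
    using sp by (auto simp: W_def sm1_def zero_prod_def)
  have ideal: "mult1 cs x y \<in> W" "mult1 cs y x \<in> W" if x: "x \<in> W" for x y
  proof -
    obtain a where "a \<in> J2" "x = (a, 0)" using x by (auto simp: W_def)
    then show "mult1 cs x y \<in> W" "mult1 cs y x \<in> W"
      using sp Mideal_two_sided[OF J2] by (auto simp: W_def mult1_def A.scale_zero_left)
  qed
  interpret Q: real_cseminormed_algebra "sm1 cs" "X.qnorm W" "mult1 cs" "(0, 1)"
    by (rule X.real_cseminormed_algebra_qnorm[OF W ideal])
  have q0: "X.qnorm W (b, 0) = 0"
  proof (rule ccontr)
    assume "X.qnorm W (b, 0) \<noteq> 0"
    then obtain F where F: "F \<in> Q.dual" "\<And>x. cmod (F x) \<le> X.qnorm W x" "F (0, 1) = 1" "F (b, 0) \<noteq> 0"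
      using Q.states_separate by blast
    have le: "cmod (F x) \<le> 1 * norm1 cs x" for x
      using F(2)[of x] X.qnorm_le_N[OF W, of x] by simp
    have FX: "F \<in> X.dual"
      by (rule X.dualI[OF _ _ le]) (use Q.dual_add[OF F(1)] Q.dual_sc[OF F(1)] in auto)
    moreover have "X.dnorm F \<le> 1" by (rule X.dnorm_least) (use le in auto)
    moreover have "1 \<le> X.dnorm F"
      using X.dnorm_upper[OF FX, of "(0, 1)"] X.N_e F(3) by simp
    ultimately have st: "F \<in> states1 cs" using F(3) by (simp add: states1_iff)
    have "rest F a = 0" if "a \<in> J2" for a
      using F(2)[of "(a, 0)"] X.qnorm_subspace[OF W, of "(a, 0)"] that by (auto simp: W_def rest_def)
    then have "rest F \<in> Fp cs (supp_proj cs J2)"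
      using rest_state_QA[OF st] rest_mem[OF FX] by (simp add: Fp_supp_proj[OF J2] perpA_def dualA_eq)
    then have "rest F \<in> perpA cs J1" using sub by (auto simp: Fp_supp_proj[OF J1])
    then show False using b F(4) by (simp add: perpA_def rest_def)
  qed
  have "b \<in> closure J2"
    unfolding closure_approachable
  proof (intro allI impI)
    fix d :: real assume d: "0 < d"
    then obtain w where w: "w \<in> W" "norm1 cs ((b, 0) - w) < d"
      using X.qnorm_approx[OF W, of "(b, 0)" d] q0 by auto
    then obtain a where a: "a \<in> J2" "norm1 cs (b - a, 0) < d" by (auto simp: W_def)
    have "norm (b - a) \<le> norm1 cs (b - a, 0)" by (rule norm_le_norm1)
    then show "\<exists>y\<in>J2. dist y b < d" using a by (intro bexI[of _ a]) (auto simp: dist_norm norm_minus_commute)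
  qed
  then show "b \<in> J2" using Mideal_idealD(2)[OF J2] by simp
qed

lemma proj_le_iff:
  assumes J: "Mideal_ideal cs J1" "Mideal_ideal cs J2"
  shows "proj_le cs (supp_proj cs J1) (supp_proj cs J2)
    \<longleftrightarrow> Fp cs (supp_proj cs J2) \<subseteq> Fp cs (supp_proj cs J1)"
proof
  assume "Fp cs (supp_proj cs J2) \<subseteq> Fp cs (supp_proj cs J1)"
  then show "proj_le cs (supp_proj cs J1) (supp_proj cs J2)"
    by (intro Mideal_subset_imp_proj_le J Fp_subset_imp_subset)
next
  assume le: "proj_le cs (supp_proj cs J1) (supp_proj cs J2)"
  have "sz J1 = X.arens (sz J2) (sz J1)"
    using le iota1_prodA[OF Mideal_ideal_support(1)[OF J(2)], of "supp_proj cs J1"] by (simp add: proj_le_def)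
  then have z: "sz J1 \<in> perpperp1 cs J2" using sz_perpperp[OF J(2) sz_mem[OF J(1)]] by simp
  show "Fp cs (supp_proj cs J2) \<subseteq> Fp cs (supp_proj cs J1)"
  proof
    fix \<phi> assume \<phi>: "\<phi> \<in> Fp cs (supp_proj cs J2)"
    then have Q: "\<phi> \<in> QA cs" "\<phi> \<in> perpA cs J2" by (auto simp: Fp_supp_proj[OF J(2)])
    obtain t \<psi> where t: "0 \<le> t" "\<psi> \<in> states1 cs" "\<phi> = fsm (complex_of_real t) (rest \<psi>)"
      by (rule QA_state[OF Q(1)])
    have "supp_proj cs J1 \<phi> = 0"
    \<comment> \<open>For t = 0 the functional \<phi> is 0 and says nothing about the representing
      state, so only t \<noteq> 0 puts that state into the annihilator of J2.\<close>
    proof (cases "t = 0")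
      case False
      then have "\<psi> \<in> perp1 cs J2"
        using Q(2) t by (auto simp: perpA_def perp1_iff states1_iff fsm_apply)
      then show ?thesis using z t supp_proj_state[OF J(1) t(2)] by (simp add: perpperp1_iff)
    qed (use AD.dual_zero[OF Mideal_ideal_support(1)[OF J(1)]] t in simp)
    then show "\<phi> \<in> Fp cs (supp_proj cs J1)" using Q(1) by (simp add: Fp_def)
  qed
qed

text \<open>\<open>QA cs\<close> is intersected on the right so that the empty family yields the
  face of the zero ideal, which is all of Q(A), and not the universal set.\<close>

lemma Fp_closure_cspan:
  assumes \<J>: "\<And>J. J \<in> \<J> \<Longrightarrow> Mideal_ideal cs J"
  shows "Fp cs (supp_proj cs (closure (cspan cs (\<Union>\<J>)))) = QA cs \<inter> (\<Inter>J\<in>\<J>. Fp cs (supp_proj cs J))"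
proof -
  let ?J = "closure (cspan cs (\<Union>\<J>))"
  have "\<phi> \<in> perpA cs ?J \<longleftrightarrow> (\<forall>J\<in>\<J>. \<phi> \<in> perpA cs J)" if \<phi>: "\<phi> \<in> A.dual" for \<phi>
  proof
    assume "\<phi> \<in> perpA cs ?J"
    moreover have "J \<subseteq> ?J" if "J \<in> \<J>" for J
      using that subset_cspan[of "\<Union>\<J>"] closure_subset[of "cspan cs (\<Union>\<J>)"] by auto
    ultimately show "\<forall>J\<in>\<J>. \<phi> \<in> perpA cs J" by (auto simp: perpA_def)
  next
    assume "\<forall>J\<in>\<J>. \<phi> \<in> perpA cs J"
    then have "\<phi> a = 0" if "a \<in> ?J" for a
      using vanishes_on_closure_cspan[OF \<phi> _ that] by (auto simp: perpA_def)
    then show "\<phi> \<in> perpA cs ?J" using \<phi> by (simp add: perpA_def dualA_eq)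
  qed
  then show ?thesis
    using \<J> QA_dual by (auto simp: Fp_supp_proj[OF Mideal_ideal_closure_cspan[OF \<J>]] Fp_supp_proj)
qed

end

text \<open>The last conjunct also asserts that the closed span is an M-ideal ideal, which
  guarantees that the choice in its \<open>supp_proj\<close> has a witness.\<close>

theorem theorem8p5:
  fixes cs :: "complex \<Rightarrow> 'a::{real_normed_algebra,banach} \<Rightarrow> 'a"
  assumes "cbanach_alg cs"
    and "approx_unital TYPE('a)"
    and "scaled cs"
  shows
    "(\<forall>p. central_open_proj cs p \<longrightarrow>
        Fp cs p = QA cs \<inter> perpA cs (ideal_of cs p) \<and>
        fface (Fp cs p) (QA cs) \<and> wstar_closed cs (Fp cs p))
     \<and> (\<forall>p1 p2. central_open_proj cs p1 \<and> central_open_proj cs p2 \<longrightarrow>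
          (Fp cs p1 = Fp cs p2 \<longrightarrow> p1 = p2) \<and>
          (proj_le cs p1 p2 \<longleftrightarrow> Fp cs p2 \<subseteq> Fp cs p1))
     \<and> (\<forall>J1 J2. Mideal_ideal cs J1 \<and> Mideal_ideal cs J2 \<longrightarrow>
          Fp cs (supp_proj cs J1) = Fp cs (supp_proj cs J2) \<longrightarrow> J1 = J2)
     \<and> (\<forall>\<J>. (\<forall>J\<in>\<J>. Mideal_ideal cs J) \<longrightarrow>
          (let J = closure (cspan cs (\<Union>\<J>)) in
             Mideal_ideal cs J \<and>
             Fp cs (supp_proj cs J) = QA cs \<inter> (\<Inter>Ji\<in>\<J>. Fp cs (supp_proj cs Ji))))"
proof -
  interpret scaled_algebra cs by unfold_locales (rule assms)+
  have inj: "J1 = J2" if "Mideal_ideal cs J1" "Mideal_ideal cs J2"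
    "Fp cs (supp_proj cs J1) = Fp cs (supp_proj cs J2)" for J1 J2
    using Fp_subset_imp_subset[of J1 J2] Fp_subset_imp_subset[of J2 J1] that by auto
  show ?thesis
  proof (intro conjI allI impI)
    fix p assume "central_open_proj cs p"
    then obtain J where J: "Mideal_ideal cs J" "p = supp_proj cs J" unfolding central_open_proj_def by blast
    show "Fp cs p = QA cs \<inter> perpA cs (ideal_of cs p)"
      using Fp_supp_proj[OF J(1)] ideal_of_supp_proj[OF J(1)] J(2) by simp
    show "fface (Fp cs p) (QA cs)" "wstar_closed cs (Fp cs p)"
      using fface_Fp[OF J(1)] wstar_closed_Fp[OF J(1)] J(2) by simp_all
  next
    fix p1 p2 assume "central_open_proj cs p1 \<and> central_open_proj cs p2"
    then obtain J1 J2 where J: "Mideal_ideal cs J1" "p1 = supp_proj cs J1"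
      "Mideal_ideal cs J2" "p2 = supp_proj cs J2" unfolding central_open_proj_def by blast
    show "p1 = p2" if "Fp cs p1 = Fp cs p2" using inj[OF J(1,3)] that J by simp
    show "proj_le cs p1 p2 \<longleftrightarrow> Fp cs p2 \<subseteq> Fp cs p1" using proj_le_iff[OF J(1,3)] J by simp
  next
    fix J1 J2 assume "Mideal_ideal cs J1 \<and> Mideal_ideal cs J2"
      "Fp cs (supp_proj cs J1) = Fp cs (supp_proj cs J2)"
    then show "J1 = J2" using inj by blast
  next
    fix \<J> assume "\<forall>J\<in>\<J>. Mideal_ideal cs J"
    then show "let J = closure (cspan cs (\<Union>\<J>)) in Mideal_ideal cs J \<and>
        Fp cs (supp_proj cs J) = QA cs \<inter> (\<Inter>Ji\<in>\<J>. Fp cs (supp_proj cs Ji))"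
      using Mideal_ideal_closure_cspan[of \<J>] Fp_closure_cspan[of \<J>] by (simp add: Let_def)
  qed
qed

end
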